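(* In the AD-PSGD setting described in the context, let $\gamma>0$ be such that $C_3\leqslant 1$, $C_2\geqslant 0$ and $C_1>0$. Then $$\frac{\sum_{k=0}^{K-1}\mathbb{E}\left\|\nabla f\left(\frac{X_k\mathbf{1}_n}{n}\right)\right\|^2}{K}\leqslant \frac{2(\mathbb{E}f(x_0)-\mathbb{E}f^{*})\,n}{\gamma K M}+\frac{2\gamma L}{n}\left(\sigma^2+6M\varsigma^2\right).$$
   Context: Notation: $\|\cdot\|$ is the vector $\ell_2$ norm (or matrix spectral norm); $\mathbf{1}_n\in\mathbb{R}^n$ is the all-ones column vector; $\lambda_i(\cdot)$ is the $i$-th largest eigenvalue. Problem. There are $n$ workers. Worker $i$ has a data distribution $\mathcal{D}_i$ and a local loss $f_i(x)=\mathbb{E}_{\xi\sim\mathcal{D}_i}F_i(x;\xi)$ on $\mathbb{R}^N$; the stochastic gradient computed by worker $i$ at $x$ from the sample $\xi\sim\mathcal{D}_i$ is written $\nabla F(x;\xi)$. Let $p_1,\dots,p_n\ge 0$, $\sum_i p_i=1$, define a distribution $\mathcal{I}$ on $\{1,\dots,n\}$. The problem is $\min_{x\in\mathbb{R}^N} f(x):=\mathbb{E}_{i\sim\mathcal{I}}f_i(x)=\sum_{i=1}^n p_i f_i(x)$, with optimal value $f^*$. Algorithm (AD-PSGD). Let $M\ge 1$ be the batch size, $K\ge 1$ the number of iterations, $\gamma>0$ the learning rate. Local models at iteration $k$ are the columns of $X_k=[x_k^1\ \cdots\ x_k^n]\in\mathbb{R}^{N\times n}$. All workers start from the same model: $x_0^i=x_0$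 for all $i$. For $k=0,1,2,\dots$, $$X_{k+1}=X_kW_k-\gamma\,\partial g(\hat X_k;\xi_k^{i_k},i_k),$$ where $i_k\sim\mathcal{I}$ is the worker performing the $k$-th update, $W_k\in\mathbb{R}^{n\times n}$ is a random averaging matrix, $\xi_k^{i}=(\xi_{k,1}^{i},\dots,\xi_{k,M}^{i})$ is a batch of independent samples from $\mathcal{D}_i$, $\hat X_k=[\hat x_k^1\ \cdots\ \hat x_k^n]=X_{k-\tau_k}$ for a nonnegative integer $\tau_k$ (with $\tau_k\le k$), and $\partial g(\hat X_k;\xi_k^{i_k},i_k)\in\mathbb{R}^{N\times n}$ has $i_k$-th column $\sum_{j=1}^M\nabla F(\hat x_k^{i_k};\xi_{k,j}^{i_k})$ and all other columns $0$. Standing assumptions. 1. Each $f_i$ has $L$-Lipschitz gradient. 2. $W_k$ is doubly stochastic for all $k$. 3. There is $\rho\in[0,1)$ with $\max\{|\lambda_2(\mathbb{E}[W_k^\top W_k])|,|\lambda_n(\mathbb{E}[W_k^\top W_k])|\}\le\rho$ for all $k$. 4. $\mathbb{E}_{\xi\sim\mathcal{D}_i}\nabla F(x;\xi)=\nabla f_i(x)$ and $\mathbb{E}_{i\sim\mathcal{I}}\mathbb{E}_{\xi\sim\mathcal{D}_i}\nabla F(x;\xi)=\nabla f(x)$. 5. There are constants $\sigma,\varsigma\ge 0$ with $\mathbb{E}_{\xi\sim\mathcal{D}_i}\|\nabla F(x;\xi)-\nabla f_i(x)\|^2\le\sigma^2$ for all $i,x$, and $\mathbb{E}_{i\sim\mathcal{I}}\|\nabla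 f_i(x)-\nabla f(x)\|^2\le\varsigma^2$ for all $x$. 6. The random variables $\xi_k,i_k$ ($k=0,1,2,\dots$) are independent; $W_k$ is a random variable that may depend on $i_k$ (but the pairs $(i_k,W_k)$ are independent across $k$ and independent of the samples $\xi$). 7. There is a constant $T$ with $\max_k\tau_k\le T$. Constants: $$\bar\rho:=\frac{n-1}{n}\left(\frac{1}{1-\rho}+\frac{2\sqrt\rho}{(1-\sqrt\rho)^2}\right),\qquad C_1:=1-24M^2L^2\gamma^2\left(T\frac{n-1}{n}+\bar\rho\right),$$ $$C_2:=\frac{\gamma M}{2n}-\frac{\gamma^2LM^2}{n^2}-\frac{2M^3L^2T^2\gamma^3}{n^3}-\left(\frac{6\gamma^2L^3M^2}{n^2}+\frac{\gamma M}{n}L^2+\frac{12M^3L^4T^2\gamma^3}{n^3}\right)\frac{4M^2\gamma^2\left(T\frac{n-1}{n}+\bar\rho\right)}{C_1},$$ $$C_3:=\frac12+\frac{2\left(6\gamma^2L^2M^2+\gamma nML+\frac{12M^3L^3T^2\gamma^3}{n}\right)\bar\rho}{C_1}+\frac{LT^2\gamma M}{n}.$$ *)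

theory Defs
  imports "HOL-Probability.Probability" "HOL-Computational_Algebra.Polynomial"
begin

(* Only meaningful where h is differentiable. *)
definition gradient :: "('a::real_inner \<Rightarrow> real) \<Rightarrow> 'a \<Rightarrow> 'a" where
  "gradient h x = (THE d. GDERIV h x :> d)"

definition local_loss ::
  "('n \<Rightarrow> 's measure) \<Rightarrow> ('n \<Rightarrow> 'a \<Rightarrow> 's \<Rightarrow> real) \<Rightarrow> 'n \<Rightarrow> 'a \<Rightarrow> real" where
  "local_loss D F i x = (\<integral>s. F i x s \<partial>D i)"

definition global_loss ::
  "('n::finite \<Rightarrow> real) \<Rightarrow> ('n \<Rightarrow> 's measure) \<Rightarrow> ('n \<Rightarrow> 'a \<Rightarrow> 's \<Rightarrow> real) \<Rightarrow> 'a \<Rightarrow> real" where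
  "global_loss p D F x = (\<Sum>i\<in>UNIV. p i * local_loss D F i x)"

definition stoch_grad ::
  "('n \<Rightarrow> 'a::real_inner \<Rightarrow> 's \<Rightarrow> real) \<Rightarrow> 'n \<Rightarrow> 'a \<Rightarrow> 's \<Rightarrow> 'a" where
  "stoch_grad F i x s = gradient (\<lambda>y. F i y s) x"

definition doubly_stochastic :: "real^'n^'n \<Rightarrow> bool" where
  "doubly_stochastic A \<longleftrightarrow>
     (\<forall>i j. 0 \<le> A $ i $ j) \<and> (\<forall>i. (\<Sum>j\<in>UNIV. A $ i $ j) = 1) \<and> (\<forall>j. (\<Sum>i\<in>UNIV. A $ i $ j) = 1)"

definition charpoly :: "real^'n^'n \<Rightarrow> real poly" where
  "charpoly A = det (mat [:0, 1:] - (\<chi> i j. [:A $ i $ j:]))"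

(* Real eigenvalues counted with algebraic multiplicity, in decreasing order; the index starts
   at 1. For a symmetric matrix of size n all n eigenvalues occur, so that the value is
   meaningful for 1 <= i <= n. *)
definition nth_largest_eigenvalue :: "nat \<Rightarrow> real^'n^'n \<Rightarrow> real" where
  "nth_largest_eigenvalue i A = rev (sorted_list_of_multiset (proots (charpoly A))) ! (i - 1)"

(* X holds the models of the workers in its columns; s is a batch of m samples. *)
definition batch_grad ::
  "('n \<Rightarrow> real^'d \<Rightarrow> 's \<Rightarrow> real) \<Rightarrow> nat \<Rightarrow> real^'n^'d \<Rightarrow> (nat \<Rightarrow> 's) \<Rightarrow> 'n \<Rightarrow> real^'n^'d" where
  "batch_grad F m X s i =
     (\<chi> r c. if c = i then (\<Sum>j<m. stoch_grad F i (column i X) (s j)) $ r else 0)"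

definition average_model :: "real^'n^'d \<Rightarrow> real^'d" where
  "average_model X = (1 / real CARD('n)) *\<^sub>R (X *v (\<chi> i. 1))"

datatype source = Initial | Select nat | Batch nat

(* The sigma-algebras generated by the initial model, by the pair (i_k, W_k), and by the
   batches of all workers at iteration k. The library's indep_vars does not apply directly
   because these random variables have different types; its unfolding in terms of
   indep_sets does. *)
fun source_events ::
  "'w measure \<Rightarrow> ('n::finite \<Rightarrow> 's measure) \<Rightarrow> nat \<Rightarrow> ('w \<Rightarrow> real^'d) \<Rightarrow> (nat \<Rightarrow> 'w \<Rightarrow> 'n) \<Rightarrow>
   (nat \<Rightarrow> 'w \<Rightarrow> real^'n^'n) \<Rightarrow> (nat \<Rightarrow> 'n \<Rightarrow> nat \<Rightarrow> 'w \<Rightarrow> 's) \<Rightarrow> source \<Rightarrow> 'w set set" where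
  "source_events P D m x0 I W \<xi> Initial =
     {x0 -` A \<inter> space P | A. A \<in> sets borel}"
| "source_events P D m x0 I W \<xi> (Select k) =
     {(\<lambda>\<omega>. (I k \<omega>, W k \<omega>)) -` A \<inter> space P | A. A \<in> sets (count_space UNIV \<Otimes>\<^sub>M borel)}"
| "source_events P D m x0 I W \<xi> (Batch k) =
     {(\<lambda>\<omega>. \<lambda>(i, j)\<in>UNIV \<times> {..<m}. \<xi> k i j \<omega>) -` A \<inter> space P
        | A. A \<in> sets (\<Pi>\<^sub>M (i, j)\<in>UNIV \<times> {..<m}. D i)}"

definition rho_bar :: "real \<Rightarrow> real \<Rightarrow> real" where
  "rho_bar n \<rho> = (n - 1) / n * (1 / (1 - \<rho>) + 2 * sqrt \<rho> / (1 - sqrt \<rho>)^2)"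

definition C1 :: "real \<Rightarrow> real \<Rightarrow> real \<Rightarrow> real \<Rightarrow> real \<Rightarrow> real \<Rightarrow> real" where
  "C1 n M L T \<rho> \<gamma> = 1 - 24 * M^2 * L^2 * \<gamma>^2 * (T * ((n - 1) / n) + rho_bar n \<rho>)"

definition C2 :: "real \<Rightarrow> real \<Rightarrow> real \<Rightarrow> real \<Rightarrow> real \<Rightarrow> real \<Rightarrow> real" where
  "C2 n M L T \<rho> \<gamma> =
     \<gamma> * M / (2 * n) - \<gamma>^2 * L * M^2 / n^2 - 2 * M^3 * L^2 * T^2 * \<gamma>^3 / n^3
     - (6 * \<gamma>^2 * L^3 * M^2 / n^2 + \<gamma> * M / n * L^2 + 12 * M^3 * L^4 * T^2 * \<gamma>^3 / n^3)
       * (4 * M^2 * \<gamma>^2 * (T * ((n - 1) / n) + rho_bar n \<rho>) / C1 n M L T \<rho> \<gamma>)"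

definition C3 :: "real \<Rightarrow> real \<Rightarrow> real \<Rightarrow> real \<Rightarrow> real \<Rightarrow> real \<Rightarrow> real" where
  "C3 n M L T \<rho> \<gamma> =
     1 / 2
     + 2 * (6 * \<gamma>^2 * L^2 * M^2 + \<gamma> * n * M * L + 12 * M^3 * L^3 * T^2 * \<gamma>^3 / n)
         * rho_bar n \<rho> / C1 n M L T \<rho> \<gamma>
     + L * T^2 * \<gamma> * M / n"

end

theory Submission
  imports Defs
begin

text \<open>
  Averaging with a doubly stochastic matrix and adding one worker's batch moves the mean
  model by \<open>- \<gamma>/n\<close> times that batch, so the mean model performs stochastic gradient descent
  on the global loss, except that gradients are taken at outdated local models. Descent for
  a function with Lipschitz gradient (\<open>lipschitz_gradient_upper_bound\<close>) turns this into
  \<open>expected_descent\<close>: per step the expected loss drops by a multiple of the squared global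
  gradient plus the squared mean of the local gradients, up to three errors, namely the
  second moment of the batch, the drift of the mean model during the delay, and the
  disagreement between the local models. The drift is a sum of at most \<open>T\<close> earlier batches
  (\<open>expected_drift\<close>), and the second moment of a batch is a constant plus multiples of the
  disagreement and of the squared mean of the local gradients (\<open>update_controlled\<close>).
  Everything hinges on bounding the disagreement.

  For a fixed direction \<open>u\<close> orthogonal to the all-ones vector put \<open>Y = X\<^sub>k W\<^sub>k u\<close>. The
  vector \<open>W\<^sub>k u\<close> is again orthogonal to the all-ones vector and is independent of \<open>X\<^sub>k\<close>, so
  a bound \<open>E |X\<^sub>k w|\<^sup>2 \<le> \<beta>\<^sub>k |w|\<^sup>2\<close> for all deterministic such \<open>w\<close> yields
  \<open>E |Y|\<^sup>2 \<le> \<rho> \<beta>\<^sub>k |u|\<^sup>2\<close> (\<open>averaging_contracts\<close>). This is where the spectral assumption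
  enters: orthogonally to the all-ones vector, the second largest eigenvalue bounds the
  quadratic form of \<open>E[W\<^sup>T W]\<close> (\<open>quadratic_form_le_second_eigenvalue\<close>). It is essential to
  propagate the bound for all directions at once: batches depend on earlier averaging
  matrices through the delayed models, so that expanding \<open>X\<^sub>k\<close> as a sum over all earlier
  batches would produce products of dependent factors. Splitting \<open>X\<^bsub>k+1\<^esub> u\<close> into the
  averaged part and the new batch with weights \<open>r = sqrt \<rho>\<close> and \<open>1 - r\<close> gives
  \<open>\<beta>\<^bsub>k+1\<^esub> = r \<beta>\<^sub>k + \<gamma>\<^sup>2 E |batch|\<^sup>2 / (1 - r)\<close> (\<open>controlled_Suc\<close>). Summed over \<open>k\<close> this
  costs a factor \<open>1 / (1 - r)\<^sup>2\<close>, which together with \<open>(n - 1)/n\<close> stays below the constant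
  \<open>rho_bar\<close>.

  These recursions involve only real numbers, and \<open>rate_from_recursions\<close> solves them: the
  disagreement is eliminated, the squared mean of the local gradients ends up with a
  nonpositive coefficient, and the noise terms add up to the second summand of the claim. A
  delayed index is hit at most \<open>T + 1\<close> times, so the disagreement comes with the factor
  \<open>(T + 1) rho_bar\<close> rather than the \<open>T (n - 1)/n + rho_bar\<close> in the constants \<open>C1\<close> and \<open>C2\<close>.
  The difference is affordable (\<open>step_size_consequences\<close>): for \<open>n \<ge> 2\<close> the condition
  \<open>C3 \<le> 1\<close> bounds both \<open>\<gamma> M L n rho_bar\<close> and \<open>\<gamma> M L T\<^sup>2 / n\<close>, hence the product in which \<open>T\<close>
  meets \<open>rho_bar\<close>; for \<open>n = 1\<close> there is no disagreement and \<open>C2 \<ge> 0\<close> is what is needed.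

  The initial model may have infinite second moment. The induction therefore speaks about
  the deviations \<open>X\<^sub>k u\<close>, the global gradient and the loss of the mean model, whose
  integrability is established along with the bound on the deviations (predicate
  \<open>controlled\<close>). Second moments are first estimated as extended nonnegative integrals, where
  no integrability has to be known in advance.
\<close>

section \<open>The second largest eigenvalue and quadratic forms\<close>

lemma det_const_poly: "det (\<chi> i j. [:A $ i $ j:]) = [:det (A :: real^'n^'n):]"
proof -
  have prod: "(\<Prod>i\<in>S. [:g i:]) = [:\<Prod>i\<in>S. g i :: real:]" for g and S :: "'n set"
    by (induction S rule: infinite_finite_induct) (auto simp: one_pCons)
  have sum: "(\<Sum>i\<in>S. [:g i:]) = [:\<Sum>i\<in>S. g i :: real:]" for g and S :: "('n \<Rightarrow> 'n) set"
    by (induction S rule: infinite_finite_induct) auto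
  show ?thesis
    by (simp add: det_def prod sum[symmetric] of_int_poly mult.commute)
qed

lemma poly_det: "poly (det A) x = det (\<chi> i j. poly (A $ i $ j) (x::real))"
  by (simp add: det_def poly_sum poly_prod)

lemma poly_charpoly: "poly (charpoly A) x = det (x *\<^sub>R mat 1 - A)"
proof -
  have "(\<chi> i j. poly ((mat [:0, 1:] - (\<chi> i j. [:A $ i $ j:])) $ i $ j) x) = x *\<^sub>R mat 1 - A"
    by (simp add: vec_eq_iff mat_def)
  then show ?thesis
    by (simp add: charpoly_def poly_det)
qed

text \<open>
  The zero polynomial has no roots in the sense of \<open>proots\<close>, so this is what makes the list
  of eigenvalues meaningful. Any number exceeding an operator bound of the matrix is not a
  root.
\<close>

lemma charpoly_nonzero: "charpoly A \<noteq> (0 :: real poly)" for A :: "real^'n^'n"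
proof -
  obtain B where B: "\<And>v. norm (A *v v) \<le> B * norm v"
    using linear_bounded[OF matrix_vector_mul_linear[of A]] by blast
  let ?C = "(B + 1) *\<^sub>R mat 1 - A"
  have "v = 0" if "?C *v v = 0" for v
  proof -
    have "(B + 1) *\<^sub>R v = A *v v"
      using that by (simp add: matrix_vector_mult_diff_rdistrib scaleR_matrix_vector_assoc[symmetric])
    then have "\<bar>B + 1\<bar> * norm v \<le> B * norm v"
      using B[of v] by (metis norm_scaleR)
    then have "(\<bar>B + 1\<bar> - B) * norm v \<le> 0" by (simp add: algebra_simps)
    moreover have "\<bar>B + 1\<bar> - B \<ge> 1" by linarith
    ultimately have "norm v \<le> 0"
      by (smt (verit, best) mult_le_cancel_right1 norm_ge_zero)
    then show ?thesis by simp
  qed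
  then have "invertible ?C"
    using matrix_left_invertible_ker[of ?C] invertible_left_inverse by blast
  then have "det ?C \<noteq> 0" by (simp add: invertible_det_nz)
  then show ?thesis
    using poly_charpoly[of A "B + 1"] by fastforce
qed

lemma det_column_mul:
  fixes c :: "'a::comm_ring_1"
  shows "det (\<chi> i j. if j = k then c * B $ i $ j else B $ i $ j) = c * det (B :: 'a^'n^'n)"
proof -
  have 1: "transpose (\<chi> i j. if j = k then c * B $ i $ j else B $ i $ j)
      = (\<chi> i. if i = k then c *s column i B else column i B)"
    by (simp add: vec_eq_iff transpose_def column_def)
  have 2: "transpose B = (\<chi> i. if i = k then column i B else column i B)"
    by (simp add: vec_eq_iff transpose_def column_def)
  have "det (transpose (\<chi> i j. if j = k then c * B $ i $ j else B $ i $ j)) = c * det (transpose B)"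
    unfolding 1 2 using det_row_mul[of k c "\<lambda>i. column i B" "\<lambda>i. column i B"] by simp
  then show ?thesis by simp
qed

text \<open>
  Finding two independent eigenvectors must produce two eigenvalues with algebraic
  multiplicity, also when both eigenvalues agree. Let \<open>Q\<close> be the identity with columns \<open>p\<close>
  and \<open>q\<close> replaced by the eigenvectors. In \<open>(x - A) Q\<close> these two columns are multiples of
  \<open>x - \<alpha>\<close> and \<open>x - \<beta>\<close>, which can be pulled out of the determinant, and \<open>det Q\<close> is a nonzero
  constant by the condition on the minor.
\<close>

lemma two_eigenvectors_dvd_charpoly:
  fixes A :: "real^'n^'n"
  assumes a: "A *v a = \<alpha> *\<^sub>R a" and b: "A *v b = \<beta> *\<^sub>R b"
    and minor: "a $ p * b $ q \<noteq> a $ q * b $ p" and pq: "p \<noteq> q"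
  shows "[:-\<alpha>, 1:] * [:-\<beta>, 1:] dvd charpoly A"
proof -
  define Q :: "real^'n^'n" where
    "Q = (\<chi> i j. if j = p then a $ i else if j = q then b $ i else if i = j then 1 else 0)"
  define Qp where "Qp = (\<chi> i j. [:Q $ i $ j:])"
  define N where "N = mat [:0, 1:] - (\<chi> i j. [:A $ i $ j:])"
  define R where "R = (\<chi> i j. if j = p \<or> j = q then [:Q $ i $ j:] else (N ** Qp) $ i $ j)"
  have sumc: "(\<Sum>k\<in>S. [:g k:]) = [:\<Sum>k\<in>S. g k :: real:]" for g and S :: "'n set"
    by (induction S rule: infinite_finite_induct) auto
  have NQ: "(N ** Qp) $ i $ j = [:0, Q $ i $ j:] - [:\<Sum>k\<in>UNIV. A $ i $ k * Q $ k $ j:]" for i j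
  proof -
    have "(N ** Qp) $ i $ j = (\<Sum>k\<in>UNIV. (if i = k then [:0, 1:] * [:Q $ k $ j:] else 0) - [:A $ i $ k * Q $ k $ j:])"
      unfolding matrix_matrix_mult_def N_def Qp_def vec_lambda_beta
      by (rule sum.cong) (auto simp: mat_def algebra_simps)
    also have "\<dots> = [:0, 1:] * [:Q $ i $ j:] - [:\<Sum>k\<in>UNIV. A $ i $ k * Q $ k $ j:]"
      by (simp add: sum_subtractf sumc)
    finally show ?thesis by simp
  qed
  have cp: "(N ** Qp) $ i $ p = [:-\<alpha>, 1:] * [:Q $ i $ p:]" for i
  proof -
    have "(\<Sum>k\<in>UNIV. A $ i $ k * Q $ k $ p) = \<alpha> * a $ i"
      using arg_cong[OF a, of "\<lambda>v. v $ i"] by (simp add: Q_def matrix_vector_mult_def)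
    then show ?thesis unfolding NQ by (simp add: Q_def)
  qed
  have cq: "(N ** Qp) $ i $ q = [:-\<beta>, 1:] * [:Q $ i $ q:]" for i
  proof -
    have "(\<Sum>k\<in>UNIV. A $ i $ k * Q $ k $ q) = \<beta> * b $ i"
      using arg_cong[OF b, of "\<lambda>v. v $ i"] pq by (simp add: Q_def matrix_vector_mult_def)
    then show ?thesis unfolding NQ using pq by (simp add: Q_def)
  qed
  have "N ** Qp = (\<chi> i j. if j = p then [:-\<alpha>, 1:] * ((\<chi> i j. if j = q then [:-\<beta>, 1:] * R $ i $ j else R $ i $ j) $ i $ j)
      else (\<chi> i j. if j = q then [:-\<beta>, 1:] * R $ i $ j else R $ i $ j) $ i $ j)"
    using pq by (simp add: vec_eq_iff cp cq R_def)
  then have "det (N ** Qp) = [:-\<alpha>, 1:] * ([:-\<beta>, 1:] * det R)"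
    by (simp only: det_column_mul)
  then have eq: "charpoly A * [:det Q:] = [:-\<alpha>, 1:] * [:-\<beta>, 1:] * det R"
    unfolding det_mul Qp_def det_const_poly charpoly_def N_def by (simp only: mult.assoc)
  have "v = 0" if v: "Q *v v = 0" for v
  proof -
    have *: "a $ i * v $ p + b $ i * v $ q + (if i = p \<or> i = q then 0 else v $ i) = 0" for i
    proof -
      have "0 = (Q *v v) $ i" using v by simp
      also have "\<dots> = (\<Sum>j\<in>UNIV. (if j = p then a $ i * v $ p else 0) + (if j = q then b $ i * v $ q else 0)
          + (if i = j then if i = p \<or> i = q then 0 else v $ i else 0))"
        unfolding matrix_vector_mult_def Q_def using pq by (auto intro!: sum.cong)
      finally show ?thesis by (simp add: sum.distrib)
    qed
    have 1: "a $ p * v $ p + b $ p * v $ q = 0" and 2: "a $ q * v $ p + b $ q * v $ q = 0"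
      using *[of p] *[of q] by auto
    have "(a $ p * b $ q - a $ q * b $ p) * v $ p = b $ q * (a $ p * v $ p + b $ p * v $ q) - b $ p * (a $ q * v $ p + b $ q * v $ q)"
      by (simp add: algebra_simps)
    then have vp: "v $ p = 0" using 1 2 minor by simp
    have "(a $ p * b $ q - a $ q * b $ p) * v $ q = a $ p * (a $ q * v $ p + b $ q * v $ q) - a $ q * (a $ p * v $ p + b $ p * v $ q)"
      by (simp add: algebra_simps)
    then have vq: "v $ q = 0" using 1 2 minor by simp
    show "v = 0"
      unfolding vec_eq_iff
    proof
      fix i show "v $ i = 0 $ i"
        using *[of i] vp vq by (cases "i = p \<or> i = q") auto
    qed
  qed
  then have "invertible Q"
    using matrix_left_invertible_ker[of Q] invertible_left_inverse by blast
  then have nz: "det Q \<noteq> 0" by (simp add: invertible_det_nz)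
  have "charpoly A = charpoly A * [:det Q:] * [:1 / det Q:]"
    using nz by (simp add: one_pCons[symmetric] mult.assoc)
  also have "\<dots> = [:-\<alpha>, 1:] * [:-\<beta>, 1:] * (det R * [:1 / det Q:])"
    unfolding eq by (simp only: mult.assoc)
  finally show ?thesis by (metis dvd_triv_left)
qed

text \<open>
  Otherwise only the first entry of the decreasing list could exceed the second one, but
  both \<open>a\<close> and \<open>b\<close> would do so.
\<close>

lemma second_largest_ge_min:
  fixes a b :: real
  assumes "{#a, b#} \<subseteq># S"
  shows "min a b \<le> rev (sorted_list_of_multiset S) ! 1"
proof -
  define l where "l = rev (sorted_list_of_multiset S)"
  have ml: "mset l = S" by (simp add: l_def)
  have srt: "sorted (rev l)" by (simp add: l_def)
  have desc: "l ! j \<le> l ! i" if "i \<le> j" "j < length l" for i j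
    using srt that by (simp add: sorted_rev_nth_mono)
  have "length l \<ge> 2"
    using size_mset_mono[OF assms] unfolding ml[symmetric] by simp
  then obtain x y zs where l: "l = x # y # zs"
    by (metis One_nat_def Suc_1 Suc_le_length_iff)
  show ?thesis
  proof (rule ccontr)
    assume "\<not> ?thesis"
    then have less: "y < a" "y < b" by (auto simp: l_def[symmetric] l)
    have "z \<le> y" if "z \<in> set zs" for z
    proof -
      obtain i where "i < length zs" "zs ! i = z" using \<open>z \<in> set zs\<close> by (metis in_set_conv_nth)
      then show ?thesis using desc[of 1 "Suc (Suc i)"] l by simp
    qed
    then have zs: "filter_mset (\<lambda>z. y < z) (mset zs) = {#}"
      by (auto simp: filter_mset_eq_mempty_iff not_less)
    have "filter_mset (\<lambda>z. y < z) S = filter_mset (\<lambda>z. y < z) {#x#}"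
      unfolding ml[symmetric] l mset.simps filter_mset_add_mset zs by auto
    also have "\<dots> \<subseteq># {#x#}" by (rule multiset_filter_subset)
    finally have "filter_mset (\<lambda>z. y < z) S \<subseteq># {#x#}" .
    with multiset_filter_mono[OF assms, of "\<lambda>z. y < z"]
    have "filter_mset (\<lambda>z. y < z) {#a, b#} \<subseteq># {#x#}" by (rule subset_mset.order_trans)
    moreover have "filter_mset (\<lambda>z. y < z) {#a, b#} = {#a, b#}" using less by auto
    ultimately have "size {#a, b#} \<le> size {#x#}" by (metis size_mset_mono)
    then show False by simp
  qed
qed

text \<open>
  The all-ones vector already accounts for the eigenvalue 1, so a further eigenvector
  orthogonal to it contributes a second entry to the list of eigenvalues.
\<close>

lemma eigenvalue_le_second_largest:
  fixes A :: "real^'n^'n"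
  assumes "A *v 1 = 1" "A *v v = \<mu> *\<^sub>R v" "v \<noteq> 0" "v \<bullet> 1 = 0"
  shows "min 1 \<mu> \<le> nth_largest_eigenvalue 2 A"
proof -
  obtain p q where pq: "v $ p \<noteq> v $ q"
  proof (rule ccontr)
    assume "\<not> thesis"
    then have eq: "v $ i = v $ j" for i j using that by blast
    have "0 = (\<Sum>i\<in>UNIV. v $ i)" using assms(4) by (simp add: inner_vec_def)
    also have "\<dots> = (\<Sum>i\<in>(UNIV::'n set). v $ j)" for j by (intro sum.cong eq refl)
    finally have "v $ j = 0" for j by simp
    then show False using assms(3) by (simp add: vec_eq_iff)
  qed
  have "[:-1, 1:] * [:-\<mu>, 1:] dvd charpoly A"
    by (rule two_eigenvectors_dvd_charpoly[of A 1 1 v \<mu> p q]) (use assms pq in auto)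
  then obtain R where R: "charpoly A = [:-1, 1:] * [:-\<mu>, 1:] * R" by (elim dvdE)
  have "proots (charpoly A) = {#1, \<mu>#} + proots R"
    using charpoly_nonzero[of A] unfolding R 
    by (subst proots_mult, force, force, subst proots_mult) (auto simp del: mult_pCons_left mult_pCons_right)
  then have "{#1, \<mu>#} \<subseteq># proots (charpoly A)" by simp
  from second_largest_ge_min[OF this] show ?thesis
    by (simp add: nth_largest_eigenvalue_def)
qed

text \<open>
  A maximiser of the quadratic form on the unit sphere of the orthogonal complement of the
  all-ones vector is an eigenvector, whose eigenvalue is the maximum. This replaces a full
  diagonalisation: only this one eigenvector has to be compared with the list of
  eigenvalues.
\<close>

lemma quadratic_form_le_second_eigenvalue:
  fixes A :: "real^'n^'n"
  assumes sym: "\<And>u w. u \<bullet> (A *v w) = w \<bullet> (A *v u)"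
    and one: "A *v 1 = 1" and le: "nth_largest_eigenvalue 2 A \<le> \<rho>" and \<rho>: "\<rho> < 1"
    and u: "u \<bullet> 1 = 0"
  shows "u \<bullet> (A *v u) \<le> \<rho> * (norm u)\<^sup>2"
proof (cases "u = 0")
  case False
  let ?S = "sphere 0 1 \<inter> {w. w \<bullet> 1 = 0} :: (real^'n) set"
  have "compact ?S"
    by (intro compact_Int_closed compact_sphere closed_Collect_eq continuous_intros)
  moreover have "u /\<^sub>R norm u \<in> ?S" using False u by simp
  moreover have "continuous_on ?S (\<lambda>w. w \<bullet> (A *v w))"
    by (intro continuous_intros linear_continuous_on linear_conv_bounded_linear[THEN iffD1] matrix_vector_mul_linear)
  ultimately obtain v where v: "v \<in> ?S" and max: "\<And>w. w \<in> ?S \<Longrightarrow> w \<bullet> (A *v w) \<le> v \<bullet> (A *v v)"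
    using continuous_attains_sup[of ?S "\<lambda>w. w \<bullet> (A *v w)"] by blast
  define \<mu> where "\<mu> = v \<bullet> (A *v v)"
  have form: "w \<bullet> (A *v w) \<le> \<mu> * (norm w)\<^sup>2" if "w \<bullet> 1 = 0" for w
  proof (cases "w = 0")
    case False
    have "(w /\<^sub>R norm w) \<bullet> (A *v (w /\<^sub>R norm w)) \<le> \<mu>"
      unfolding \<mu>_def by (rule max) (use False that in auto)
    then show ?thesis
      using False by (simp add: matrix_vector_mult_scaleR field_simps power2_eq_square)
  qed simp
  define w where "w = \<mu> *\<^sub>R v - A *v v"
  have w1: "w \<bullet> 1 = 0"
    using v sym[of 1 v] one by (simp add: w_def inner_diff_left inner_diff_right inner_commute)
  define Bww where "Bww = \<mu> * (norm w)\<^sup>2 - w \<bullet> (A *v w)"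
  (* Moving from the maximiser v in the direction w cannot increase the Rayleigh quotient. *)
  have key: "0 \<le> 2 * t * (norm w)\<^sup>2 + t\<^sup>2 * Bww" for t
  proof -
    have nv: "norm v = 1" using v by simp
    have "(v + t *\<^sub>R w) \<bullet> 1 = 0" using v w1 by (simp add: inner_add_left)
    from form[OF this]
    have "0 \<le> \<mu> * (norm (v + t *\<^sub>R w))\<^sup>2 - (v + t *\<^sub>R w) \<bullet> (A *v (v + t *\<^sub>R w))" by simp
    also have "\<dots> = 2 * t * (\<mu> * (w \<bullet> v) - w \<bullet> (A *v v)) + t\<^sup>2 * Bww + (\<mu> * (norm v)\<^sup>2 - v \<bullet> (A *v v))"
      using sym[of v w] unfolding Bww_def power2_norm_eq_inner
      by (simp add: matrix_vector_right_distrib matrix_vector_mult_scaleR inner_add_left inner_add_right algebra_simps power2_eq_square inner_commute)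
    also have "\<mu> * (w \<bullet> v) - w \<bullet> (A *v v) = (norm w)\<^sup>2"
      unfolding power2_norm_eq_inner by (simp add: w_def inner_diff_left inner_diff_right inner_commute algebra_simps)
    also have "\<mu> * (norm v)\<^sup>2 - v \<bullet> (A *v v) = 0" by (simp add: nv \<mu>_def)
    finally show ?thesis by simp
  qed
  have "w = 0"
  proof (rule ccontr)
    assume "w \<noteq> 0"
    then have pos: "(norm w)\<^sup>2 > 0" by simp
    (* A negative t so small that the linear term of key dominates the quadratic one. *)
    define t where "t = - (norm w)\<^sup>2 / (\<bar>Bww\<bar> + 1)"
    have "t\<^sup>2 * Bww \<le> t\<^sup>2 * (\<bar>Bww\<bar> + 1)" by (intro mult_left_mono) auto
    also have "\<dots> = - t * (norm w)\<^sup>2"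
    proof -
      have "t * (\<bar>Bww\<bar> + 1) = - (norm w)\<^sup>2" by (simp add: t_def field_simps)
      then show ?thesis by (simp add: power2_eq_square mult.assoc)
    qed
    finally have "0 \<le> t * (norm w)\<^sup>2" using key[of t] by linarith
    moreover have "t < 0" using pos by (simp add: t_def field_simps)
    ultimately show False using pos by (simp add: zero_le_mult_iff)
  qed
  then have "A *v v = \<mu> *\<^sub>R v" by (simp add: w_def)
  from eigenvalue_le_second_largest[OF one this] have "min 1 \<mu> \<le> \<rho>"
    using v le by fastforce
  then have "\<mu> \<le> \<rho>" using \<rho> by (simp add: min_def split: if_splits)
  then show ?thesis
    using form[OF u] mult_right_mono[of \<mu> \<rho> "(norm u)\<^sup>2"] by simp
qed simp

section \<open>Gradients\<close>

lemma GDERIV_unique: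
  assumes "GDERIV h x :> d" "GDERIV h x :> e"
  shows "d = e"
proof -
  have "(\<lambda>y. y \<bullet> d) = (\<lambda>y. y \<bullet> e)"
    using assms unfolding gderiv_def by (rule has_derivative_unique)
  then show ?thesis by (metis inner_commute vector_eq_rdot)
qed

lemma gradient_eqI: "GDERIV h x :> d \<Longrightarrow> gradient h x = d"
  unfolding gradient_def by (blast intro: the_equality GDERIV_unique)

lemma GDERIV_gradient:
  fixes h :: "'a::euclidean_space \<Rightarrow> real"
  assumes "h differentiable (at x)"
  shows "GDERIV h x :> gradient h x"
proof -
  obtain h' where h': "(h has_derivative h') (at x)"
    using assms by (auto simp: differentiable_def)
  interpret linear h' using h' by (rule has_derivative_linear)
  have "h' y = y \<bullet> (\<Sum>b\<in>Basis. h' b *\<^sub>R b)" for y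
  proof -
    have "h' y = h' (\<Sum>b\<in>Basis. (y \<bullet> b) *\<^sub>R b)" by (simp add: euclidean_representation)
    also have "\<dots> = y \<bullet> (\<Sum>b\<in>Basis. h' b *\<^sub>R b)"
      by (simp add: sum scale inner_sum_right mult.commute)
    finally show ?thesis .
  qed
  then have "h' = (\<lambda>y. y \<bullet> (\<Sum>b\<in>Basis. h' b *\<^sub>R b))" by blast
  then have "GDERIV h x :> (\<Sum>b\<in>Basis. h' b *\<^sub>R b)"
    using h' unfolding gderiv_def by simp
  then show ?thesis using gradient_eqI by fastforce
qed

lemma GDERIV_weighted_sum:
  assumes "\<And>i. i \<in> S \<Longrightarrow> GDERIV (h i) x :> d i"
  shows "GDERIV (\<lambda>x. \<Sum>i\<in>S. (c i :: real) * h i x) x :> (\<Sum>i\<in>S. c i *\<^sub>R d i)"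
proof -
  have "((\<lambda>x. \<Sum>i\<in>S. c i * h i x) has_derivative (\<lambda>y. \<Sum>i\<in>S. c i * (y \<bullet> d i))) (at x)"
    using assms unfolding gderiv_def by (intro has_derivative_sum has_derivative_mult_right)
  then show ?thesis by (simp add: gderiv_def inner_sum_right)
qed

lemma lipschitz_gradient_upper_bound:
  fixes f :: "'a::real_inner \<Rightarrow> real"
  assumes deriv: "\<And>x. GDERIV f x :> g x" and lip: "L-lipschitz_on UNIV g"
  shows "f y \<le> f x + g x \<bullet> (y - x) + L / 2 * (norm (y - x))\<^sup>2"
proof -
  define d where "d = y - x"
  define \<phi> where "\<phi> t = f (x + t *\<^sub>R d) - t * (g x \<bullet> d) - L / 2 * t\<^sup>2 * (norm d)\<^sup>2" for t
  have DERIV: "(\<phi> has_real_derivative (d \<bullet> g (x + t *\<^sub>R d) - g x \<bullet> d - L * t * (norm d)\<^sup>2)) (at t)" for t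
  proof -
    have "((\<lambda>t. f (x + t *\<^sub>R d)) has_derivative (\<lambda>s. (s *\<^sub>R d) \<bullet> g (x + t *\<^sub>R d))) (at t)"
      by (rule has_derivative_compose[of "\<lambda>t. x + t *\<^sub>R d"])
        (auto intro!: derivative_eq_intros deriv[unfolded gderiv_def])
    then have "((\<lambda>t. f (x + t *\<^sub>R d)) has_real_derivative (d \<bullet> g (x + t *\<^sub>R d))) (at t)"
      by (simp add: has_field_derivative_def mult_commute_abs)
    then show ?thesis
      unfolding \<phi>_def by (auto intro!: derivative_eq_intros)
  qed
  have "\<phi> 1 \<le> \<phi> 0"
  proof (rule DERIV_nonpos_imp_nonincreasing[of 0 1 \<phi>])
    fix t :: real assume t: "0 \<le> t" "t \<le> 1"
    have "d \<bullet> g (x + t *\<^sub>R d) - g x \<bullet> d = d \<bullet> (g (x + t *\<^sub>R d) - g x)"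
      by (simp add: inner_diff_right inner_commute)
    also have "\<dots> \<le> norm d * norm (g (x + t *\<^sub>R d) - g x)" by (rule norm_cauchy_schwarz)
    also have "\<dots> \<le> norm d * (L * norm (t *\<^sub>R d))"
      using lipschitz_onD[OF lip, of "x + t *\<^sub>R d" x] by (intro mult_left_mono) (auto simp: dist_norm)
    also have "\<dots> = L * t * (norm d)\<^sup>2" using t by (simp add: power2_eq_square)
    finally show "\<exists>z. (\<phi> has_real_derivative z) (at t) \<and> z \<le> 0"
      using DERIV[of t] by (intro exI conjI) auto
  qed simp
  then show ?thesis by (simp add: \<phi>_def d_def)
qed

text \<open>
  A gradient step of length \<open>1 / (L + 1)\<close> cannot go below the lower bound \<open>m\<close>. The shift by
  1 covers \<open>L = 0\<close>; the constant only has to be finite, for the gradient at the initial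
  model to be square integrable.
\<close>

lemma lipschitz_gradient_norm_bound:
  fixes f :: "'a::real_inner \<Rightarrow> real"
  assumes deriv: "\<And>x. GDERIV f x :> g x" and lip: "L-lipschitz_on UNIV g"
    and lower: "\<And>x. m \<le> f x"
  shows "(norm (g x))\<^sup>2 \<le> 2 * (L + 1) * (f x - m)"
proof -
  have L: "0 \<le> L" using lip by (rule lipschitz_on_nonneg)
  define t where "t = 1 / (L + 1)"
  have t: "0 < t" "L * t \<le> 1" using L by (auto simp: t_def field_simps)
  have "m \<le> f (x - t *\<^sub>R g x)" by (rule lower)
  also have "\<dots> \<le> f x - t * (norm (g x))\<^sup>2 + L / 2 * (t\<^sup>2 * (norm (g x))\<^sup>2)"
    using lipschitz_gradient_upper_bound[OF deriv lip, of "x - t *\<^sub>R g x" x]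
    by (simp add: power_mult_distrib power2_norm_eq_inner)
  also have "\<dots> = f x - t * (norm (g x))\<^sup>2 * (1 - L * t / 2)"
    by (simp add: power2_eq_square algebra_simps)
  also have "\<dots> \<le> f x - t * (norm (g x))\<^sup>2 * (1 / 2)"
    using t by (intro diff_left_mono mult_left_mono) auto
  finally have "t * (norm (g x))\<^sup>2 \<le> 2 * (f x - m)" by simp
  then show ?thesis using L by (simp add: t_def field_simps)
qed

text \<open>
  Each component is a pointwise limit of difference quotients.
\<close>

lemma measurable_stoch_grad:
  fixes F :: "'n \<Rightarrow> 'a::euclidean_space \<Rightarrow> 's \<Rightarrow> real"
  assumes meas: "(\<lambda>(x, s). F i x s) \<in> borel_measurable (borel \<Otimes>\<^sub>M N)"
    and diff: "\<And>x s. s \<in> space N \<Longrightarrow> (\<lambda>y. F i y s) differentiable (at x)"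
  shows "(\<lambda>(x, s). stoch_grad F i x s) \<in> borel_measurable (borel \<Otimes>\<^sub>M N)"
proof (subst borel_measurable_euclidean_space, rule ballI)
  fix b :: 'a assume b: "b \<in> Basis"
  define q where "q m z = (case z of (x, s) \<Rightarrow> real (Suc m) * (F i (x + (1 / real (Suc m)) *\<^sub>R b) s - F i x s))"
    for m z
  show "(\<lambda>z. (case z of (x, s) \<Rightarrow> stoch_grad F i x s) \<bullet> b) \<in> borel_measurable (borel \<Otimes>\<^sub>M N)"
  proof (rule borel_measurable_LIMSEQ_real[where u = q])
    fix z assume "z \<in> space (borel \<Otimes>\<^sub>M N :: ('a \<times> 's) measure)"
    then obtain x s where z: "z = (x, s)" and s: "s \<in> space N"
      by (auto simp: space_pair_measure)
    define h where "h t = F i (x + t *\<^sub>R b) s" for t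
    have "GDERIV (\<lambda>y. F i y s) x :> stoch_grad F i x s"
      unfolding stoch_grad_def by (rule GDERIV_gradient[OF diff[OF s]])
    then have "((\<lambda>y. F i y s) has_derivative (\<lambda>y. y \<bullet> stoch_grad F i x s)) (at (x + 0 *\<^sub>R b))"
      by (simp add: gderiv_def)
    then have "(h has_derivative (\<lambda>t. (t *\<^sub>R b) \<bullet> stoch_grad F i x s)) (at 0)"
      unfolding h_def by (rule has_derivative_compose[rotated]) (auto intro!: derivative_eq_intros)
    then have "(h has_real_derivative (stoch_grad F i x s \<bullet> b)) (at 0)"
      by (simp add: has_field_derivative_def mult_commute_abs inner_commute)
    then have lim: "(\<lambda>t. (h (0 + t) - h 0) / t) \<midarrow>0\<rightarrow> stoch_grad F i x s \<bullet> b"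
      unfolding DERIV_def .
    have "(\<lambda>m. (h (0 + 1 / real (Suc m)) - h 0) / (1 / real (Suc m))) \<longlonglongrightarrow> stoch_grad F i x s \<bullet> b"
      using LIMSEQ_SEQ_conv[THEN iffD2, rule_format, OF lim, of "\<lambda>m. 1 / real (Suc m)"]
        LIMSEQ_inverse_real_of_nat by (simp add: inverse_eq_divide)
    then show "(\<lambda>m. q m z) \<longlonglongrightarrow> (case z of (x, s) \<Rightarrow> stoch_grad F i x s) \<bullet> b"
      by (simp add: q_def z h_def mult.commute)
  next
    fix m
    have [measurable]: "(\<lambda>z. F i (fst z) (snd z)) \<in> borel_measurable (borel \<Otimes>\<^sub>M N)"
      using meas by (simp add: case_prod_beta')
    have [measurable]: "(\<lambda>z. F i (fst z + (1 / real (Suc m)) *\<^sub>R b) (snd z)) \<in> borel_measurable (borel \<Otimes>\<^sub>M N)"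
      using measurable_compose[OF _ meas, of "\<lambda>z. (fst z + (1 / real (Suc m)) *\<^sub>R b, snd z)"] by simp
    show "q m \<in> borel_measurable (borel \<Otimes>\<^sub>M N)"
      unfolding q_def case_prod_beta' by measurable
  qed
qed

section \<open>Second moments and independence\<close>

definition square_integrable :: "'w measure \<Rightarrow> ('w \<Rightarrow> 'a::euclidean_space) \<Rightarrow> bool" where
  "square_integrable P Y \<longleftrightarrow> Y \<in> borel_measurable P \<and> integrable P (\<lambda>\<omega>. (norm (Y \<omega>))\<^sup>2)"

lemma square_integrableD:
  assumes "square_integrable P Y"
  shows "Y \<in> borel_measurable P" "integrable P (\<lambda>\<omega>. (norm (Y \<omega>))\<^sup>2)"
  using assms by (auto simp: square_integrable_def)

lemma norm_add_sq_le: "(norm (a + b))\<^sup>2 \<le> 2 * (norm a)\<^sup>2 + 2 * (norm (b :: 'a::real_inner))\<^sup>2"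
proof -
  have "0 \<le> (norm (a - b))\<^sup>2" by simp
  also have "\<dots> = 2 * (norm a)\<^sup>2 + 2 * (norm b)\<^sup>2 - (norm (a + b))\<^sup>2"
    unfolding power2_norm_eq_inner by (simp add: inner_add_left inner_add_right inner_diff_left inner_diff_right inner_commute)
  finally show ?thesis by simp
qed

lemma abs_inner_le_sq: "\<bar>a \<bullet> b\<bar> \<le> (norm a)\<^sup>2 + (norm (b :: 'a::real_inner))\<^sup>2"
proof -
  have "\<bar>a \<bullet> b\<bar> \<le> norm a * norm b" by (rule Cauchy_Schwarz_ineq2)
  moreover have "0 \<le> (norm a - norm b)\<^sup>2" by simp
  ultimately show ?thesis
    by (simp add: power2_diff)
qed

lemma square_integrable_add:
  assumes "square_integrable P Y" "square_integrable P Z"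
  shows "square_integrable P (\<lambda>\<omega>. Y \<omega> + Z \<omega>)"
  unfolding square_integrable_def
proof
  note [measurable] = assms[THEN square_integrableD(1)]
  show "(\<lambda>\<omega>. Y \<omega> + Z \<omega>) \<in> borel_measurable P" by measurable
  show "integrable P (\<lambda>\<omega>. (norm (Y \<omega> + Z \<omega>))\<^sup>2)"
    by (rule Bochner_Integration.integrable_bound[of P "\<lambda>\<omega>. 2 * (norm (Y \<omega>))\<^sup>2 + 2 * (norm (Z \<omega>))\<^sup>2"])
      (use assms[THEN square_integrableD(2)] norm_add_sq_le in auto)
qed

lemma square_integrable_scaleR:
  assumes "square_integrable P Y"
  shows "square_integrable P (\<lambda>\<omega>. c *\<^sub>R Y \<omega>)"
  using assms by (auto simp: square_integrable_def power_mult_distrib)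

lemma square_integrable_sum:
  assumes "\<And>i. i \<in> S \<Longrightarrow> square_integrable P (Y i)"
  shows "square_integrable P (\<lambda>\<omega>. \<Sum>i\<in>S. Y i \<omega>)"
  using assms
proof (induction S rule: infinite_finite_induct)
  case (insert x F)
  then show ?case using square_integrable_add[of P "Y x" "\<lambda>\<omega>. \<Sum>i\<in>F. Y i \<omega>"] by simp
qed (auto simp: square_integrable_def)

lemma square_integrable_bound:
  assumes "Y \<in> borel_measurable P" "integrable P B" "AE \<omega> in P. (norm (Y \<omega>))\<^sup>2 \<le> B \<omega>"
  shows "square_integrable P Y"
  unfolding square_integrable_def
  using assms by (auto intro!: Bochner_Integration.integrable_bound[OF assms(2)])

lemma integrable_inner:
  assumes "square_integrable P Y" "square_integrable P Z"
  shows "integrable P (\<lambda>\<omega>. Y \<omega> \<bullet> Z \<omega>)"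
proof -
  note [measurable] = assms[THEN square_integrableD(1)]
  show ?thesis
    by (rule Bochner_Integration.integrable_bound[of P "\<lambda>\<omega>. (norm (Y \<omega>))\<^sup>2 + (norm (Z \<omega>))\<^sup>2"])
      (use assms[THEN square_integrableD(2)] abs_inner_le_sq in auto)
qed

lemma square_integrable_nn_integral:
  assumes [measurable]: "Y \<in> borel_measurable P"
    and le: "(\<integral>\<^sup>+\<omega>. ennreal ((norm (Y \<omega>))\<^sup>2) \<partial>P) \<le> ennreal c" and c: "0 \<le> c"
  shows "square_integrable P Y" "(\<integral>\<omega>. (norm (Y \<omega>))\<^sup>2 \<partial>P) \<le> c"
proof -
  have *: "integrable P (\<lambda>\<omega>. (norm (Y \<omega>))\<^sup>2)"
    using le by (intro integrableI_bounded) (auto simp: less_top[symmetric] top_unique)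
  then show "square_integrable P Y" by (simp add: square_integrable_def)
  have "ennreal (\<integral>\<omega>. (norm (Y \<omega>))\<^sup>2 \<partial>P) \<le> ennreal c"
    using le * by (subst nn_integral_eq_integral[symmetric]) auto
  then show "(\<integral>\<omega>. (norm (Y \<omega>))\<^sup>2 \<partial>P) \<le> c" using c by simp
qed

text \<open>
  Young's inequality \<open>|x + y|\<^sup>2 \<le> |x|\<^sup>2 / r + |y|\<^sup>2 / (1 - r)\<close>. With weight \<open>1 / r\<close> a
  contraction by \<open>r\<^sup>2\<close> is reduced to one by \<open>r\<close>, which still decays geometrically. For
  \<open>r = 0\<close> the first summand vanishes almost surely.
\<close>

lemma integral_norm_add_sq_weighted:
  fixes A B :: "'w \<Rightarrow> 'a::euclidean_space"
  assumes A: "square_integrable P A" and B: "square_integrable P B"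
    and a: "(\<integral>\<omega>. (norm (A \<omega>))\<^sup>2 \<partial>P) \<le> r\<^sup>2 * \<alpha>" and b: "(\<integral>\<omega>. (norm (B \<omega>))\<^sup>2 \<partial>P) \<le> \<beta>"
    and r: "0 \<le> r" "r < 1"
  shows "(\<integral>\<omega>. (norm (A \<omega> + B \<omega>))\<^sup>2 \<partial>P) \<le> r * \<alpha> + \<beta> / (1 - r)"
proof (cases "r = 0")
  case True
  have "(\<integral>\<omega>. (norm (A \<omega>))\<^sup>2 \<partial>P) = 0"
    using a True by (intro antisym) auto
  then have "AE \<omega> in P. (norm (A \<omega>))\<^sup>2 = 0"
    using square_integrableD(2)[OF A] by (subst (asm) integral_nonneg_eq_0_iff_AE) auto
  then have "(\<integral>\<omega>. (norm (A \<omega> + B \<omega>))\<^sup>2 \<partial>P) = (\<integral>\<omega>. (norm (B \<omega>))\<^sup>2 \<partial>P)"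
    using square_integrableD(1)[OF A] square_integrableD(1)[OF B] by (intro integral_cong_AE) auto
  then show ?thesis using b True by simp
next
  case False
  then have r0: "0 < r" using r by simp
  have young: "(norm (x + y))\<^sup>2 \<le> (norm x)\<^sup>2 / r + (norm y)\<^sup>2 / (1 - r)" for x y :: 'a
  proof -
    have "(1 - r) * (norm x)\<^sup>2 + r * (norm y)\<^sup>2 - r * (1 - r) * (norm (x + y))\<^sup>2 = (norm ((1 - r) *\<^sub>R x - r *\<^sub>R y))\<^sup>2"
      unfolding power2_norm_eq_inner
      by (simp add: inner_add_left inner_add_right inner_diff_left inner_diff_right inner_commute algebra_simps power2_eq_square)
    then have "r * (1 - r) * (norm (x + y))\<^sup>2 \<le> (1 - r) * (norm x)\<^sup>2 + r * (norm y)\<^sup>2"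
      by (smt (verit) zero_le_power2)
    then show ?thesis using r r0 by (simp add: field_simps)
  qed
  have "(\<integral>\<omega>. (norm (A \<omega> + B \<omega>))\<^sup>2 \<partial>P) \<le> (\<integral>\<omega>. (norm (A \<omega>))\<^sup>2 / r + (norm (B \<omega>))\<^sup>2 / (1 - r) \<partial>P)"
    using square_integrableD(2)[OF A] square_integrableD(2)[OF B] square_integrableD(2)[OF square_integrable_add[OF A B]]
    by (intro integral_mono young) auto
  also have "\<dots> = (\<integral>\<omega>. (norm (A \<omega>))\<^sup>2 \<partial>P) / r + (\<integral>\<omega>. (norm (B \<omega>))\<^sup>2 \<partial>P) / (1 - r)"
    using square_integrableD(2)[OF A] square_integrableD(2)[OF B] by simp
  also have "\<dots> \<le> r\<^sup>2 * \<alpha> / r + \<beta> / (1 - r)"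
    using r r0 a b by (intro add_mono divide_right_mono) auto
  finally show ?thesis using r0 by (simp add: power2_eq_square)
qed

text \<open>
  The two value types may differ, as for the matrix of the local models and a direction, or
  a batch of samples.
\<close>

definition (in prob_space) independent_rv ::
  "'b measure \<Rightarrow> ('a \<Rightarrow> 'b) \<Rightarrow> 'c measure \<Rightarrow> ('a \<Rightarrow> 'c) \<Rightarrow> bool" where
  "independent_rv N1 Z N2 Y \<longleftrightarrow> Z \<in> measurable M N1 \<and> Y \<in> measurable M N2 \<and>
     (\<forall>A\<in>sets N1. \<forall>B\<in>sets N2. prob ((Z -` A \<inter> space M) \<inter> (Y -` B \<inter> space M))
        = prob (Z -` A \<inter> space M) * prob (Y -` B \<inter> space M))"

lemma (in prob_space) independent_rv_distr:
  assumes "independent_rv N1 Z N2 Y"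
  shows "distr M (N1 \<Otimes>\<^sub>M N2) (\<lambda>\<omega>. (Z \<omega>, Y \<omega>)) = distr M N1 Z \<Otimes>\<^sub>M distr M N2 Y"
proof (rule pair_measure_eqI[symmetric])
  have [measurable]: "Z \<in> measurable M N1" "Y \<in> measurable M N2"
    using assms by (auto simp: independent_rv_def)
  show "sigma_finite_measure (distr M N1 Z)" "sigma_finite_measure (distr M N2 Y)"
    by (simp_all add: prob_space_distr prob_space_imp_sigma_finite)
  show "sets (distr M N1 Z \<Otimes>\<^sub>M distr M N2 Y) = sets (distr M (N1 \<Otimes>\<^sub>M N2) (\<lambda>\<omega>. (Z \<omega>, Y \<omega>)))"
    by (simp cong: sets_pair_measure_cong)
  fix A B assume "A \<in> sets (distr M N1 Z)" "B \<in> sets (distr M N2 Y)"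
  then have A: "A \<in> sets N1" and B: "B \<in> sets N2" by auto
  have "(\<lambda>\<omega>. (Z \<omega>, Y \<omega>)) -` (A \<times> B) \<inter> space M = (Z -` A \<inter> space M) \<inter> (Y -` B \<inter> space M)"
    by auto
  then show "emeasure (distr M N1 Z) A * emeasure (distr M N2 Y) B =
      emeasure (distr M (N1 \<Otimes>\<^sub>M N2) (\<lambda>\<omega>. (Z \<omega>, Y \<omega>))) (A \<times> B)"
    using assms A B
    by (simp add: emeasure_distr emeasure_eq_measure independent_rv_def ennreal_mult)
qed

text \<open>
  The second variable may be replaced by a copy living on a separate factor of the sample
  space. Unlike a formulation with distributions, this keeps the inner integral an
  expectation over the original space, to which facts about fixed arguments apply directly.
\<close>

lemma (in prob_space) nn_integral_independent_copy:
  assumes ind: "independent_rv N1 Z N2 Y" and [measurable]: "\<phi> \<in> borel_measurable (N1 \<Otimes>\<^sub>M N2)"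
  shows "(\<integral>\<^sup>+\<omega>. \<phi> (Z \<omega>, Y \<omega>) \<partial>M) = (\<integral>\<^sup>+\<omega>. \<integral>\<^sup>+\<omega>'. \<phi> (Z \<omega>, Y \<omega>') \<partial>M \<partial>M)"
proof -
  have [measurable]: "Z \<in> measurable M N1" "Y \<in> measurable M N2"
    using ind by (auto simp: independent_rv_def)
  interpret D2: prob_space "distr M N2 Y" by (simp add: prob_space_distr)
  have "(\<integral>\<^sup>+\<omega>. \<phi> (Z \<omega>, Y \<omega>) \<partial>M) = integral\<^sup>N (distr M (N1 \<Otimes>\<^sub>M N2) (\<lambda>\<omega>. (Z \<omega>, Y \<omega>))) \<phi>"
    by (simp add: nn_integral_distr)
  also have "\<dots> = (\<integral>\<^sup>+z. \<integral>\<^sup>+y. \<phi> (z, y) \<partial>distr M N2 Y \<partial>distr M N1 Z)"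
    unfolding independent_rv_distr[OF ind]
    by (rule D2.nn_integral_fst[symmetric]) (simp cong: measurable_cong_sets sets_pair_measure_cong)
  also have "\<dots> = (\<integral>\<^sup>+\<omega>. \<integral>\<^sup>+y. \<phi> (Z \<omega>, y) \<partial>distr M N2 Y \<partial>M)"
    by (rule nn_integral_distr) auto
  also have "\<dots> = (\<integral>\<^sup>+\<omega>. \<integral>\<^sup>+\<omega>'. \<phi> (Z \<omega>, Y \<omega>') \<partial>M \<partial>M)"
    by (intro nn_integral_cong nn_integral_distr) (auto dest!: measurable_space[of Z])
  finally show ?thesis .
qed

lemma (in prob_space) integral_independent_copy:
  fixes \<phi> :: "_ \<Rightarrow> real"
  assumes ind: "independent_rv N1 Z N2 Y" and [measurable]: "\<phi> \<in> borel_measurable (N1 \<Otimes>\<^sub>M N2)"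
    and int: "integrable M (\<lambda>\<omega>. \<phi> (Z \<omega>, Y \<omega>))"
  shows "(\<integral>\<omega>. \<phi> (Z \<omega>, Y \<omega>) \<partial>M) = (\<integral>\<omega>. \<integral>\<omega>'. \<phi> (Z \<omega>, Y \<omega>') \<partial>M \<partial>M)"
proof -
  have [measurable]: "Z \<in> measurable M N1" "Y \<in> measurable M N2"
    using ind by (auto simp: independent_rv_def)
  interpret D1: prob_space "distr M N1 Z" by (simp add: prob_space_distr)
  interpret D2: prob_space "distr M N2 Y" by (simp add: prob_space_distr)
  interpret pair_sigma_finite "distr M N1 Z" "distr M N2 Y" ..
  have int': "integrable (distr M N1 Z \<Otimes>\<^sub>M distr M N2 Y) \<phi>"
    unfolding independent_rv_distr[OF ind, symmetric] using int by (subst integrable_distr_eq) auto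
  have "(\<integral>\<omega>. \<phi> (Z \<omega>, Y \<omega>) \<partial>M) = integral\<^sup>L (distr M (N1 \<Otimes>\<^sub>M N2) (\<lambda>\<omega>. (Z \<omega>, Y \<omega>))) \<phi>"
    by (simp add: integral_distr)
  also have "\<dots> = (\<integral>z. \<integral>y. \<phi> (z, y) \<partial>distr M N2 Y \<partial>distr M N1 Z)"
    unfolding independent_rv_distr[OF ind] by (rule integral_fst'[symmetric, OF int'])
  also have "\<dots> = (\<integral>\<omega>. \<integral>y. \<phi> (Z \<omega>, y) \<partial>distr M N2 Y \<partial>M)"
  proof (rule integral_distr)
    have "(\<lambda>x. \<integral>y. \<phi> (x, y) \<partial>distr M N2 Y) \<in> borel_measurable N1" by measurable
    then show "(\<lambda>x. \<integral>y. \<phi> (x, y) \<partial>distr M N2 Y) \<in> borel_measurable N1" .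
  qed simp
  also have "\<dots> = (\<integral>\<omega>. \<integral>\<omega>'. \<phi> (Z \<omega>, Y \<omega>') \<partial>M \<partial>M)"
    by (intro Bochner_Integration.integral_cong integral_distr refl) (auto dest!: measurable_space[of Z])
  finally show ?thesis .
qed

text \<open>
  After centring, the mixed terms vanish, so the variances add up, while the means add
  coherently. This is why the noise of a batch grows with \<open>m\<close> and its squared mean with
  \<open>m\<^sup>2\<close>.
\<close>

lemma (in prob_space) expectation_sq_norm_iid_sum:
  fixes Y :: "nat \<Rightarrow> 'a \<Rightarrow> 'b::euclidean_space"
  assumes ind: "indep_vars (\<lambda>_. borel) Y {..<m}"
    and mean: "\<And>j. j < m \<Longrightarrow> has_bochner_integral M (Y j) \<mu>"
    and int: "\<And>j. j < m \<Longrightarrow> integrable M (\<lambda>\<omega>. (norm (Y j \<omega> - \<mu>))\<^sup>2)"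
    and var: "\<And>j. j < m \<Longrightarrow> (\<integral>\<omega>. (norm (Y j \<omega> - \<mu>))\<^sup>2 \<partial>M) \<le> v"
  shows "square_integrable M (\<lambda>\<omega>. \<Sum>j<m. Y j \<omega>)"
    and "(\<integral>\<omega>. (norm (\<Sum>j<m. Y j \<omega>))\<^sup>2 \<partial>M) \<le> real m * v + (real m)\<^sup>2 * (norm \<mu>)\<^sup>2"
proof -
  define Z where "Z j \<omega> = Y j \<omega> - \<mu>" for j \<omega>
  have Ym: "Y j \<in> borel_measurable M" if "j < m" for j
    using mean[OF that] by (auto dest: borel_measurable_has_bochner_integral)
  have Z: "square_integrable M (Z j)" if "j < m" for j
    using int[OF that] Ym[OF that] unfolding square_integrable_def Z_def by auto
  have ZE: "(\<integral>\<omega>. Z j \<omega> \<partial>M) = 0" and Zi: "integrable M (Z j)" if "j < m" for j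
    using mean[OF that] by (auto simp: Z_def[abs_def] has_bochner_integral_iff prob_space)
  have cross: "(\<integral>\<omega>. Z j \<omega> \<bullet> Z l \<omega> \<partial>M) = 0" if jl: "j < m" "l < m" "j \<noteq> l" for j l
  proof -
    have [measurable]: "Z j \<in> borel_measurable M" "Z l \<in> borel_measurable M"
      using Z jl by (auto simp: square_integrable_def)
    have "indep_vars (\<lambda>_. borel) (\<lambda>j \<omega>. Y j \<omega> - \<mu>) {..<m}"
      by (rule indep_vars_compose2[OF ind]) auto
    then have indep_Z: "indep_vars (\<lambda>_. borel) Z {..<m}" by (simp add: Z_def[abs_def])
    have "independent_rv borel (Z j) borel (Z l)"
    proof -
      have "prob ((Z j -` A \<inter> space M) \<inter> (Z l -` B \<inter> space M)) = prob (Z j -` A \<inter> space M) * prob (Z l -` B \<inter> space M)"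
        if "A \<in> sets borel" "B \<in> sets borel" for A B
        using indep_varsD[OF indep_Z, of "{j, l}" "\<lambda>i. if i = j then A else B"] jl that
        by auto
      then show ?thesis unfolding independent_rv_def by auto
    qed
    from integral_independent_copy[OF this, of "\<lambda>(x, y). x \<bullet> y"]
    have "(\<integral>\<omega>. Z j \<omega> \<bullet> Z l \<omega> \<partial>M) = (\<integral>\<omega>. \<integral>\<omega>'. Z j \<omega> \<bullet> Z l \<omega>' \<partial>M \<partial>M)"
      using integrable_inner[OF Z Z] jl by simp
    also have "\<dots> = 0" using ZE Zi jl by simp
    finally show ?thesis .
  qed
  let ?S = "\<lambda>\<omega>. \<Sum>j<m. Z j \<omega>"
  have S: "square_integrable M ?S" by (intro square_integrable_sum Z) auto
  have sumY: "(\<Sum>j<m. Y j \<omega>) = ?S \<omega> + real m *\<^sub>R \<mu>" for \<omega>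
    by (simp add: Z_def sum_subtractf sum_constant_scaleR del: sum_constant)
  have const: "square_integrable M (\<lambda>\<omega>. real m *\<^sub>R \<mu>)" by (simp add: square_integrable_def)
  show "square_integrable M (\<lambda>\<omega>. \<Sum>j<m. Y j \<omega>)"
    unfolding sumY by (rule square_integrable_add[OF S const])
  have iS: "integrable M ?S" and ES: "(\<integral>\<omega>. ?S \<omega> \<partial>M) = 0" using Zi ZE by auto
  have "(\<integral>\<omega>. (norm (?S \<omega>))\<^sup>2 \<partial>M) = (\<integral>\<omega>. (\<Sum>j<m. \<Sum>l<m. Z j \<omega> \<bullet> Z l \<omega>) \<partial>M)"
    unfolding power2_norm_eq_inner by (simp only: inner_sum_left) (simp only: inner_sum_right)
  also have "\<dots> = (\<Sum>j<m. \<Sum>l<m. (\<integral>\<omega>. Z j \<omega> \<bullet> Z l \<omega> \<partial>M))"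
    using integrable_inner[OF Z Z] by (subst Bochner_Integration.integral_sum, force, intro sum.cong refl Bochner_Integration.integral_sum) auto
  also have "\<dots> = (\<Sum>j<m. \<Sum>l<m. if j = l then (\<integral>\<omega>. (norm (Z j \<omega>))\<^sup>2 \<partial>M) else 0)"
    by (intro sum.cong refl) (auto simp: cross power2_norm_eq_inner)
  also have "\<dots> \<le> (\<Sum>j<m. v)"
    using sum_mono[of "{..<m}" "\<lambda>j. \<integral>\<omega>. (norm (Z j \<omega>))\<^sup>2 \<partial>M" "\<lambda>_. v"] var by (simp add: Z_def)
  finally have vS: "(\<integral>\<omega>. (norm (?S \<omega>))\<^sup>2 \<partial>M) \<le> real m * v" by simp
  have "(\<integral>\<omega>. (norm (\<Sum>j<m. Y j \<omega>))\<^sup>2 \<partial>M) = (\<integral>\<omega>. (norm (?S \<omega>))\<^sup>2 + 2 * real m * (?S \<omega> \<bullet> \<mu>) + (real m)\<^sup>2 * (norm \<mu>)\<^sup>2 \<partial>M)"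
    unfolding sumY power2_norm_eq_inner
    by (intro Bochner_Integration.integral_cong refl)
      (simp add: inner_add_left inner_add_right inner_commute algebra_simps power2_eq_square)
  also have "\<dots> = (\<integral>\<omega>. (norm (?S \<omega>))\<^sup>2 \<partial>M) + 2 * real m * ((\<integral>\<omega>. ?S \<omega> \<partial>M) \<bullet> \<mu>) + (real m)\<^sup>2 * (norm \<mu>)\<^sup>2"
    using square_integrableD(2)[OF S] iS by (simp add: prob_space del: integral_sum integral_sum')
  finally show "(\<integral>\<omega>. (norm (\<Sum>j<m. Y j \<omega>))\<^sup>2 \<partial>M) \<le> real m * v + (real m)\<^sup>2 * (norm \<mu>)\<^sup>2"
    using vS ES by simp
qed

section \<open>Doubly stochastic matrices\<close>

lemma doubly_stochastic_mult_one: "doubly_stochastic A \<Longrightarrow> A *v 1 = 1"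
  by (simp add: doubly_stochastic_def matrix_vector_mult_def vec_eq_iff)

lemma doubly_stochastic_inner_one: "doubly_stochastic A \<Longrightarrow> (A *v u) \<bullet> 1 = u \<bullet> 1"
proof -
  assume A: "doubly_stochastic A"
  have "(A *v u) \<bullet> 1 = (\<Sum>i\<in>UNIV. \<Sum>j\<in>UNIV. A $ i $ j * u $ j)"
    by (simp add: inner_vec_def matrix_vector_mult_def)
  also have "\<dots> = (\<Sum>j\<in>UNIV. (\<Sum>i\<in>UNIV. A $ i $ j) * u $ j)"
    by (subst sum.swap) (simp add: sum_distrib_right)
  also have "\<dots> = u \<bullet> 1"
    using A by (simp add: doubly_stochastic_def inner_vec_def)
  finally show ?thesis .
qed

lemma doubly_stochastic_entry_bounds:
  assumes "doubly_stochastic A" shows "0 \<le> A $ i $ j" "A $ i $ j \<le> 1"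
proof -
  show "0 \<le> A $ i $ j" using assms by (simp add: doubly_stochastic_def)
  have "A $ i $ j \<le> (\<Sum>j\<in>UNIV. A $ i $ j)"
    using assms by (intro member_le_sum) (auto simp: doubly_stochastic_def)
  then show "A $ i $ j \<le> 1" using assms by (simp add: doubly_stochastic_def)
qed

lemma borel_measurable_vec_iff:
  fixes f :: "'w \<Rightarrow> real^'n"
  shows "f \<in> borel_measurable N \<longleftrightarrow> (\<forall>i. (\<lambda>x. f x $ i) \<in> borel_measurable N)"
  by (subst borel_measurable_euclidean_space) (auto simp: Basis_vec_def inner_axis)

lemma borel_measurable_matrix_iff:
  fixes f :: "'w \<Rightarrow> real^'n^'m"
  shows "f \<in> borel_measurable N \<longleftrightarrow> (\<forall>i j. (\<lambda>x. f x $ i $ j) \<in> borel_measurable N)"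
  by (subst borel_measurable_euclidean_space) (auto simp: Basis_vec_def inner_axis)

lemma borel_measurable_matrix_vector_mult [measurable (raw)]:
  fixes A :: "'w \<Rightarrow> real^'n^'m"
  assumes "A \<in> borel_measurable N" "u \<in> borel_measurable N"
  shows "(\<lambda>x. A x *v u x) \<in> borel_measurable N"
  using assms unfolding borel_measurable_vec_iff borel_measurable_matrix_iff
  by (auto simp: matrix_vector_mult_def intro!: borel_measurable_sum borel_measurable_times)

lemma borel_measurable_matrix_matrix_mult [measurable (raw)]:
  fixes A :: "'w \<Rightarrow> real^'n^'m" and B :: "'w \<Rightarrow> real^'k^'n"
  assumes "A \<in> borel_measurable N" "B \<in> borel_measurable N"
  shows "(\<lambda>x. A x ** B x) \<in> borel_measurable N"
  using assms unfolding borel_measurable_matrix_iff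
  by (auto simp: matrix_matrix_mult_def intro!: borel_measurable_sum borel_measurable_times)

lemma borel_measurable_matrix_nth [measurable (raw)]:
  fixes A :: "'w \<Rightarrow> real^'n^'m"
  assumes "A \<in> borel_measurable N"
  shows "(\<lambda>x. A x $ i $ j) \<in> borel_measurable N"
  using assms unfolding borel_measurable_matrix_iff by simp

lemma column_eq_mult: "column i X = X *v axis i (1::real)"
  by (simp add: matrix_vector_mul_component column_def matrix_vector_mult_def axis_def vec_eq_iff if_distrib cong: if_cong)

text \<open>
  \<open>E |W u|\<^sup>2\<close> is the quadratic form of \<open>E[W\<^sup>T W]\<close>, a symmetric matrix that fixes the
  all-ones vector.
\<close>

lemma (in prob_space) expected_contraction:
  fixes W :: "'a \<Rightarrow> real^'n^'n"
  assumes meas [measurable]: "W \<in> borel_measurable M" and ds: "AE \<omega> in M. doubly_stochastic (W \<omega>)"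
    and le: "nth_largest_eigenvalue 2 (\<integral>\<omega>. transpose (W \<omega>) ** W \<omega> \<partial>M) \<le> \<rho>" and \<rho>: "\<rho> < 1"
    and u: "u \<bullet> 1 = 0"
  shows "square_integrable M (\<lambda>\<omega>. W \<omega> *v u)"
    and "(\<integral>\<omega>. (norm (W \<omega> *v u))\<^sup>2 \<partial>M) \<le> \<rho> * (norm u)\<^sup>2"
proof -
  define G where "G \<omega> = transpose (W \<omega>) ** W \<omega>" for \<omega>
  define A where "A = (\<integral>\<omega>. G \<omega> \<partial>M)"
  have [measurable]: "(\<lambda>\<omega>. transpose (W \<omega>)) \<in> borel_measurable M"
    unfolding borel_measurable_matrix_iff by (simp add: transpose_def)
  have Gm [measurable]: "G \<in> borel_measurable M" unfolding G_def[abs_def] by measurable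
  have G: "integrable M G"
  proof (rule integrable_const_bound)
    show "AE \<omega> in M. norm (G \<omega>) \<le> real CARD('n) * (real CARD('n) * real CARD('n))"
      using ds
    proof eventually_elim
      fix \<omega> assume W: "doubly_stochastic (W \<omega>)"
      have "norm (G \<omega>) \<le> (\<Sum>i\<in>UNIV. norm (G \<omega> $ i))" unfolding norm_vec_def by (rule L2_set_le_sum) simp
      also have "\<dots> \<le> (\<Sum>i\<in>(UNIV::'n set). \<Sum>j\<in>(UNIV::'n set). \<bar>G \<omega> $ i $ j\<bar>)"
        by (intro sum_mono norm_le_l1_cart)
      also have "\<dots> \<le> (\<Sum>i\<in>(UNIV::'n set). \<Sum>j\<in>(UNIV::'n set). real CARD('n))"
      proof (intro sum_mono)
        fix i j
        have "\<bar>G \<omega> $ i $ j\<bar> \<le> (\<Sum>k\<in>UNIV. \<bar>W \<omega> $ k $ i * W \<omega> $ k $ j\<bar>)"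
          unfolding G_def matrix_matrix_mult_def transpose_def by (simp add: sum_abs)
        also have "\<dots> \<le> (\<Sum>k\<in>(UNIV::'n set). 1)"
          using doubly_stochastic_entry_bounds[OF W] by (intro sum_mono) (simp add: mult_le_one)
        finally show "\<bar>G \<omega> $ i $ j\<bar> \<le> real CARD('n)" by simp
      qed
      finally show "norm (G \<omega>) \<le> real CARD('n) * (real CARD('n) * real CARD('n))" by simp
    qed
  qed simp
  have form: "x \<bullet> (G \<omega> *v y) = (W \<omega> *v x) \<bullet> (W \<omega> *v y)" for x y \<omega>
    unfolding G_def by (simp add: matrix_vector_mul_assoc[symmetric] dot_lmul_matrix[symmetric] inner_commute vector_transpose_matrix)
       (metis dot_lmul_matrix inner_commute vector_transpose_matrix transpose_transpose)
  have bl: "bounded_linear (\<lambda>B. B *v y)" for y :: "real^'n"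
    by (rule linear_conv_bounded_linear[THEN iffD1], unfold linear_iff)
      (auto simp: matrix_vector_mult_add_rdistrib scaleR_matrix_vector_assoc)
  have Ay: "A *v y = (\<integral>\<omega>. G \<omega> *v y \<partial>M)" for y
    unfolding A_def by (rule integral_bounded_linear[OF bl G, symmetric])
  have Gy: "integrable M (\<lambda>\<omega>. G \<omega> *v y)" for y by (rule integrable_bounded_linear[OF bl G])
  have Axy: "x \<bullet> (A *v y) = (\<integral>\<omega>. (W \<omega> *v x) \<bullet> (W \<omega> *v y) \<partial>M)" for x y
    unfolding Ay form[symmetric] using Gy by simp
  have sym: "x \<bullet> (A *v y) = y \<bullet> (A *v x)" for x y
    unfolding Axy by (simp add: inner_commute)
  have one: "A *v 1 = 1"
  proof -
    have "A *v 1 = (\<integral>\<omega>. 1 \<partial>M)"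
      unfolding Ay
    proof (rule integral_cong_AE)
      show "AE \<omega> in M. G \<omega> *v 1 = 1"
        using ds
      proof eventually_elim
        fix \<omega> assume W: "doubly_stochastic (W \<omega>)"
        have "doubly_stochastic (transpose (W \<omega>))" using W by (auto simp: doubly_stochastic_def transpose_def)
        then show "G \<omega> *v 1 = 1"
          unfolding G_def matrix_vector_mul_assoc[symmetric] using W by (simp only: doubly_stochastic_mult_one)
      qed
    qed measurable
    then show ?thesis by (simp add: prob_space)
  qed
  have [measurable]: "(\<lambda>\<omega>. W \<omega> *v u) \<in> borel_measurable M" by measurable
  have "integrable M (\<lambda>\<omega>. (norm (W \<omega> *v u))\<^sup>2)"
    unfolding power2_norm_eq_inner form[symmetric] using Gy by simp
  then show "square_integrable M (\<lambda>\<omega>. W \<omega> *v u)" by (simp add: square_integrable_def)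
  have "(\<integral>\<omega>. (norm (W \<omega> *v u))\<^sup>2 \<partial>M) = u \<bullet> (A *v u)"
    unfolding Axy power2_norm_eq_inner ..
  also have "\<dots> \<le> \<rho> * (norm u)\<^sup>2"
    by (rule quadratic_form_le_second_eigenvalue[OF sym one]) (use le \<rho> u in \<open>auto simp: A_def G_def\<close>)
  finally show "(\<integral>\<omega>. (norm (W \<omega> *v u))\<^sup>2 \<partial>M) \<le> \<rho> * (norm u)\<^sup>2" .
qed

section \<open>Averages of Lipschitz gradients\<close>

lemma norm_weighted_sum_sq_le:
  fixes v :: "'n \<Rightarrow> 'a::real_inner"
  assumes "finite S" and w: "\<And>i. i \<in> S \<Longrightarrow> 0 \<le> w i" "sum w S = (1::real)"
  shows "(norm (\<Sum>i\<in>S. w i *\<^sub>R v i))\<^sup>2 \<le> (\<Sum>i\<in>S. w i * (norm (v i))\<^sup>2)"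
proof -
  define m where "m = (\<Sum>i\<in>S. w i *\<^sub>R v i)"
  have "0 \<le> (\<Sum>i\<in>S. w i * (norm (v i - m))\<^sup>2)" by (intro sum_nonneg mult_nonneg_nonneg w) auto
  also have "\<dots> = (\<Sum>i\<in>S. w i * (norm (v i))\<^sup>2 - 2 * ((w i *\<^sub>R v i) \<bullet> m) + w i * (m \<bullet> m))"
    unfolding power2_norm_eq_inner
    by (intro sum.cong refl) (simp add: inner_diff_left inner_diff_right inner_commute algebra_simps)
  also have "\<dots> = (\<Sum>i\<in>S. w i * (norm (v i))\<^sup>2) - 2 * (m \<bullet> m) + m \<bullet> m"
    unfolding sum.distrib sum_subtractf sum_distrib_left[symmetric] sum_distrib_right[symmetric] w(2)
    by (simp add: m_def inner_sum_left)
  finally show ?thesis by (simp add: m_def power2_norm_eq_inner)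
qed

lemma norm_sum_sq_le_card:
  fixes v :: "'n \<Rightarrow> 'a::real_inner"
  assumes "finite S"
  shows "(norm (\<Sum>i\<in>S. v i))\<^sup>2 \<le> real (card S) * (\<Sum>i\<in>S. (norm (v i))\<^sup>2)"
proof (cases "S = {}")
  case False
  let ?c = "real (card S)"
  have c: "?c > 0" using False assms by (simp add: card_gt_0_iff)
  have "(norm (\<Sum>i\<in>S. (1 / ?c) *\<^sub>R (?c *\<^sub>R v i)))\<^sup>2 \<le> (\<Sum>i\<in>S. 1 / ?c * (norm (?c *\<^sub>R v i))\<^sup>2)"
    by (rule norm_weighted_sum_sq_le) (use assms c in auto)
  also have "\<dots> = ?c * (\<Sum>i\<in>S. (norm (v i))\<^sup>2)"
    using c by (simp add: sum_distrib_left power_mult_distrib power2_eq_square[of ?c] mult.assoc)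
  finally show ?thesis using c by simp
qed simp

lemma norm_add3_sq_le: "(norm (a + b + c))\<^sup>2 \<le> 3 * ((norm a)\<^sup>2 + (norm b)\<^sup>2 + (norm (c :: 'a::real_inner))\<^sup>2)"
  using norm_sum_sq_le_card[of "{0,1,2::nat}" "\<lambda>i. if i = 0 then a else if i = 1 then b else c"]
  by (simp add: add.assoc)

lemma lipschitz_on_UNIV_sq:
  assumes "L-lipschitz_on UNIV (h :: 'a::real_normed_vector \<Rightarrow> 'b::real_normed_vector)"
  shows "(norm (h x - h y))\<^sup>2 \<le> L\<^sup>2 * (norm (x - y))\<^sup>2"
  using lipschitz_onD[OF assms, of x y] power_mono[of "norm (h x - h y)" "L * norm (x - y)" 2]
  by (simp add: dist_norm power_mult_distrib)

lemma lipschitz_weighted_sum: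
  fixes h :: "'n::finite \<Rightarrow> 'a::real_normed_vector \<Rightarrow> 'b::real_normed_vector"
  assumes p: "\<And>i. 0 \<le> p i" "(\<Sum>i\<in>UNIV. p i) = 1" and lip: "\<And>i. L-lipschitz_on UNIV (h i)"
  shows "L-lipschitz_on UNIV (\<lambda>x. \<Sum>i\<in>UNIV. p i *\<^sub>R h i x)"
proof (rule lipschitz_onI)
  fix x y
  have "norm ((\<Sum>i\<in>UNIV. p i *\<^sub>R h i x) - (\<Sum>i\<in>UNIV. p i *\<^sub>R h i y)) = norm (\<Sum>i\<in>UNIV. p i *\<^sub>R (h i x - h i y))"
    by (simp add: sum_subtractf scaleR_diff_right)
  also have "\<dots> \<le> (\<Sum>i\<in>UNIV. p i * (L * dist x y))"
    using lip p(1) by (intro sum_norm_le) (auto intro!: mult_left_mono lipschitz_onD[OF lip] simp: dist_norm[symmetric])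
  also have "\<dots> = L * dist x y" by (simp add: sum_distrib_right[symmetric] p)
  finally show "dist (\<Sum>i\<in>UNIV. p i *\<^sub>R h i x) (\<Sum>i\<in>UNIV. p i *\<^sub>R h i y) \<le> L * dist x y"
    by (simp add: dist_norm)
qed (use lip lipschitz_on_nonneg in blast)

text \<open>
  The gradients are compared with those at a common point \<open>b\<close>: each \<open>h i (a i)\<close> differs from
  the weighted mean \<open>z\<close> by a Lipschitz term, the heterogeneity at \<open>b\<close>, and a second
  Lipschitz term for the mean itself. Splitting off \<open>z\<close> costs a factor 2 and the three
  differences a factor 3.
\<close>

lemma weighted_gradients_sq_le:
  fixes h :: "'n::finite \<Rightarrow> 'a::real_inner \<Rightarrow> 'a"
  assumes p: "\<And>i. 0 \<le> p i" "(\<Sum>i\<in>UNIV. p i) = 1" and lip: "\<And>i. L-lipschitz_on UNIV (h i)"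
    and het: "(\<Sum>i\<in>UNIV. p i * (norm (h i b - (\<Sum>j\<in>UNIV. p j *\<^sub>R h j b)))\<^sup>2) \<le> \<nu>\<^sup>2"
  shows "(\<Sum>i\<in>UNIV. p i * (norm (h i (a i)))\<^sup>2) \<le>
    12 * L\<^sup>2 * (\<Sum>i\<in>UNIV. p i * (norm (a i - b))\<^sup>2) + 6 * \<nu>\<^sup>2 + 2 * (norm (\<Sum>i\<in>UNIV. p i *\<^sub>R h i (a i)))\<^sup>2"
proof -
  define z where "z = (\<Sum>i\<in>UNIV. p i *\<^sub>R h i (a i))"
  define H where "H = (\<Sum>i\<in>UNIV. p i *\<^sub>R h i b)"
  define s where "s = (\<Sum>i\<in>UNIV. p i * (norm (a i - b))\<^sup>2)"
  have dev: "(\<Sum>i\<in>UNIV. p i * (norm (h i (a i) - h i b))\<^sup>2) \<le> L\<^sup>2 * s"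
    unfolding s_def sum_distrib_left
    using lipschitz_on_UNIV_sq[OF lip] p(1) by (intro sum_mono) (metis mult.left_commute mult_left_mono)
  have "H - z = (\<Sum>i\<in>UNIV. p i *\<^sub>R (h i b - h i (a i)))"
    by (simp add: H_def z_def sum_subtractf scaleR_diff_right)
  then have "(norm (H - z))\<^sup>2 \<le> (\<Sum>i\<in>UNIV. p i * (norm (h i b - h i (a i)))\<^sup>2)"
    using norm_weighted_sum_sq_le[of UNIV p "\<lambda>i. h i b - h i (a i)"] p by simp
  then have Hz: "(norm (H - z))\<^sup>2 \<le> L\<^sup>2 * s" using dev by (simp add: norm_minus_commute)
  have "(norm (h i (a i)))\<^sup>2 \<le> 6 * (norm (h i (a i) - h i b))\<^sup>2 + 6 * (norm (h i b - H))\<^sup>2 + 6 * (norm (H - z))\<^sup>2 + 2 * (norm z)\<^sup>2" for i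
    using norm_add3_sq_le[of "h i (a i) - h i b" "h i b - H" "H - z"]
      norm_add_sq_le[of "h i (a i) - z" z] by simp
  then have "(\<Sum>i\<in>UNIV. p i * (norm (h i (a i)))\<^sup>2) \<le> (\<Sum>i\<in>UNIV. p i * (6 * (norm (h i (a i) - h i b))\<^sup>2
      + 6 * (norm (h i b - H))\<^sup>2 + 6 * (norm (H - z))\<^sup>2 + 2 * (norm z)\<^sup>2))"
    using p(1) by (intro sum_mono mult_left_mono) auto
  also have "\<dots> = 6 * (\<Sum>i\<in>UNIV. p i * (norm (h i (a i) - h i b))\<^sup>2) + 6 * (\<Sum>i\<in>UNIV. p i * (norm (h i b - H))\<^sup>2)
      + (\<Sum>i\<in>UNIV. p i) * (6 * (norm (H - z))\<^sup>2 + 2 * (norm z)\<^sup>2)"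
    unfolding sum_distrib_left sum_distrib_right sum.distrib[symmetric]
    by (intro sum.cong refl) (simp add: algebra_simps)
  also have "\<dots> \<le> 6 * (L\<^sup>2 * s) + 6 * \<nu>\<^sup>2 + 1 * (6 * (L\<^sup>2 * s) + 2 * (norm z)\<^sup>2)"
    unfolding p(2) using dev Hz het[folded H_def] by (intro add_mono mult_left_mono) auto
  finally show ?thesis by (simp add: s_def z_def)
qed

lemma gradient_deviation_sq_le:
  fixes h :: "'n::finite \<Rightarrow> 'a::real_inner \<Rightarrow> 'a"
  assumes p: "\<And>i. 0 \<le> p i" "(\<Sum>i\<in>UNIV. p i) = 1" and lip: "\<And>i. L-lipschitz_on UNIV (h i)"
  shows "(norm ((\<Sum>i\<in>UNIV. p i *\<^sub>R h i x) - (\<Sum>i\<in>UNIV. p i *\<^sub>R h i (a i))))\<^sup>2 \<le>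
    2 * L\<^sup>2 * (norm (x - b))\<^sup>2 + 2 * L\<^sup>2 * (\<Sum>i\<in>UNIV. p i * (norm (a i - b))\<^sup>2)"
proof -
  let ?H = "\<lambda>x. \<Sum>i\<in>UNIV. p i *\<^sub>R h i x"
  let ?z = "\<Sum>i\<in>UNIV. p i *\<^sub>R h i (a i)"
  have "?H b - ?z = (\<Sum>i\<in>UNIV. p i *\<^sub>R (h i b - h i (a i)))"
    by (simp add: sum_subtractf scaleR_diff_right)
  then have "(norm (?H b - ?z))\<^sup>2 \<le> (\<Sum>i\<in>UNIV. p i * (norm (h i b - h i (a i)))\<^sup>2)"
    using norm_weighted_sum_sq_le[of UNIV p "\<lambda>i. h i b - h i (a i)"] p by simp
  also have "\<dots> \<le> L\<^sup>2 * (\<Sum>i\<in>UNIV. p i * (norm (a i - b))\<^sup>2)"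
    unfolding sum_distrib_left
    using lipschitz_on_UNIV_sq[OF lip] p(1)
    by (intro sum_mono) (metis mult.left_commute mult_left_mono norm_minus_commute)
  finally have 1: "(norm (?H b - ?z))\<^sup>2 \<le> L\<^sup>2 * (\<Sum>i\<in>UNIV. p i * (norm (a i - b))\<^sup>2)" .
  have 2: "(norm (?H x - ?H b))\<^sup>2 \<le> L\<^sup>2 * (norm (x - b))\<^sup>2"
    by (rule lipschitz_on_UNIV_sq[OF lipschitz_weighted_sum[OF p lip]])
  show ?thesis
    using norm_add_sq_le[of "?H x - ?H b" "?H b - ?z"] 1 2 by simp
qed

section \<open>Solving the recursions\<close>

text \<open>
  A given \<open>j\<close> lies in the delay window of \<open>k\<close> only for the \<open>T\<close> values \<open>j < k \<le> j + T\<close>.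
\<close>

lemma sum_stale_window_le:
  fixes e :: "nat \<Rightarrow> real" and \<tau> :: "nat \<Rightarrow> nat"
  assumes e: "\<And>j. 0 \<le> e j" and \<tau>: "\<And>k. \<tau> k \<le> k" "\<And>k. \<tau> k \<le> T"
  shows "(\<Sum>k<K. \<Sum>j\<in>{k - \<tau> k..<k}. e j) \<le> real T * (\<Sum>j<K. e j)"
proof -
  have "(\<Sum>k<K. \<Sum>j\<in>{k - \<tau> k..<k}. e j) = (\<Sum>k<K. \<Sum>j | j < K \<and> k - \<tau> k \<le> j \<and> j < k. e j)"
    by (intro sum.cong refl) auto
  also have "\<dots> = (\<Sum>j<K. \<Sum>k | k < K \<and> k - \<tau> k \<le> j \<and> j < k. e j)"
    using sum.swap_restrict[of "{..<K}" "{..<K}" "\<lambda>k j. e j" "\<lambda>k j. k - \<tau> k \<le> j \<and> j < k"] by simp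
  also have "\<dots> \<le> (\<Sum>j<K. real T * e j)"
  proof (rule sum_mono)
    fix j
    have "{k. k < K \<and> k - \<tau> k \<le> j \<and> j < k} \<subseteq> {j<..j + T}"
      using \<tau>(2) by (auto simp: le_diff_conv) (meson add_le_cancel_left le_trans)
    then have "card {k. k < K \<and> k - \<tau> k \<le> j \<and> j < k} \<le> card {j<..j + T}"
      by (intro card_mono) auto
    then show "(\<Sum>k | k < K \<and> k - \<tau> k \<le> j \<and> j < k. e j) \<le> real T * e j"
      using e[of j] by (simp add: mult_right_mono)
  qed
  finally show ?thesis by (simp add: sum_distrib_left)
qed

text \<open>
  A given \<open>j\<close> equals \<open>k - \<tau> k\<close> only for the \<open>T + 1\<close> values \<open>j \<le> k \<le> j + T\<close>.
\<close>

lemma sum_delayed_le: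
  fixes b :: "nat \<Rightarrow> real" and \<tau> :: "nat \<Rightarrow> nat"
  assumes b: "\<And>j. 0 \<le> b j" and \<tau>: "\<And>k. \<tau> k \<le> k" "\<And>k. \<tau> k \<le> T"
  shows "(\<Sum>k<K. b (k - \<tau> k)) \<le> (real T + 1) * (\<Sum>j<K. b j)"
proof -
  have "(\<Sum>k<K. b (k - \<tau> k)) = (\<Sum>k<K. \<Sum>j | j < K \<and> j = k - \<tau> k. b j)"
  proof (intro sum.cong refl)
    fix k assume "k \<in> {..<K}"
    then have "{j. j < K \<and> j = k - \<tau> k} = {k - \<tau> k}" by auto
    then show "b (k - \<tau> k) = (\<Sum>j | j < K \<and> j = k - \<tau> k. b j)" by simp
  qed
  also have "\<dots> = (\<Sum>j<K. \<Sum>k | k < K \<and> j = k - \<tau> k. b j)"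
    using sum.swap_restrict[of "{..<K}" "{..<K}" "\<lambda>k j. b j" "\<lambda>k j. j = k - \<tau> k"] by simp
  also have "\<dots> \<le> (\<Sum>j<K. (real T + 1) * b j)"
  proof (rule sum_mono)
    fix j
    have "{k. k < K \<and> j = k - \<tau> k} \<subseteq> {j..j + T}"
    proof
      fix k assume "k \<in> {k. k < K \<and> j = k - \<tau> k}"
      then show "k \<in> {j..j + T}" using \<tau>(1)[of k] \<tau>(2)[of k] by auto
    qed
    then have "card {k. k < K \<and> j = k - \<tau> k} \<le> card {j..j + T}"
      by (intro card_mono) auto
    then have "real (card {k. k < K \<and> j = k - \<tau> k}) \<le> real T + 1" by simp
    then show "(\<Sum>k | k < K \<and> j = k - \<tau> k. b j) \<le> (real T + 1) * b j"
      unfolding sum_constant using b[of j] by (intro mult_right_mono) auto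
  qed
  finally show ?thesis by (simp add: sum_distrib_left)
qed

text \<open>
  The constant part \<open>A\<close> of the input is bounded separately for each \<open>k\<close>, through the fixed
  point of the recursion, so the delay does not affect it. Only the varying part \<open>B\<close>, which
  has to be bounded in sum, pays the factor \<open>T + 1\<close>.
\<close>

lemma sum_delayed_recursion_le:
  fixes \<beta> E B :: "nat \<Rightarrow> real"
  assumes r: "0 \<le> r" "r < 1" and \<beta>0: "\<beta> 0 = 0"
    and \<beta>: "\<And>k. \<beta> (Suc k) = r * \<beta> k + c * E k"
    and E: "\<And>k. E k \<le> A + B k" and A: "0 \<le> A" and B: "\<And>k. 0 \<le> B k" and c: "0 \<le> c"
    and \<tau>: "\<And>k. \<tau> k \<le> k" "\<And>k. \<tau> k \<le> T"
  shows "(\<Sum>k<K. \<beta> (k - \<tau> k)) \<le> c / (1 - r) * (real K * A + (real T + 1) * (\<Sum>k<K. B k))"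
proof -
  (* The response of the recursion to the varying part of the input alone. *)
  define b where "b = rec_nat 0 (\<lambda>k x. r * x + c * B k)"
  have b: "b 0 = 0" "b (Suc k) = r * b k + c * B k" for k by (simp_all add: b_def)
  have b_nonneg: "0 \<le> b k" for k
    by (induction k) (auto simp: b intro!: add_nonneg_nonneg mult_nonneg_nonneg r c B)
  have le: "\<beta> k \<le> c * A / (1 - r) + b k" for k
  proof (induction k)
    case (Suc k)
    have "\<beta> (Suc k) \<le> r * (c * A / (1 - r) + b k) + c * (A + B k)"
      unfolding \<beta> using Suc E[of k] r c by (intro add_mono mult_left_mono) auto
    also have "\<dots> = c * A / (1 - r) + b (Suc k)" using r by (simp add: b field_simps)
    finally show ?case .
  qed (use r c A in \<open>simp add: \<beta>0 b\<close>)
  have "(1 - r) * (\<Sum>k<K. b k) + b K = c * (\<Sum>k<K. B k)"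
  proof (induction K)
    case (Suc K)
    have "(1 - r) * (\<Sum>k<Suc K. b k) + b (Suc K) = ((1 - r) * (\<Sum>k<K. b k) + b K) + c * B K"
      by (simp add: b algebra_simps)
    then show ?case unfolding Suc by (simp add: algebra_simps)
  qed (simp add: b)
  then have "(1 - r) * (\<Sum>k<K. b k) \<le> c * (\<Sum>k<K. B k)" using b_nonneg[of K] by linarith
  then have sb: "(\<Sum>k<K. b k) \<le> c * (\<Sum>k<K. B k) / (1 - r)" using r by (simp add: field_simps)
  have "(\<Sum>k<K. \<beta> (k - \<tau> k)) \<le> (\<Sum>k<K. c * A / (1 - r) + b (k - \<tau> k))" by (intro sum_mono le)
  also have "\<dots> = real K * (c * A / (1 - r)) + (\<Sum>k<K. b (k - \<tau> k))" by (simp add: sum.distrib)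
  also have "\<dots> \<le> real K * (c * A / (1 - r)) + (real T + 1) * (c * (\<Sum>k<K. B k) / (1 - r))"
    using sum_delayed_le[where b = b, OF b_nonneg \<tau>, where K = K] mult_left_mono[OF sb, of "real T + 1"] by simp
  also have "\<dots> = c / (1 - r) * (real K * A + (real T + 1) * (\<Sum>k<K. B k))"
    by (simp add: divide_inverse algebra_simps)
  finally show ?thesis .
qed

text \<open>
  The left-hand side is what the recursion for the disagreement produces, with \<open>r = sqrt \<rho>\<close>.
\<close>

lemma inverse_gap_le_rho_bar:
  assumes "0 \<le> r" "r < 1" "1 \<le> n"
  shows "(n - 1) / n / (1 - r)\<^sup>2 \<le> rho_bar n (r\<^sup>2)"
proof -
  have "1 / (1 - r)\<^sup>2 \<le> 1 / (1 - r\<^sup>2) + 2 * r / (1 - r)\<^sup>2"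
  proof -
    have eq: "1 - r\<^sup>2 = (1 - r) * (1 + r)" by (simp add: algebra_simps power2_eq_square)
    have "1 / (1 - r\<^sup>2) + 2 * r / (1 - r)\<^sup>2 - 1 / (1 - r)\<^sup>2 = 2 * r\<^sup>2 / ((1 - r)\<^sup>2 * (1 + r))"
      unfolding eq using assms by (simp add: divide_simps) (simp add: algebra_simps power2_eq_square)
    moreover have "0 \<le> 2 * r\<^sup>2 / ((1 - r)\<^sup>2 * (1 + r))" using assms by simp
    ultimately show ?thesis by linarith
  qed
  then have "(n - 1) / n * (1 / (1 - r)\<^sup>2) \<le> (n - 1) / n * (1 / (1 - r\<^sup>2) + 2 * r / (1 - r)\<^sup>2)"
    using assms by (intro mult_left_mono) auto
  then show ?thesis using assms by (simp add: rho_bar_def)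
qed

lemma fraction_le_rho_bar:
  assumes "0 \<le> \<rho>" "\<rho> < 1" "1 \<le> n"
  shows "(n - 1) / n \<le> rho_bar n \<rho>"
proof -
  have "1 \<le> 1 / (1 - \<rho>)" using assms by (simp add: field_simps)
  moreover have "0 \<le> 2 * sqrt \<rho> / (1 - sqrt \<rho>)\<^sup>2" using assms by simp
  ultimately have "1 \<le> 1 / (1 - \<rho>) + 2 * sqrt \<rho> / (1 - sqrt \<rho>)\<^sup>2" by linarith
  then show ?thesis
    unfolding rho_bar_def using assms mult_left_mono[of 1 _ "(n - 1) / n"] by simp
qed

text \<open>
  Solving the recursions requires the denominator \<open>1 - 12 h\<^sup>2 R (T + 1)\<close> to be positive, the
  coefficient of the squared mean of the local gradients to be nonpositive, and the noise
  caused by disagreement and drift not to exceed that of the batches themselves. With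
  \<open>u = h T'\<^sup>2 / n\<close> and \<open>v = 2 n h B R / c1\<close> the condition \<open>C3 \<le> 1\<close> reads \<open>u + v \<le> 1/2\<close>. If
  \<open>n \<ge> 2\<close> then \<open>n R \<ge> 1\<close>, so \<open>v\<close> controls \<open>h\<close> and \<open>h R\<close>, while \<open>u\<close> controls \<open>h T\<close>; all terms
  to be estimated are then bounded by polynomials in \<open>u\<close> and \<open>v\<close>. If \<open>n = 1\<close> then \<open>R = 0\<close>,
  and the second claim comes from \<open>C2 \<ge> 0\<close>. Here \<open>T\<close> has to be a natural number, for
  \<open>T \<le> T\<^sup>2\<close>; the real bound \<open>T'\<close> occurs in the constants only.
\<close>

lemma step_size_consequences:
  fixes m \<gamma> L T' \<rho> :: real and n T :: nat
  defines "R \<equiv> rho_bar (real n) \<rho>" and "h \<equiv> \<gamma> * m * L"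
  defines "\<epsilon> \<equiv> h\<^sup>2 * (real T)\<^sup>2 / (real n)\<^sup>2 + h / (2 * real n)"
  assumes n: "1 \<le> n" and m: "0 < m" and \<gamma>: "0 < \<gamma>" and L: "0 \<le> L" and \<rho>: "0 \<le> \<rho>" "\<rho> < 1"
    and T: "real T \<le> T'"
    and C1: "0 < C1 (real n) m L T' \<rho> \<gamma>" and C2: "0 \<le> C2 (real n) m L T' \<rho> \<gamma>"
    and C3: "C3 (real n) m L T' \<rho> \<gamma> \<le> 1"
  shows "0 < 1 - 12 * h\<^sup>2 * R * (real T + 1)" (is "0 < ?C")
    and "2 * h\<^sup>2 * R * (real T + 1) * (1 + 12 * \<epsilon>) / (1 - 12 * h\<^sup>2 * R * (real T + 1)) \<le> 1 / 2 - 2 * \<epsilon>"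
    and "(1 + 12 * \<epsilon>) * h * R * real n / (1 - 12 * h\<^sup>2 * R * (real T + 1)) + h * (real T)\<^sup>2 / real n \<le> 1 / 2"
proof -
  define N where "N = real n"
  have N: "1 \<le> N" using n by (simp add: N_def)
  have h: "0 \<le> h" using m \<gamma> L by (simp add: h_def)
  have T0: "0 \<le> T'" using T by linarith
  have R: "0 \<le> R"
    using fraction_le_rho_bar[OF \<rho> N] N by (auto simp: R_def N_def[symmetric] intro: order_trans[rotated])
  define c1 where "c1 = 1 - 24 * h\<^sup>2 * (T' * ((N - 1) / N) + R)"
  have C1_eq: "C1 (real n) m L T' \<rho> \<gamma> = c1"
    by (simp add: C1_def c1_def h_def R_def N_def power_mult_distrib algebra_simps)
  have c1: "0 < c1" using C1 by (simp add: C1_eq)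
  define u where "u = h * T'\<^sup>2 / N"
  define B where "B = 1 + 6 * h / N + 12 * (h / N) * u"
  define v where "v = 2 * N * h * B * R / c1"
  have u0: "0 \<le> u" and B1: "1 \<le> B" using h N by (simp_all add: u_def B_def)
  have v0: "0 \<le> v" using h N R c1 B1 by (simp add: v_def)
  have "C3 (real n) m L T' \<rho> \<gamma> = 1 / 2 + v + u"
  proof -
    have key: "6 * \<gamma>\<^sup>2 * L\<^sup>2 * m\<^sup>2 + \<gamma> * N * m * L + 12 * m ^ 3 * L ^ 3 * T'\<^sup>2 * \<gamma> ^ 3 / N = N * h * B"
      using N by (simp add: B_def u_def h_def field_simps power2_eq_square power3_eq_cube)
    have R_eq: "rho_bar N \<rho> = R" by (simp add: R_def N_def)
    show ?thesis
      unfolding C3_def C1_eq unfolding N_def[symmetric] R_eq key by (simp add: v_def u_def h_def mult_ac)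
  qed
  with C3 have uv: "u + v \<le> 1 / 2" by simp
  have TT: "(real T)\<^sup>2 \<le> T'\<^sup>2" using T by (intro power_mono) auto
  have uT: "h * (real T)\<^sup>2 / N \<le> u" unfolding u_def using h N TT by (intro divide_right_mono mult_left_mono) auto
  have "h\<^sup>2 * (real T)\<^sup>2 / N\<^sup>2 = (h / N) * (h * (real T)\<^sup>2 / N)" by (simp add: power2_eq_square)
  also have "\<dots> \<le> (h / N) * u" using h N uT by (intro mult_left_mono) auto
  finally have eps: "\<epsilon> \<le> (h / N) * u + h / (2 * N)" by (simp add: \<epsilon>_def N_def)
  have "12 * (h / (2 * N)) = 6 * h / N" by simp
  with eps have eB: "1 + 12 * \<epsilon> \<le> B" unfolding B_def by linarith
  have eps0: "0 \<le> \<epsilon>" using h by (simp add: \<epsilon>_def)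
  have "0 < ?C \<and> 2 * h\<^sup>2 * R * (real T + 1) * (1 + 12 * \<epsilon>) / ?C \<le> 1 / 2 - 2 * \<epsilon> \<and>
    (1 + 12 * \<epsilon>) * h * R * real n / ?C + h * (real T)\<^sup>2 / real n \<le> 1 / 2"
  proof (cases "n = 1")
    case True
    then have N1: "N = 1" and R0: "R = 0" by (simp_all add: N_def R_def rho_bar_def)
    have "C2 (real n) m L T' \<rho> \<gamma> = \<gamma> * m * (1 / 2 - h - 2 * h * u)"
      unfolding C2_def C1_eq using True R0
      by (simp add: u_def N1 h_def R_def power2_eq_square power3_eq_cube field_simps)
    moreover have "0 < \<gamma> * m" using \<gamma> m by simp
    ultimately have "0 \<le> 1 / 2 - h - 2 * h * u" using C2 by (metis mult_pos_neg not_le)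
    moreover have "2 * \<epsilon> \<le> 2 * h * u + h" using eps by (simp add: N1)
    ultimately show ?thesis using uT uv v0 by (simp add: R0 N1 N_def[symmetric])
  next
    case False
    then have N2: "2 \<le> N" using n by (simp add: N_def)
    have "(N - 1) / N \<le> R" using fraction_le_rho_bar[OF \<rho> N] by (simp add: R_def N_def)
    then have NR: "1 \<le> N * R" using N2 by (simp add: field_simps)
    have c1_le: "c1 \<le> 1 - 24 * h\<^sup>2 * R"
    proof -
      have "0 \<le> 24 * h\<^sup>2 * (T' * ((N - 1) / N))" using T0 N by simp
      then show ?thesis unfolding c1_def distrib_left by linarith
    qed
    then have c1_1: "c1 \<le> 1" using R by (smt (verit) mult_nonneg_nonneg zero_le_power2)
    have vc: "2 * N * h * B * R = v * c1" using c1 by (simp add: v_def)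
    (* The factor B in v is at least 1 and the denominator c1 at most 1. *)
    have hNR: "2 * (h * (N * R)) \<le> v"
    proof -
      have "2 * (h * (N * R)) * 1 \<le> 2 * (h * (N * R)) * B" using h N R B1 by (intro mult_left_mono) auto
      also have "\<dots> = v * c1" using vc by (simp add: algebra_simps)
      also have "\<dots> \<le> v * 1" using v0 c1_1 by (intro mult_left_mono) auto
      finally show ?thesis by simp
    qed
    have hv: "2 * h \<le> v" using hNR NR mult_left_mono[OF NR h] by linarith
    have hN: "h / N \<le> v / 4"
    proof -
      have "h / N \<le> h / 2" using h N2 by (intro divide_left_mono) auto
      then show ?thesis using hv by linarith
    qed
    have T1: "real T \<le> (real T)\<^sup>2" by (cases T) (auto simp: power2_eq_square)
    have hT: "h * real T \<le> u * N"
    proof -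
      have "real T \<le> T'\<^sup>2" using T1 TT by linarith
      then have "h * real T \<le> h * T'\<^sup>2" using h by (intro mult_left_mono)
      then show ?thesis using N by (simp add: u_def)
    qed
    have cross: "12 * h\<^sup>2 * R * real T \<le> 6 * (u * v)"
    proof -
      have "12 * h\<^sup>2 * R * real T = 12 * (h * R) * (h * real T)" by (simp add: power2_eq_square)
      also have "\<dots> \<le> 12 * (h * R) * (u * N)" using hT h R by (intro mult_left_mono) auto
      also have "\<dots> = 6 * u * (2 * (h * (N * R)))" by simp
      also have "\<dots> \<le> 6 * u * v" using hNR u0 by (intro mult_left_mono) auto
      finally show ?thesis by simp
    qed
    have uv16: "u * v \<le> 1 / 16"
    proof -
      have "4 * (u * v) \<le> (u + v)\<^sup>2" using zero_le_power2[of "u - v"] by (simp add: power2_eq_square algebra_simps)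
      also have "\<dots> \<le> (1 / 2)\<^sup>2" using uv u0 v0 by (intro power_mono) auto
      finally show ?thesis by (simp add: power2_eq_square)
    qed
    have C: "c1 / 2 \<le> ?C"
    proof -
      have "?C = 1 - 12 * h\<^sup>2 * R * real T - 12 * h\<^sup>2 * R" by (simp add: algebra_simps)
      then show ?thesis using cross uv16 c1_le by linarith
    qed
    then have C0: "0 < ?C" using c1 by linarith
    have frac: "x / ?C \<le> 2 * x / c1" if "0 \<le> x" for x
    proof -
      have "x / ?C \<le> x / (c1 / 2)" using that C C0 c1 by (intro divide_left_mono) auto
      then show ?thesis by (simp add: mult.commute)
    qed
    have iii: "(1 + 12 * \<epsilon>) * h * R * N / ?C \<le> v"
    proof -
      have "(1 + 12 * \<epsilon>) * (h * R * N) / ?C \<le> B * (h * R * N) / ?C"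
        using eB h R N C0 by (intro divide_right_mono mult_right_mono) auto
      also have "\<dots> \<le> 2 * (B * (h * R * N)) / c1" using h R N B1 by (intro frac) auto
      also have "\<dots> = v" by (simp add: v_def mult.commute mult.left_commute)
      finally show ?thesis by (simp add: mult.assoc)
    qed
    have ii: "2 * h\<^sup>2 * R * (real T + 1) * (1 + 12 * \<epsilon>) / ?C \<le> 2 * u * v + v\<^sup>2 / 2"
    proof -
      have "2 * h\<^sup>2 * R * (real T + 1) * (1 + 12 * \<epsilon>) / ?C = 2 * (h * (real T + 1) / N) * ((1 + 12 * \<epsilon>) * h * R * N / ?C)"
        using N by (simp add: power2_eq_square)
      also have "\<dots> \<le> 2 * (h * (real T + 1) / N) * v" using h N iii by (intro mult_left_mono) auto
      also have "\<dots> \<le> 2 * (u + v / 4) * v"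
      proof -
        have "h * (real T + 1) / N = h * real T / N + h / N" by (simp add: algebra_simps add_divide_distrib)
        also have "h * real T / N \<le> u" using hT N by (simp add: field_simps)
        finally have "h * (real T + 1) / N \<le> u + v / 4" using hN by linarith
        then show ?thesis using v0 by (intro mult_right_mono mult_left_mono) auto
      qed
      finally show ?thesis by (simp add: algebra_simps power2_eq_square)
    qed
    have eps_v: "2 * \<epsilon> \<le> v / 4 * (2 * u + 1)"
    proof -
      have "(h / N) * (2 * u + 1) = 2 * ((h / N) * u + h / (2 * N))" by (simp add: algebra_simps)
      then have "2 * \<epsilon> \<le> (h / N) * (2 * u + 1)" using eps by argo
      also have "\<dots> \<le> v / 4 * (2 * u + 1)" using hN u0 by (intro mult_right_mono) auto
      finally show ?thesis .
    qed
    have v2: "v\<^sup>2 \<le> v / 2"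
      using uv u0 v0 mult_left_mono[of v "1 / 2" v] by (simp add: power2_eq_square)
    have "v / 4 * (2 * u + 1) = u * v / 2 + v / 4" and "2 * u * v = 2 * (u * v)"
      by (simp_all add: algebra_simps)
    then have "2 * h\<^sup>2 * R * (real T + 1) * (1 + 12 * \<epsilon>) / ?C \<le> 1 / 2 - 2 * \<epsilon>"
      using ii uv16 uv u0 v2 eps_v by argo
    moreover have "(1 + 12 * \<epsilon>) * h * R * N / ?C + h * (real T)\<^sup>2 / N \<le> 1 / 2"
      using iii uT uv by linarith
    ultimately show ?thesis using C0 by (simp add: N_def)
  qed
  then show "0 < ?C"
    and "2 * h\<^sup>2 * R * (real T + 1) * (1 + 12 * \<epsilon>) / ?C \<le> 1 / 2 - 2 * \<epsilon>"
    and "(1 + 12 * \<epsilon>) * h * R * real n / ?C + h * (real T)\<^sup>2 / real n \<le> 1 / 2" by blast+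
qed


text \<open>
  What remains of the theorem once all expectations are named: \<open>\<phi>\<close> is the expected loss of
  the mean model, \<open>S\<close> and \<open>\<Gamma>\<close> are the second moments of the global gradient and of the mean
  of the local gradients, \<open>V\<close> is the disagreement, \<open>E\<close> the second moment of a batch and \<open>d\<close>
  that of the drift. Summing over \<open>k\<close> first makes the delays disappear; then \<open>V\<close> is
  eliminated, after which \<open>\<Gamma>\<close> has a nonpositive coefficient.
\<close>

lemma rate_from_recursions:
  fixes \<phi> S V \<Gamma> E d \<beta> :: "nat \<Rightarrow> real" and \<gamma> m L r \<sigma> \<nu> T' lower :: real and n T K :: nat
  defines "Q \<equiv> \<sigma>\<^sup>2 + 6 * m * \<nu>\<^sup>2"
  assumes n: "1 \<le> n" and m: "0 < m" and \<gamma>: "0 < \<gamma>" and L: "0 \<le> L" and r: "0 \<le> r" "r < 1"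
    and T: "real T \<le> T'" and \<tau>: "\<And>k. \<tau> k \<le> k" "\<And>k. \<tau> k \<le> T" and K: "1 \<le> K"
    and descent: "\<And>k. \<phi> (Suc k) \<le> \<phi> k - \<gamma> * m / (2 * real n) * (S k + \<Gamma> k) +
      \<gamma> * m / real n * L\<^sup>2 * (d k + V k) + L * \<gamma>\<^sup>2 / (2 * (real n)\<^sup>2) * E k"
    and drift: "\<And>k. d k \<le> (\<gamma> / real n)\<^sup>2 * (real T * (\<Sum>l\<in>{k - \<tau> k..<k}. E l))"
    and energy: "\<And>k. E k \<le> m * Q + m\<^sup>2 * (12 * L\<^sup>2 * V k + 2 * \<Gamma> k)"
    and consensus: "\<And>k. V k \<le> (real n - 1) / real n * \<beta> (k - \<tau> k)"
    and \<beta>: "\<beta> 0 = 0" "\<And>k. \<beta> (Suc k) = r * \<beta> k + \<gamma>\<^sup>2 * E k / (1 - r)"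
    and nonneg: "\<And>k. 0 \<le> V k" "\<And>k. 0 \<le> \<Gamma> k" "\<And>k. 0 \<le> E k" and lower: "lower \<le> \<phi> K"
    and C1: "0 < C1 (real n) m L T' (r\<^sup>2) \<gamma>" and C2: "0 \<le> C2 (real n) m L T' (r\<^sup>2) \<gamma>"
    and C3: "C3 (real n) m L T' (r\<^sup>2) \<gamma> \<le> 1"
  shows "(\<Sum>k<K. S k) / real K \<le>
    2 * (\<phi> 0 - lower) * real n / (\<gamma> * real K * m) + 2 * \<gamma> * L / real n * Q"
proof -
  define R where "R = rho_bar (real n) (r\<^sup>2)"
  define h where "h = \<gamma> * m * L"
  define \<epsilon> where "\<epsilon> = h\<^sup>2 * (real T)\<^sup>2 / (real n)\<^sup>2 + h / (2 * real n)"
  define C where "C = 1 - 12 * h\<^sup>2 * R * (real T + 1)"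
  define s where "s = (\<Sum>k<K. V k)"
  define g where "g = (\<Sum>k<K. \<Gamma> k)"
  define e where "e = (\<Sum>k<K. E k)"
  define N where "N = real n"
  have N: "1 \<le> N" using n by (simp add: N_def)
  have r2: "0 \<le> r\<^sup>2" "r\<^sup>2 < 1" using r by (auto simp: power_less_one_iff abs_square_less_1)
  note ss = step_size_consequences[OF n m \<gamma> L r2 T C1 C2 C3, folded R_def h_def, folded \<epsilon>_def C_def N_def]
  have h: "0 \<le> h" using m \<gamma> L by (simp add: h_def)
  have \<epsilon>: "0 \<le> \<epsilon>" using h by (simp add: \<epsilon>_def)
  have Q: "0 \<le> Q" using m by (simp add: Q_def)
  have g0: "0 \<le> g" unfolding g_def by (intro sum_nonneg nonneg)
  have s0: "0 \<le> s" unfolding s_def by (intro sum_nonneg nonneg)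
  have B: "(\<Sum>k<K. m\<^sup>2 * (12 * L\<^sup>2 * V k + 2 * \<Gamma> k)) = m\<^sup>2 * (12 * L\<^sup>2 * s + 2 * g)"
    unfolding s_def g_def sum_distrib_left sum.distrib[symmetric] ..
  have e_le: "e \<le> real K * (m * Q) + m\<^sup>2 * (12 * L\<^sup>2 * s + 2 * g)"
    unfolding e_def B[symmetric] using sum_mono[of "{..<K}" E, OF energy] by (simp add: sum.distrib)
  have s_le: "s * C \<le> \<gamma>\<^sup>2 * R * (real K * (m * Q) + (real T + 1) * (m\<^sup>2 * (2 * g)))"
  proof -
    have "(\<Sum>k<K. \<beta> (k - \<tau> k)) \<le> \<gamma>\<^sup>2 / (1 - r) / (1 - r) *
        (real K * (m * Q) + (real T + 1) * (\<Sum>k<K. m\<^sup>2 * (12 * L\<^sup>2 * V k + 2 * \<Gamma> k)))"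
      by (rule sum_delayed_recursion_le[where \<beta> = \<beta> and E = E and \<tau> = \<tau> and c = "\<gamma>\<^sup>2 / (1 - r)" and B = "\<lambda>k. m\<^sup>2 * (12 * L\<^sup>2 * V k + 2 * \<Gamma> k)" and A = "m * Q",
            OF r \<beta>(1) _ energy _ _ _ \<tau>])
        (use r m Q nonneg in \<open>auto simp: \<beta>\<close>)
    then have b: "(\<Sum>k<K. \<beta> (k - \<tau> k)) \<le> \<gamma>\<^sup>2 / (1 - r)\<^sup>2 *
        (real K * (m * Q) + (real T + 1) * (m\<^sup>2 * (12 * L\<^sup>2 * s + 2 * g)))"
      unfolding B by (simp add: power2_eq_square)
    have "s \<le> (N - 1) / N * (\<Sum>k<K. \<beta> (k - \<tau> k))"
      unfolding s_def N_def sum_distrib_left by (intro sum_mono consensus)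
    also have "\<dots> \<le> (N - 1) / N * (\<gamma>\<^sup>2 / (1 - r)\<^sup>2 *
        (real K * (m * Q) + (real T + 1) * (m\<^sup>2 * (12 * L\<^sup>2 * s + 2 * g))))"
      using b N by (intro mult_left_mono) auto
    also have "\<dots> = (N - 1) / N / (1 - r)\<^sup>2 * (\<gamma>\<^sup>2 *
        (real K * (m * Q) + (real T + 1) * (m\<^sup>2 * (12 * L\<^sup>2 * s + 2 * g))))"
      by simp
    also have "\<dots> \<le> R * (\<gamma>\<^sup>2 * (real K * (m * Q) + (real T + 1) * (m\<^sup>2 * (12 * L\<^sup>2 * s + 2 * g))))"
      unfolding R_def N_def[symmetric]
      using inverse_gap_le_rho_bar[OF r N] m Q s0 g0 by (intro mult_right_mono) auto
    finally show ?thesis by (simp add: C_def h_def algebra_simps power2_eq_square)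
  qed
  have s_bound: "L\<^sup>2 * (1 + 12 * \<epsilon>) * s \<le>
      real K * Q * (\<gamma> * L / N) * (1 / 2 - h * (real T)\<^sup>2 / N) + (1 / 2 - 2 * \<epsilon>) * g"
  proof -
    have "L\<^sup>2 * (1 + 12 * \<epsilon>) * s = L\<^sup>2 * (1 + 12 * \<epsilon>) / C * (s * C)" using ss(1) by simp
    also have "\<dots> \<le> L\<^sup>2 * (1 + 12 * \<epsilon>) / C * (\<gamma>\<^sup>2 * R * (real K * (m * Q) + (real T + 1) * (m\<^sup>2 * (2 * g))))"
      using s_le ss(1) \<epsilon> by (intro mult_left_mono) auto
    also have "\<dots> = real K * Q * (\<gamma> * L / N) * ((1 + 12 * \<epsilon>) * h * R * N / C)
        + (2 * h\<^sup>2 * R * (real T + 1) * (1 + 12 * \<epsilon>) / C) * g"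
      using ss(1) N by (simp add: h_def field_simps power2_eq_square)
    also have "\<dots> \<le> real K * Q * (\<gamma> * L / N) * (1 / 2 - h * (real T)\<^sup>2 / N) + (1 / 2 - 2 * \<epsilon>) * g"
    proof (intro add_mono mult_left_mono mult_right_mono)
      show "(1 + 12 * \<epsilon>) * h * R * N / C \<le> 1 / 2 - h * (real T)\<^sup>2 / N" using ss(3) by linarith
    qed (use ss(2) Q \<gamma> L N g0 in auto)
    finally show ?thesis .
  qed
  have telescope: "\<phi> K \<le> \<phi> 0 - \<gamma> * m / (2 * N) * ((\<Sum>k<K. S k) + g) + \<gamma> * m / N * L\<^sup>2 * ((\<Sum>k<K. d k) + s)
      + L * \<gamma>\<^sup>2 / (2 * N\<^sup>2) * e"
  proof -
    have "(\<Sum>k<K. \<phi> (Suc k) - \<phi> k) \<le> (\<Sum>k<K. - (\<gamma> * m / (2 * N) * (S k + \<Gamma> k)) +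
        \<gamma> * m / N * L\<^sup>2 * (d k + V k) + L * \<gamma>\<^sup>2 / (2 * N\<^sup>2) * E k)"
      using descent unfolding N_def by (intro sum_mono) (smt (verit))
    also have "\<dots> = - (\<gamma> * m / (2 * N) * ((\<Sum>k<K. S k) + g)) + \<gamma> * m / N * L\<^sup>2 * ((\<Sum>k<K. d k) + s)
      + L * \<gamma>\<^sup>2 / (2 * N\<^sup>2) * e"
      unfolding g_def s_def e_def sum.distrib[symmetric] sum_distrib_left sum_negf[symmetric] ..
    finally show ?thesis by (simp add: sum_lessThan_telescope)
  qed
  have d_le: "(\<Sum>k<K. d k) \<le> (\<gamma> / N)\<^sup>2 * (real T)\<^sup>2 * e"
  proof -
    have "(\<Sum>k<K. d k) \<le> (\<Sum>k<K. (\<gamma> / N)\<^sup>2 * (real T * (\<Sum>l\<in>{k - \<tau> k..<k}. E l)))"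
      unfolding N_def by (intro sum_mono drift)
    also have "\<dots> = (\<gamma> / N)\<^sup>2 * (real T * (\<Sum>k<K. \<Sum>l\<in>{k - \<tau> k..<k}. E l))"
      by (simp add: sum_distrib_left)
    also have "\<dots> \<le> (\<gamma> / N)\<^sup>2 * (real T * (real T * e))"
      unfolding e_def by (intro mult_left_mono sum_stale_window_le[OF nonneg(3) \<tau>]) auto
    finally show ?thesis by (simp add: power2_eq_square mult.assoc)
  qed
  (* kappa is the coefficient of e in the telescoped inequality divided by gamma m / n. *)
  define \<kappa> where "\<kappa> = L\<^sup>2 * (\<gamma> / N)\<^sup>2 * (real T)\<^sup>2 + L * \<gamma> / (2 * N * m)"
  have \<kappa>: "0 \<le> \<kappa>" using L \<gamma> m N by (simp add: \<kappa>_def)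
  have \<kappa>m: "\<kappa> * m\<^sup>2 = \<epsilon>"
    using m N by (simp add: \<kappa>_def \<epsilon>_def h_def N_def[symmetric] field_simps power2_eq_square)
  have \<kappa>Q: "\<kappa> * (real K * (m * Q)) = real K * Q * (\<gamma> * L / N) * (1 / 2 + h * (real T)\<^sup>2 / N)"
    using m N by (simp add: \<kappa>_def h_def field_simps power2_eq_square)
  have "lower \<le> \<phi> 0 - \<gamma> * m / (2 * N) * ((\<Sum>k<K. S k) + g) + \<gamma> * m / N * L\<^sup>2 * ((\<gamma> / N)\<^sup>2 * (real T)\<^sup>2 * e + s)
      + L * \<gamma>\<^sup>2 / (2 * N\<^sup>2) * e"
  proof -
    have "\<gamma> * m / N * L\<^sup>2 * ((\<Sum>k<K. d k) + s) \<le> \<gamma> * m / N * L\<^sup>2 * ((\<gamma> / N)\<^sup>2 * (real T)\<^sup>2 * e + s)"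
      using d_le \<gamma> m N by (intro mult_left_mono add_mono) auto
    then show ?thesis using lower telescope by linarith
  qed
  also have "\<dots> = \<phi> 0 + \<gamma> * m / N * (- ((\<Sum>k<K. S k) + g) / 2 + L\<^sup>2 * s + \<kappa> * e)"
    using m N \<gamma> by (simp add: \<kappa>_def field_simps power2_eq_square)
  finally have start: "- (N / (\<gamma> * m) * (\<phi> 0 - lower)) \<le> - ((\<Sum>k<K. S k) + g) / 2 + L\<^sup>2 * s + \<kappa> * e"
    using m N \<gamma> by (simp add: field_simps)
  have energy': "\<kappa> * e \<le> real K * Q * (\<gamma> * L / N) * (1 / 2 + h * (real T)\<^sup>2 / N) + \<epsilon> * (12 * L\<^sup>2 * s + 2 * g)"
    using mult_left_mono[OF e_le \<kappa>] \<kappa>m \<kappa>Q by (simp add: distrib_left mult.assoc[symmetric])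
  (* The remaining combination is linear in the following compound quantities. *)
  have linear: "z / 2 \<le> D + q"
    if "- D \<le> - (z + g) / 2 + x + y" "y \<le> q1 + w" "t \<le> q2 + w'"
      "q1 + q2 = q" "w = 12 * a + 2 * b" "t = x + 12 * a" "w' = g / 2 - 2 * b"
    for z D q x y q1 q2 t w w' a b :: real
    using that by argo
  have "real K * Q * (\<gamma> * L / N) * (1 / 2 + h * (real T)\<^sup>2 / N) + real K * Q * (\<gamma> * L / N) * (1 / 2 - h * (real T)\<^sup>2 / N)
      = real K * Q * (\<gamma> * L / N)"
    unfolding distrib_left[symmetric] by simp
  moreover have "\<epsilon> * (12 * L\<^sup>2 * s + 2 * g) = 12 * (\<epsilon> * L\<^sup>2 * s) + 2 * (\<epsilon> * g)"
    and "L\<^sup>2 * (1 + 12 * \<epsilon>) * s = L\<^sup>2 * s + 12 * (\<epsilon> * L\<^sup>2 * s)"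
    and "(1 / 2 - 2 * \<epsilon>) * g = g / 2 - 2 * (\<epsilon> * g)"
    by (simp_all add: algebra_simps)
  ultimately have "(\<Sum>k<K. S k) / 2 \<le> N / (\<gamma> * m) * (\<phi> 0 - lower) + real K * Q * (\<gamma> * L / N)"
    by (rule linear[OF start energy' s_bound])
  then have "2 / real K * ((\<Sum>k<K. S k) / 2) \<le> 2 / real K * (N / (\<gamma> * m) * (\<phi> 0 - lower) + real K * Q * (\<gamma> * L / N))"
    by (intro mult_left_mono) auto
  also have "\<dots> = 2 * (\<phi> 0 - lower) * N / (\<gamma> * real K * m) + 2 * \<gamma> * L / N * Q"
  proof -
    have "0 < real K" using K by simp
    then show ?thesis using \<gamma> m N by (simp add: divide_simps)
  qed
  finally show ?thesis using K by (simp add: N_def)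
qed

section \<open>The algorithm and its sources of randomness\<close>

text \<open>
  The setting of the theorem after two simplifications: gradients are abstract maps \<open>g\<close>
  (stochastic) and \<open>h\<close> (local), and the spectral assumption is replaced by the contraction
  that it implies, with \<open>r = sqrt \<rho>\<close>.
\<close>

locale adpsgd = prob_space P for P :: "'w measure" +
  fixes D :: "'n::finite \<Rightarrow> 's measure"
    and g :: "'n \<Rightarrow> real^'d \<Rightarrow> 's \<Rightarrow> real^'d"
    and h :: "'n \<Rightarrow> real^'d \<Rightarrow> real^'d"
    and f :: "real^'d \<Rightarrow> real"
    and fmin :: real
    and p :: "'n \<Rightarrow> real"
    and x0 :: "'w \<Rightarrow> real^'d"
    and I :: "nat \<Rightarrow> 'w \<Rightarrow> 'n"
    and W :: "nat \<Rightarrow> 'w \<Rightarrow> real^'n^'n"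
    and \<xi> :: "nat \<Rightarrow> 'n \<Rightarrow> nat \<Rightarrow> 'w \<Rightarrow> 's"
    and X :: "nat \<Rightarrow> 'w \<Rightarrow> real^'n^'d"
    and \<tau> :: "nat \<Rightarrow> nat"
    and m T :: nat
    and \<gamma> L r \<sigma> \<nu> :: real
  assumes p_nonneg: "\<And>i. 0 \<le> p i" and p_sum: "(\<Sum>i\<in>UNIV. p i) = 1"
    and gamma: "0 < \<gamma>"
    and g_meas: "\<And>i. (\<lambda>(x, s). g i x s) \<in> borel_measurable (borel \<Otimes>\<^sub>M D i)"
    and h_lip: "\<And>i. L-lipschitz_on UNIV (h i)"
    and f_deriv: "\<And>x. GDERIV f x :> (\<Sum>i\<in>UNIV. p i *\<^sub>R h i x)"
    and f_lower: "\<And>x. fmin \<le> f x"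
    and g_mean: "\<And>i x. has_bochner_integral (D i) (g i x) (h i x)"
    and g_var_int: "\<And>i x. integrable (D i) (\<lambda>s. (norm (g i x s - h i x))\<^sup>2)"
    and g_var: "\<And>i x. (\<integral>s. (norm (g i x s - h i x))\<^sup>2 \<partial>D i) \<le> \<sigma>\<^sup>2"
    and heterogeneity: "\<And>x. (\<Sum>i\<in>UNIV. p i * (norm (h i x - (\<Sum>j\<in>UNIV. p j *\<^sub>R h j x)))\<^sup>2) \<le> \<nu>\<^sup>2"
    and x0_meas: "x0 \<in> borel_measurable P"
    and f_x0_int: "integrable P (\<lambda>\<omega>. f (x0 \<omega>))"
    and I_meas: "\<And>k. I k \<in> measurable P (count_space UNIV)"
    and I_law: "\<And>k i. prob {\<omega> \<in> space P. I k \<omega> = i} = p i"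
    and W_meas: "\<And>k. W k \<in> borel_measurable P"
    and xi_meas: "\<And>k i j. j < m \<Longrightarrow> \<xi> k i j \<in> measurable P (D i)"
    and xi_law: "\<And>k i j. j < m \<Longrightarrow> distr P (D i) (\<xi> k i j) = D i"
    and batch_indep: "\<And>k i. indep_vars (\<lambda>_. D i) (\<lambda>j. \<xi> k i j) {..<m}"
    and sources_indep: "indep_sets (source_events P D m x0 I W \<xi>) UNIV"
    and W_stoch: "\<And>k. AE \<omega> in P. doubly_stochastic (W k \<omega>)"
    and r: "0 \<le> r" "r < 1"
    and contraction_int: "\<And>k u. u \<bullet> 1 = 0 \<Longrightarrow> square_integrable P (\<lambda>\<omega>. W k \<omega> *v u)"
    and contraction: "\<And>k u. u \<bullet> 1 = 0 \<Longrightarrow> (\<integral>\<omega>. (norm (W k \<omega> *v u))\<^sup>2 \<partial>P) \<le> r\<^sup>2 * (norm u)\<^sup>2"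
    and tau_le: "\<And>k. \<tau> k \<le> k" and tau_bound: "\<And>k. \<tau> k \<le> T"
    and X_0: "\<And>\<omega> i. \<omega> \<in> space P \<Longrightarrow> column i (X 0 \<omega>) = x0 \<omega>"
    and X_Suc: "\<And>\<omega> k. \<omega> \<in> space P \<Longrightarrow> X (Suc k) \<omega> = X k \<omega> ** W k \<omega> -
        \<gamma> *\<^sub>R (\<chi> l c. if c = I k \<omega>
          then (\<Sum>j<m. g (I k \<omega>) (column (I k \<omega>) (X (k - \<tau> k) \<omega>)) (\<xi> k (I k \<omega>) j \<omega>)) $ l else 0)"
begin

text \<open>
  With information recorded as a set of sources, independence becomes disjointness of sets.
\<close>

definition info :: "source set \<Rightarrow> 'w measure" where
  "info A = sigma (space P) (\<Union>s\<in>A. source_events P D m x0 I W \<xi> s)"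

lemma source_events_subset: "source_events P D m x0 I W \<xi> s \<subseteq> events"
  using sources_indep by (auto simp: indep_sets_def)

lemma space_info [simp]: "space (info A) = space P"
  unfolding info_def by (rule space_measure_of) (use source_events_subset sets.sets_into_space in blast)

lemma sets_info: "sets (info A) = sigma_sets (space P) (\<Union>s\<in>A. source_events P D m x0 I W \<xi> s)"
  unfolding info_def by (rule sets_measure_of) (use source_events_subset sets.sets_into_space in blast)

lemma sets_info_subset: "sets (info A) \<subseteq> events"
  unfolding sets_info using source_events_subset by (intro sets.sigma_sets_subset) auto

lemma measurable_info_imp: "Z \<in> measurable (info A) N \<Longrightarrow> Z \<in> measurable P N"
  using sets_info_subset by (auto simp: measurable_def)

lemma measurable_info_mono: "A \<subseteq> B \<Longrightarrow> Z \<in> measurable (info A) N \<Longrightarrow> Z \<in> measurable (info B) N"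
proof -
  assume "A \<subseteq> B"
  then have "sets (info A) \<subseteq> sets (info B)"
    unfolding sets_info by (intro sigma_sets_mono') blast
  moreover assume "Z \<in> measurable (info A) N"
  ultimately show "Z \<in> measurable (info B) N" by (auto simp: measurable_def)
qed

lemma in_sigma_sets_source:
  assumes "s \<in> A" "a \<in> source_events P D m x0 I W \<xi> s"
  shows "a \<in> sigma_sets (space P) (\<Union>s\<in>A. source_events P D m x0 I W \<xi> s)"
  using assms by (intro sigma_sets.Basic) blast

lemma measurable_info_x0: "Initial \<in> A \<Longrightarrow> x0 \<in> borel_measurable (info A)"
proof (rule measurableI)
  fix B :: "(real^'d) set" assume "Initial \<in> A" "B \<in> sets borel"
  then show "x0 -` B \<inter> space (info A) \<in> sets (info A)"
    unfolding sets_info space_info by (intro in_sigma_sets_source[of Initial]) auto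
qed simp

lemma measurable_info_Select:
  assumes "Select k \<in> A"
  shows "I k \<in> measurable (info A) (count_space UNIV)" "W k \<in> borel_measurable (info A)"
proof -
  have *: "(\<lambda>\<omega>. (I k \<omega>, W k \<omega>)) \<in> measurable (info A) (count_space UNIV \<Otimes>\<^sub>M borel)"
  proof (rule measurableI)
    fix B :: "('n \<times> (real^'n^'n)) set" assume "B \<in> sets (count_space UNIV \<Otimes>\<^sub>M borel)"
    then show "(\<lambda>\<omega>. (I k \<omega>, W k \<omega>)) -` B \<inter> space (info A) \<in> sets (info A)"
      using assms by (simp only: sets_info space_info) (rule in_sigma_sets_source[of "Select k"], auto)
  qed (auto simp: space_pair_measure)
  show "I k \<in> measurable (info A) (count_space UNIV)" using measurable_compose[OF * measurable_fst] by simp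
  show "W k \<in> borel_measurable (info A)" using measurable_compose[OF * measurable_snd] by simp
qed

lemma measurable_info_Batch:
  assumes "Batch k \<in> A" "j < m"
  shows "\<xi> k i j \<in> measurable (info A) (D i)"
proof -
  let ?N = "\<Pi>\<^sub>M (i, j)\<in>UNIV \<times> {..<m}. D i"
  let ?Y = "\<lambda>\<omega>. \<lambda>(i, j)\<in>UNIV \<times> {..<m}. \<xi> k i j \<omega>"
  have "?Y \<in> measurable (info A) ?N"
  proof (rule measurableI)
    fix B assume "B \<in> sets ?N"
    then show "?Y -` B \<inter> space (info A) \<in> sets (info A)"
      using assms by (simp only: sets_info space_info) (rule in_sigma_sets_source[of "Batch k"], simp, simp only: source_events.simps, blast)
  next
    fix \<omega> assume "\<omega> \<in> space (info A)"
    then show "?Y \<omega> \<in> space ?N"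
      using measurable_space[OF xi_meas] by (auto simp: space_PiM PiE_def Pi_def extensional_def)
  qed
  from measurable_compose[OF this measurable_component_singleton[of "(i, j)"]]
  show ?thesis using assms by simp
qed

lemma Int_stable_source_events: "Int_stable (source_events P D m x0 I W \<xi> s)"
proof -
  have *: "Int_stable {Z -` A \<inter> space P | A. A \<in> sets N}" for Z :: "'w \<Rightarrow> 'z" and N
  proof (rule Int_stableI)
    fix a b assume "a \<in> {Z -` A \<inter> space P | A. A \<in> sets N}" "b \<in> {Z -` A \<inter> space P | A. A \<in> sets N}"
    then obtain A B where "A \<in> sets N" "B \<in> sets N" "a = Z -` A \<inter> space P" "b = Z -` B \<inter> space P" by auto
    then show "a \<inter> b \<in> {Z -` A \<inter> space P | A. A \<in> sets N}"
      by (auto intro!: exI[of _ "A \<inter> B"])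
  qed
  show ?thesis by (cases s) (simp_all only: source_events.simps *)
qed

text \<open>
  The events of a single source are closed under intersection, so independence of the
  sources passes to the sigma-algebras that they generate.
\<close>

lemma independent_info:
  assumes "A \<inter> B = {}" "Z \<in> measurable (info A) N1" "Y \<in> measurable (info B) N2"
  shows "independent_rv N1 Z N2 Y"
proof -
  let ?J = "\<lambda>b. if b then A else B"
  have "indep_sets (\<lambda>b. sigma_sets (space P) (\<Union>s\<in>?J b. source_events P D m x0 I W \<xi> s)) UNIV"
  proof (rule indep_sets_collect_sigma)
    show "indep_sets (source_events P D m x0 I W \<xi>) (\<Union>b\<in>UNIV. ?J b)"
      by (rule indep_sets_mono_index[OF _ sources_indep]) auto
    show "disjoint_family_on ?J UNIV" using assms(1) by (auto simp: disjoint_family_on_def)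
  qed (rule Int_stable_source_events)
  then have ind: "indep_sets (\<lambda>b. sets (info (?J b))) UNIV" by (simp add: sets_info)
  have "prob ((Z -` a \<inter> space P) \<inter> (Y -` b \<inter> space P)) = prob (Z -` a \<inter> space P) * prob (Y -` b \<inter> space P)"
    if "a \<in> sets N1" "b \<in> sets N2" for a b
    using indep_setsD[OF ind, of UNIV "\<lambda>c. if c then Z -` a \<inter> space P else Y -` b \<inter> space P"]
      measurable_sets[OF assms(2) that(1)] measurable_sets[OF assms(3) that(2)]
    by (auto simp: UNIV_bool Int_commute mult.commute)
  then show ?thesis
    unfolding independent_rv_def using measurable_info_imp[OF assms(2)] measurable_info_imp[OF assms(3)] by simp
qed

definition past :: "nat \<Rightarrow> source set" where
  "past k = {Initial} \<union> Select ` {..<k} \<union> Batch ` {..<k}"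

lemma past_mono: "j \<le> k \<Longrightarrow> past j \<subseteq> past k"
  by (auto simp: past_def)

text \<open>
  The batch gradient that worker \<open>i\<close> would contribute at step \<open>k\<close> if it were selected.
\<close>

definition local_grad_sum :: "nat \<Rightarrow> 'n \<Rightarrow> 'w \<Rightarrow> real^'d" where
  "local_grad_sum k i \<omega> = (\<Sum>j<m. g i (column i (X (k - \<tau> k) \<omega>)) (\<xi> k i j \<omega>))"

definition update :: "nat \<Rightarrow> 'w \<Rightarrow> real^'d" where
  "update k \<omega> = local_grad_sum k (I k \<omega>) \<omega>"

text \<open>
  Only the selected column changes, so in direction \<open>u\<close> the update is weighted by a single
  component of \<open>u\<close>.
\<close>

lemma X_Suc_mult:
  assumes "\<omega> \<in> space P"
  shows "X (Suc k) \<omega> *v u = X k \<omega> *v (W k \<omega> *v u) - (\<gamma> * u $ I k \<omega>) *\<^sub>R update k \<omega>"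
proof -
  have "(\<chi> l c. if c = i then y $ l else 0) *v u = (u $ i) *\<^sub>R y" for i and y :: "real^'d"
    by (simp add: vec_eq_iff matrix_vector_mult_def if_distrib[of "\<lambda>z. z * _"] cong: if_cong)
  then show ?thesis
    unfolding X_Suc[OF assms] matrix_vector_mult_diff_rdistrib
    by (simp add: matrix_vector_mul_assoc scaleR_matrix_vector_assoc[symmetric] update_def local_grad_sum_def)
qed

lemma measurable_g:
  assumes "a \<in> borel_measurable N" "b \<in> measurable N (D i)"
  shows "(\<lambda>\<omega>. g i (a \<omega>) (b \<omega>)) \<in> borel_measurable N"
  using measurable_compose[OF measurable_Pair[OF assms] g_meas[of i]] by simp

lemma measurable_local_grad_sum:
  assumes "X (k - \<tau> k) \<in> borel_measurable (info A)" "Batch k \<in> A"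
  shows "local_grad_sum k i \<in> borel_measurable (info A)"
  unfolding local_grad_sum_def[abs_def] column_eq_mult
  using assms by (intro borel_measurable_sum measurable_g measurable_info_Batch borel_measurable_matrix_vector_mult) auto

lemma measurable_update:
  assumes "X (k - \<tau> k) \<in> borel_measurable (info A)" "Batch k \<in> A" "Select k \<in> A"
  shows "update k \<in> borel_measurable (info A)"
proof -
  have [measurable]: "I k \<in> measurable (info A) (count_space UNIV)" by (rule measurable_info_Select) fact
  show ?thesis
    unfolding update_def[abs_def]
    by (rule measurable_compose_countable[OF measurable_local_grad_sum]) (use assms in auto)
qed

text \<open>
  The delayed models are among the earlier ones, hence strong induction.
\<close>

lemma measurable_X_past: "X k \<in> borel_measurable (info (past k))"
proof (induction k rule: less_induct)
  case (less k)
  show ?case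
  proof (cases k)
    case 0
    have "(\<lambda>\<omega>. X 0 \<omega> $ i $ j) \<in> borel_measurable (info (past 0))" for i j
    proof (subst measurable_cong)
      fix \<omega> assume "\<omega> \<in> space (info (past 0))"
      then show "X 0 \<omega> $ i $ j = x0 \<omega> $ i"
        using X_0[of \<omega> j] by (auto simp: column_def vec_eq_iff)
    next
      show "(\<lambda>\<omega>. x0 \<omega> $ i) \<in> borel_measurable (info (past 0))"
        using measurable_info_x0[of "past 0"] by (simp add: past_def borel_measurable_vec_iff)
    qed
    then show ?thesis unfolding 0 borel_measurable_matrix_iff by blast
  next
    case (Suc l)
    have [measurable]: "X l \<in> borel_measurable (info (past k))"
      by (rule measurable_info_mono[OF past_mono less.IH]) (auto simp: Suc)
    have Xd: "X (l - \<tau> l) \<in> borel_measurable (info (past k))"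
      by (rule measurable_info_mono[OF past_mono less.IH]) (auto simp: Suc)
    have [measurable]: "W l \<in> borel_measurable (info (past k))" "I l \<in> measurable (info (past k)) (count_space UNIV)"
      by (rule measurable_info_Select; simp add: past_def Suc)+
    have [measurable]: "update l \<in> borel_measurable (info (past k))"
      by (rule measurable_update[OF Xd]) (auto simp: past_def Suc)
    have "(\<lambda>\<omega>. X k \<omega> $ i $ j) \<in> borel_measurable (info (past k))" for i j
    proof (subst measurable_cong)
      fix \<omega> assume "\<omega> \<in> space (info (past k))"
      then have "X k \<omega> = X l \<omega> ** W l \<omega> - \<gamma> *\<^sub>R (\<chi> l' c. if c = I l \<omega> then update l \<omega> $ l' else 0)"
        unfolding Suc update_def local_grad_sum_def by (intro X_Suc) simp
      then show "X k \<omega> $ i $ j = (X l \<omega> ** W l \<omega>) $ i $ j - \<gamma> * (if I l \<omega> = j then update l \<omega> $ i else 0)"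
        by simp
    next
      have [measurable]: "(\<lambda>\<omega>. update l \<omega> $ i) \<in> borel_measurable (info (past k))"
        using \<open>update l \<in> borel_measurable (info (past k))\<close> by (simp add: borel_measurable_vec_iff)
      show "(\<lambda>\<omega>. (X l \<omega> ** W l \<omega>) $ i $ j - \<gamma> * (if I l \<omega> = j then update l \<omega> $ i else 0)) \<in> borel_measurable (info (past k))"
        by measurable
    qed
    then show ?thesis unfolding borel_measurable_matrix_iff by blast
  qed
qed

lemma measurable_X [measurable]: "X k \<in> borel_measurable P"
  by (rule measurable_info_imp[OF measurable_X_past])

lemma measurable_update' [measurable]: "update k \<in> borel_measurable P"
proof (rule measurable_info_imp)
  show "update k \<in> borel_measurable (info UNIV)"
    by (rule measurable_update) (rule measurable_info_mono[OF subset_UNIV measurable_X_past], simp_all)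
qed

section \<open>Moments of one update\<close>

text \<open>
  The worker is chosen independently of everything computed from other sources.
\<close>

lemma nn_integral_selected:
  assumes Y: "Y \<in> borel_measurable (info A)" and "Select k \<notin> A"
  shows "(\<integral>\<^sup>+\<omega>. Y \<omega> * indicator {i} (I k \<omega>) \<partial>P) = ennreal (p i) * (\<integral>\<^sup>+\<omega>. Y \<omega> \<partial>P)"
proof -
  have Y': "Y \<in> borel_measurable P" by (rule measurable_info_imp[OF Y])
  have ind: "independent_rv borel Y (count_space UNIV) (I k)"
    by (rule independent_info[OF _ Y measurable_info_Select(1)[of k "{Select k}"]]) (use assms in auto)
  have "(\<integral>\<^sup>+\<omega>'. indicator {i} (I k \<omega>') \<partial>P) = ennreal (p i)"
  proof -
    have "(\<integral>\<^sup>+\<omega>'. indicator {i} (I k \<omega>') \<partial>P) = (\<integral>\<^sup>+\<omega>'. indicator {\<omega> \<in> space P. I k \<omega> = i} \<omega>' \<partial>P)"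
      by (intro nn_integral_cong) (auto simp: indicator_def)
    also have "\<dots> = ennreal (p i)"
      using I_meas[of k] by (subst nn_integral_indicator) (auto simp: emeasure_eq_measure I_law)
    finally show ?thesis .
  qed
  then have "(\<integral>\<^sup>+\<omega>'. Y \<omega> * indicator {i} (I k \<omega>') \<partial>P) = Y \<omega> * ennreal (p i)" for \<omega>
    using I_meas[of k] by (subst nn_integral_cmult) auto
  moreover have "(\<lambda>(y, \<iota>). y * indicator {i} \<iota>) \<in> borel_measurable (borel \<Otimes>\<^sub>M count_space UNIV :: (ennreal \<times> 'n) measure)"
    by measurable
  ultimately show ?thesis
    using nn_integral_independent_copy[OF ind, of "\<lambda>(y, \<iota>). y * indicator {i} \<iota>"] Y'
    by (simp add: nn_integral_multc mult.commute)
qed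

text \<open>
  If worker \<open>i\<close> is chosen with probability 0 then \<open>Y\<close> need not be integrable, but the
  left-hand side vanishes almost surely. This matters since the gradient of such a worker at
  the initial model can fail to be integrable.
\<close>

lemma integral_selected:
  fixes Y :: "'w \<Rightarrow> real"
  assumes Y: "Y \<in> borel_measurable (info A)" and "Select k \<notin> A" and int: "p i \<noteq> 0 \<Longrightarrow> integrable P Y"
  shows "integrable P (\<lambda>\<omega>. Y \<omega> * indicator {i} (I k \<omega>))"
    and "(\<integral>\<omega>. Y \<omega> * indicator {i} (I k \<omega>) \<partial>P) = p i * (\<integral>\<omega>. Y \<omega> \<partial>P)"
proof -
  have Y': "Y \<in> borel_measurable P" by (rule measurable_info_imp[OF Y])
  note I_meas[measurable] Y'[measurable]
  have "integrable P (\<lambda>\<omega>. Y \<omega> * indicator {i} (I k \<omega>)) \<and>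
    (\<integral>\<omega>. Y \<omega> * indicator {i} (I k \<omega>) \<partial>P) = p i * (\<integral>\<omega>. Y \<omega> \<partial>P)"
  proof (cases "p i = 0")
    case True
    have "AE \<omega> in P. \<not> I k \<omega> = i"
      by (rule AE_I'[of "{\<omega> \<in> space P. I k \<omega> = i}"])
        (auto simp: null_sets_def emeasure_eq_measure I_law True)
    then have ae: "AE \<omega> in P. Y \<omega> * indicator {i} (I k \<omega>) = 0" by eventually_elim auto
    have "integrable P (\<lambda>\<omega>. Y \<omega> * indicator {i} (I k \<omega>)) \<longleftrightarrow> integrable P (\<lambda>\<omega>. 0 :: real)"
      by (rule integrable_cong_AE) (use ae in auto)
    moreover have "(\<integral>\<omega>. Y \<omega> * indicator {i} (I k \<omega>) \<partial>P) = 0"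
      using ae by (rule integral_eq_zero_AE)
    ultimately show ?thesis using True by simp
  next
    case False
    then have intY: "integrable P Y" by (rule int)
    have intp: "integrable P (\<lambda>\<omega>. Y \<omega> * indicator {i} (I k \<omega>))"
      by (rule Bochner_Integration.integrable_bound[OF intY]) (auto simp: indicator_def)
    have ind: "independent_rv borel Y (count_space UNIV) (I k)"
      by (rule independent_info[OF _ Y measurable_info_Select(1)[of k "{Select k}"]]) (use assms in auto)
    have EI: "(\<integral>\<omega>'. indicator {i} (I k \<omega>') \<partial>P) = p i"
    proof -
      have "(\<integral>\<omega>'. indicator {i} (I k \<omega>') \<partial>P) = (\<integral>\<omega>'. indicator {\<omega> \<in> space P. I k \<omega> = i} \<omega>' \<partial>P)"
        by (intro Bochner_Integration.integral_cong) (auto simp: indicator_def)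
      also have "\<dots> = p i" by (simp add: I_law)
      finally show ?thesis .
    qed
    have "(\<lambda>(y, \<iota>). y * indicator {i} \<iota>) \<in> borel_measurable (borel \<Otimes>\<^sub>M count_space UNIV :: (real \<times> 'n) measure)"
      by measurable
    then show ?thesis
      using integral_independent_copy[OF ind, of "\<lambda>(y, \<iota>). y * indicator {i} \<iota>"] intp
      by (simp add: EI mult.commute)
  qed
  then show "integrable P (\<lambda>\<omega>. Y \<omega> * indicator {i} (I k \<omega>))"
    and "(\<integral>\<omega>. Y \<omega> * indicator {i} (I k \<omega>) \<partial>P) = p i * (\<integral>\<omega>. Y \<omega> \<partial>P)" by auto
qed

lemma batch_at_fixed_point:
  shows "has_bochner_integral P (\<lambda>\<omega>. \<Sum>j<m. g i x (\<xi> k i j \<omega>)) (real m *\<^sub>R h i x)"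
    and "square_integrable P (\<lambda>\<omega>. \<Sum>j<m. g i x (\<xi> k i j \<omega>))"
    and "(\<integral>\<omega>. (norm (\<Sum>j<m. g i x (\<xi> k i j \<omega>)))\<^sup>2 \<partial>P) \<le> real m * \<sigma>\<^sup>2 + (real m)\<^sup>2 * (norm (h i x))\<^sup>2"
proof -
  have [measurable]: "g i x \<in> borel_measurable (D i)"
    by (rule borel_measurable_has_bochner_integral[OF g_mean])
  have mean: "has_bochner_integral P (\<lambda>\<omega>. g i x (\<xi> k i j \<omega>)) (h i x)" if "j < m" for j
    using g_mean[of i x] xi_meas[OF that]
    by (subst (asm) xi_law[OF that, symmetric, of i k])
      (simp add: has_bochner_integral_iff integrable_distr_eq integral_distr)
  have var: "integrable P (\<lambda>\<omega>. (norm (g i x (\<xi> k i j \<omega>) - h i x))\<^sup>2)"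
    "(\<integral>\<omega>. (norm (g i x (\<xi> k i j \<omega>) - h i x))\<^sup>2 \<partial>P) \<le> \<sigma>\<^sup>2" if "j < m" for j
  proof -
    note [measurable] = xi_meas[OF that]
    show "integrable P (\<lambda>\<omega>. (norm (g i x (\<xi> k i j \<omega>) - h i x))\<^sup>2)"
      using g_var_int[of i x] by (subst (asm) xi_law[OF that, symmetric, of i k]) (simp add: integrable_distr_eq)
    show "(\<integral>\<omega>. (norm (g i x (\<xi> k i j \<omega>) - h i x))\<^sup>2 \<partial>P) \<le> \<sigma>\<^sup>2"
      using g_var[of i x] by (subst (asm) xi_law[OF that, symmetric, of i k]) (simp add: integral_distr)
  qed
  have ind: "indep_vars (\<lambda>_. borel) (\<lambda>j \<omega>. g i x (\<xi> k i j \<omega>)) {..<m}"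
    by (rule indep_vars_compose2[OF batch_indep]) auto
  show "has_bochner_integral P (\<lambda>\<omega>. \<Sum>j<m. g i x (\<xi> k i j \<omega>)) (real m *\<^sub>R h i x)"
    using has_bochner_integral_sum[of "{..<m}" P "\<lambda>j \<omega>. g i x (\<xi> k i j \<omega>)" "\<lambda>_. h i x"] mean
    by (simp add: sum_constant_scaleR del: sum_constant)
  show "square_integrable P (\<lambda>\<omega>. \<Sum>j<m. g i x (\<xi> k i j \<omega>))"
    and "(\<integral>\<omega>. (norm (\<Sum>j<m. g i x (\<xi> k i j \<omega>)))\<^sup>2 \<partial>P) \<le> real m * \<sigma>\<^sup>2 + (real m)\<^sup>2 * (norm (h i x))\<^sup>2"
    using expectation_sq_norm_iid_sum[OF ind mean var] by auto
qed

lemma independent_batch: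
  assumes "Z \<in> measurable (info (past k)) N"
  shows "independent_rv N Z (\<Pi>\<^sub>M j\<in>{..<m}. D i) (\<lambda>\<omega>. \<lambda>j\<in>{..<m}. \<xi> k i j \<omega>)"
  by (rule independent_info[of "past k" "{Batch k}", OF _ assms])
    (auto simp: past_def intro!: measurable_restrict measurable_info_Batch)

lemma measurable_batch_sum:
  assumes "a \<in> borel_measurable N"
  shows "(\<lambda>z. \<Sum>j<m. g i (a (fst z)) (snd z j)) \<in> borel_measurable (N \<Otimes>\<^sub>M (\<Pi>\<^sub>M j\<in>{..<m}. D i))"
  using measurable_compose[OF measurable_fst assms]
  by (intro borel_measurable_sum measurable_g measurable_compose[OF measurable_snd measurable_component_singleton]) auto

definition avg :: "nat \<Rightarrow> 'w \<Rightarrow> real^'d" where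
  "avg k \<omega> = average_model (X k \<omega>)"

text \<open>
  By linearity this is the gradient of \<open>f\<close>.
\<close>

definition grad_f :: "real^'d \<Rightarrow> real^'d" where
  "grad_f x = (\<Sum>i\<in>UNIV. p i *\<^sub>R h i x)"

definition stale :: "nat \<Rightarrow> 'n \<Rightarrow> 'w \<Rightarrow> real^'d" where
  "stale k i \<omega> = column i (X (k - \<tau> k) \<omega>)"

definition mean_grad :: "nat \<Rightarrow> 'w \<Rightarrow> real^'d" where
  "mean_grad k \<omega> = (\<Sum>i\<in>UNIV. p i *\<^sub>R h i (stale k i \<omega>))"

definition disagreement :: "nat \<Rightarrow> 'w \<Rightarrow> real" where
  "disagreement k \<omega> = (\<Sum>i\<in>UNIV. p i * (norm (stale k i \<omega> - avg (k - \<tau> k) \<omega>))\<^sup>2)"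

lemma grad_f_lip: "L-lipschitz_on UNIV grad_f"
  unfolding grad_f_def[abs_def] by (rule lipschitz_weighted_sum[OF p_nonneg p_sum h_lip])

lemma grad_f_meas [measurable]: "grad_f \<in> borel_measurable borel"
  by (rule borel_measurable_continuous_onI[OF lipschitz_on_continuous_on[OF grad_f_lip]])

lemma h_meas [measurable]: "h i \<in> borel_measurable borel"
  by (rule borel_measurable_continuous_onI[OF lipschitz_on_continuous_on[OF h_lip]])

lemma f_meas [measurable]: "f \<in> borel_measurable borel"
proof (rule borel_measurable_continuous_onI)
  have "isCont f x" for x
    using f_deriv[of x] unfolding gderiv_def by (rule has_derivative_continuous)
  then show "continuous_on UNIV f" by (simp add: continuous_at_imp_continuous_on)
qed

lemma f_GDERIV: "GDERIV f x :> grad_f x"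
  unfolding grad_f_def by (rule f_deriv)

lemma measurable_past:
  shows "stale k i \<in> borel_measurable (info (past k))" "avg k \<in> borel_measurable (info (past k))"
proof -
  have "X (k - \<tau> k) \<in> borel_measurable (info (past k))"
    by (rule measurable_info_mono[OF past_mono measurable_X_past]) simp
  then show "stale k i \<in> borel_measurable (info (past k))"
    unfolding stale_def[abs_def] column_eq_mult by measurable
  show "avg k \<in> borel_measurable (info (past k))"
    using measurable_X_past[of k] unfolding avg_def[abs_def] average_model_def by measurable
qed

lemma measurable_stale [measurable]: "stale k i \<in> borel_measurable P"
  by (rule measurable_info_imp[OF measurable_past(1)])

lemma measurable_avg [measurable]: "avg k \<in> borel_measurable P"
  by (rule measurable_info_imp[OF measurable_past(2)])

lemma measurable_mean_grad [measurable]: "mean_grad k \<in> borel_measurable P"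
  unfolding mean_grad_def[abs_def] by measurable

lemma measurable_disagreement [measurable]: "disagreement k \<in> borel_measurable P"
  unfolding disagreement_def[abs_def] by measurable

lemma disagreement_nonneg: "0 \<le> disagreement k \<omega>"
  unfolding disagreement_def using p_nonneg by (intro sum_nonneg) auto

lemma local_grad_sum_measurable:
  shows "local_grad_sum k i \<in> borel_measurable (info (past k \<union> {Batch k}))"
    and "local_grad_sum k i \<in> borel_measurable P"
proof -
  show "local_grad_sum k i \<in> borel_measurable (info (past k \<union> {Batch k}))"
  proof (rule measurable_local_grad_sum)
    have "past (k - \<tau> k) \<subseteq> past k \<union> {Batch k}" using past_mono[of "k - \<tau> k" k] by auto
    then show "X (k - \<tau> k) \<in> borel_measurable (info (past k \<union> {Batch k}))"
      by (rule measurable_info_mono[OF _ measurable_X_past])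
  qed simp
  then show "local_grad_sum k i \<in> borel_measurable P" by (rule measurable_info_imp)
qed

lemma local_grad_sum_restrict:
  "local_grad_sum k i \<omega> = (\<Sum>j<m. g i (stale k i \<omega>) ((\<lambda>j\<in>{..<m}. \<xi> k i j \<omega>) j))"
  unfolding local_grad_sum_def stale_def by (intro sum.cong) auto

text \<open>
  The batch is independent of the past, so the estimate for a fixed point applies with the
  delayed model as that point.
\<close>

lemma nn_second_moment_local_grad_sum:
  "(\<integral>\<^sup>+\<omega>. ennreal ((norm (local_grad_sum k i \<omega>))\<^sup>2) \<partial>P) \<le>
    (\<integral>\<^sup>+\<omega>. ennreal (real m * \<sigma>\<^sup>2 + (real m)\<^sup>2 * (norm (h i (stale k i \<omega>)))\<^sup>2) \<partial>P)"
proof -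
  let ?\<phi> = "\<lambda>z. ennreal ((norm (\<Sum>j<m. g i (fst z) (snd z j)))\<^sup>2)"
  have \<phi>: "?\<phi> \<in> borel_measurable (borel \<Otimes>\<^sub>M (\<Pi>\<^sub>M j\<in>{..<m}. D i))"
    using measurable_batch_sum[of "\<lambda>x. x" borel i] by measurable
  have "(\<integral>\<^sup>+\<omega>. ennreal ((norm (local_grad_sum k i \<omega>))\<^sup>2) \<partial>P) =
      (\<integral>\<^sup>+\<omega>. \<integral>\<^sup>+\<omega>'. ennreal ((norm (\<Sum>j<m. g i (stale k i \<omega>) ((\<lambda>j\<in>{..<m}. \<xi> k i j \<omega>') j)))\<^sup>2) \<partial>P \<partial>P)"
    using nn_integral_independent_copy[OF independent_batch[OF measurable_past(1)] \<phi>, of k i]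
    by (simp add: local_grad_sum_restrict)
  also have "\<dots> = (\<integral>\<^sup>+\<omega>. \<integral>\<^sup>+\<omega>'. ennreal ((norm (\<Sum>j<m. g i (stale k i \<omega>) (\<xi> k i j \<omega>')))\<^sup>2) \<partial>P \<partial>P)"
    by (intro nn_integral_cong arg_cong[where f = ennreal] arg_cong[where f = "\<lambda>v. (norm v)\<^sup>2"] sum.cong) auto
  also have "\<dots> \<le> (\<integral>\<^sup>+\<omega>. ennreal (real m * \<sigma>\<^sup>2 + (real m)\<^sup>2 * (norm (h i (stale k i \<omega>)))\<^sup>2) \<partial>P)"
  proof (rule nn_integral_mono)
    fix \<omega>
    show "(\<integral>\<^sup>+\<omega>'. ennreal ((norm (\<Sum>j<m. g i (stale k i \<omega>) (\<xi> k i j \<omega>')))\<^sup>2) \<partial>P) \<le>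
        ennreal (real m * \<sigma>\<^sup>2 + (real m)\<^sup>2 * (norm (h i (stale k i \<omega>)))\<^sup>2)"
      by (subst nn_integral_eq_integral[OF square_integrableD(2)[OF batch_at_fixed_point(2)]])
        (auto intro!: ennreal_leI batch_at_fixed_point(3) simp del: ennreal_plus)
  qed
  finally show ?thesis .
qed

lemma update_eq_sum_selected: "\<phi> (update k \<omega>) = (\<Sum>i\<in>UNIV. \<phi> (local_grad_sum k i \<omega>) * indicator {i} (I k \<omega>))"
  for \<phi> :: "_ \<Rightarrow> 'b::semiring_1"
proof -
  have "(\<Sum>i\<in>UNIV. \<phi> (local_grad_sum k i \<omega>) * indicator {i} (I k \<omega>)) =
      (\<Sum>i\<in>UNIV. if i = I k \<omega> then \<phi> (local_grad_sum k i \<omega>) else 0)"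
    by (intro sum.cong) (auto simp: indicator_def)
  then show ?thesis by (simp add: update_def)
qed

definition grad_energy_bound :: "nat \<Rightarrow> 'w \<Rightarrow> real" where
  "grad_energy_bound k \<omega> = 12 * L\<^sup>2 * disagreement k \<omega> + 6 * \<nu>\<^sup>2 + 2 * (norm (mean_grad k \<omega>))\<^sup>2"

lemma grad_energy_le: "(\<Sum>i\<in>UNIV. p i * (norm (h i (stale k i \<omega>)))\<^sup>2) \<le> grad_energy_bound k \<omega>"
  unfolding grad_energy_bound_def disagreement_def mean_grad_def
  by (rule weighted_gradients_sq_le[OF p_nonneg p_sum h_lip heterogeneity])

lemma nn_second_moment_update:
  "(\<integral>\<^sup>+\<omega>. ennreal ((norm (update k \<omega>))\<^sup>2) \<partial>P) \<le>
    (\<integral>\<^sup>+\<omega>. ennreal (real m * \<sigma>\<^sup>2 + (real m)\<^sup>2 * grad_energy_bound k \<omega>) \<partial>P)"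
proof -
  note [measurable] = local_grad_sum_measurable(2) I_meas
  have "(\<integral>\<^sup>+\<omega>. ennreal ((norm (update k \<omega>))\<^sup>2) \<partial>P) =
      (\<integral>\<^sup>+\<omega>. (\<Sum>i\<in>UNIV. ennreal ((norm (local_grad_sum k i \<omega>))\<^sup>2) * indicator {i} (I k \<omega>)) \<partial>P)"
    using update_eq_sum_selected[of "\<lambda>v. ennreal ((norm v)\<^sup>2)"] by simp
  also have "\<dots> = (\<Sum>i\<in>UNIV. (\<integral>\<^sup>+\<omega>. ennreal ((norm (local_grad_sum k i \<omega>))\<^sup>2) * indicator {i} (I k \<omega>) \<partial>P))"
    by (rule nn_integral_sum) measurable
  also have "\<dots> = (\<Sum>i\<in>UNIV. ennreal (p i) * (\<integral>\<^sup>+\<omega>. ennreal ((norm (local_grad_sum k i \<omega>))\<^sup>2) \<partial>P))"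
  proof (intro sum.cong refl nn_integral_selected)
    fix i
    show "(\<lambda>\<omega>. ennreal ((norm (local_grad_sum k i \<omega>))\<^sup>2)) \<in> borel_measurable (info (past k \<union> {Batch k}))"
      using local_grad_sum_measurable(1)[of k i] by measurable
  qed (auto simp: past_def)
  also have "\<dots> \<le> (\<Sum>i\<in>UNIV. ennreal (p i) * (\<integral>\<^sup>+\<omega>. ennreal (real m * \<sigma>\<^sup>2 + (real m)\<^sup>2 * (norm (h i (stale k i \<omega>)))\<^sup>2) \<partial>P))"
    by (intro sum_mono mult_left_mono nn_second_moment_local_grad_sum) simp
  also have "\<dots> = (\<integral>\<^sup>+\<omega>. (\<Sum>i\<in>UNIV. ennreal (p i) * ennreal (real m * \<sigma>\<^sup>2 + (real m)\<^sup>2 * (norm (h i (stale k i \<omega>)))\<^sup>2)) \<partial>P)"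
    by (subst nn_integral_sum, measurable) (simp add: nn_integral_cmult)
  also have "\<dots> \<le> (\<integral>\<^sup>+\<omega>. ennreal (real m * \<sigma>\<^sup>2 + (real m)\<^sup>2 * grad_energy_bound k \<omega>) \<partial>P)"
  proof (rule nn_integral_mono)
    fix \<omega>
    have "(\<Sum>i\<in>UNIV. ennreal (p i) * ennreal (real m * \<sigma>\<^sup>2 + (real m)\<^sup>2 * (norm (h i (stale k i \<omega>)))\<^sup>2)) =
        ennreal (\<Sum>i\<in>UNIV. p i * (real m * \<sigma>\<^sup>2 + (real m)\<^sup>2 * (norm (h i (stale k i \<omega>)))\<^sup>2))"
      using p_nonneg by (subst sum_ennreal[symmetric]) (auto simp: ennreal_mult)
    also have "(\<Sum>i\<in>UNIV. p i * (real m * \<sigma>\<^sup>2 + (real m)\<^sup>2 * (norm (h i (stale k i \<omega>)))\<^sup>2)) =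
        (\<Sum>i\<in>UNIV. p i) * (real m * \<sigma>\<^sup>2) + (real m)\<^sup>2 * (\<Sum>i\<in>UNIV. p i * (norm (h i (stale k i \<omega>)))\<^sup>2)"
      unfolding sum_distrib_left sum_distrib_right sum.distrib[symmetric] by (intro sum.cong refl) (simp add: algebra_simps)
    also have "\<dots> \<le> real m * \<sigma>\<^sup>2 + (real m)\<^sup>2 * grad_energy_bound k \<omega>"
      using mult_left_mono[OF grad_energy_le, of "(real m)\<^sup>2" k \<omega>] by (simp add: p_sum)
    finally show "(\<Sum>i\<in>UNIV. ennreal (p i) * ennreal (real m * \<sigma>\<^sup>2 + (real m)\<^sup>2 * (norm (h i (stale k i \<omega>)))\<^sup>2)) \<le>
        ennreal (real m * \<sigma>\<^sup>2 + (real m)\<^sup>2 * grad_energy_bound k \<omega>)" by (simp add: ennreal_leI)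
  qed
  finally show ?thesis .
qed

text \<open>
  The conditional mean of the update given the past is \<open>m\<close> times the weighted mean of the
  local gradients: first the batch is averaged out for each worker, then the choice of the
  worker.
\<close>

lemma inner_update:
  assumes sq_H: "square_integrable P (\<lambda>\<omega>. grad_f (avg k \<omega>))"
    and sq_update: "square_integrable P (update k)"
    and dis: "integrable P (disagreement k)" and sq_mean: "square_integrable P (mean_grad k)"
  shows "(\<integral>\<omega>. grad_f (avg k \<omega>) \<bullet> update k \<omega> \<partial>P) = real m * (\<integral>\<omega>. grad_f (avg k \<omega>) \<bullet> mean_grad k \<omega> \<partial>P)"
proof -
  note [measurable] = local_grad_sum_measurable(2) I_meas
  have bound: "integrable P (grad_energy_bound k)"
    unfolding grad_energy_bound_def[abs_def] using dis square_integrableD(2)[OF sq_mean] by simp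
  (* Only the weighted sum of the squares is controlled, so p i has to be divided out. *)
  have sq_h: "square_integrable P (\<lambda>\<omega>. h i (stale k i \<omega>))" if "p i \<noteq> 0" for i
  proof (rule square_integrable_bound[of _ _ "\<lambda>\<omega>. grad_energy_bound k \<omega> / p i"])
    have "0 < p i" using that p_nonneg[of i] by simp
    moreover have "p i * (norm (h i (stale k i \<omega>)))\<^sup>2 \<le> grad_energy_bound k \<omega>" for \<omega>
    proof -
      have "p i * (norm (h i (stale k i \<omega>)))\<^sup>2 \<le> (\<Sum>i\<in>UNIV. p i * (norm (h i (stale k i \<omega>)))\<^sup>2)"
        using p_nonneg by (intro member_le_sum) auto
      also have "\<dots> \<le> grad_energy_bound k \<omega>" by (rule grad_energy_le)
      finally show ?thesis .
    qed
    ultimately show "AE \<omega> in P. (norm (h i (stale k i \<omega>)))\<^sup>2 \<le> grad_energy_bound k \<omega> / p i"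
      by (auto simp: field_simps)
  qed (use bound in auto)
  have sq_S: "square_integrable P (local_grad_sum k i)" if "p i \<noteq> 0" for i
  proof (rule square_integrable_nn_integral(1))
    have int: "integrable P (\<lambda>\<omega>. real m * \<sigma>\<^sup>2 + (real m)\<^sup>2 * (norm (h i (stale k i \<omega>)))\<^sup>2)"
      using square_integrableD(2)[OF sq_h[OF that]] by simp
    have "(\<integral>\<^sup>+\<omega>. ennreal ((norm (local_grad_sum k i \<omega>))\<^sup>2) \<partial>P) \<le>
        (\<integral>\<^sup>+\<omega>. ennreal (real m * \<sigma>\<^sup>2 + (real m)\<^sup>2 * (norm (h i (stale k i \<omega>)))\<^sup>2) \<partial>P)"
      by (rule nn_second_moment_local_grad_sum)
    also have "\<dots> = ennreal (\<integral>\<omega>. real m * \<sigma>\<^sup>2 + (real m)\<^sup>2 * (norm (h i (stale k i \<omega>)))\<^sup>2 \<partial>P)"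
      by (rule nn_integral_eq_integral[OF int]) simp
    finally show "(\<integral>\<^sup>+\<omega>. ennreal ((norm (local_grad_sum k i \<omega>))\<^sup>2) \<partial>P) \<le>
      ennreal (\<integral>\<omega>. real m * \<sigma>\<^sup>2 + (real m)\<^sup>2 * (norm (h i (stale k i \<omega>)))\<^sup>2 \<partial>P)" .
    show "0 \<le> (\<integral>\<omega>. real m * \<sigma>\<^sup>2 + (real m)\<^sup>2 * (norm (h i (stale k i \<omega>)))\<^sup>2 \<partial>P)" by simp
  qed simp
  have local: "(\<integral>\<omega>. grad_f (avg k \<omega>) \<bullet> local_grad_sum k i \<omega> \<partial>P) = real m * (\<integral>\<omega>. grad_f (avg k \<omega>) \<bullet> h i (stale k i \<omega>) \<partial>P)"
    if "p i \<noteq> 0" for i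
  proof -
    let ?Z = "\<lambda>\<omega>. (grad_f (avg k \<omega>), stale k i \<omega>)"
    let ?Y = "\<lambda>\<omega>. \<lambda>j\<in>{..<m}. \<xi> k i j \<omega>"
    let ?\<phi> = "\<lambda>z. fst (fst z) \<bullet> (\<Sum>j<m. g i (snd (fst z)) (snd z j))"
    have Z: "?Z \<in> measurable (info (past k)) (borel \<Otimes>\<^sub>M borel)"
      using measurable_past[of k] by measurable
    have \<phi>: "?\<phi> \<in> borel_measurable ((borel \<Otimes>\<^sub>M borel) \<Otimes>\<^sub>M (\<Pi>\<^sub>M j\<in>{..<m}. D i))"
      using measurable_batch_sum[of snd "borel \<Otimes>\<^sub>M borel" i] by measurable
    have "(\<integral>\<omega>. grad_f (avg k \<omega>) \<bullet> local_grad_sum k i \<omega> \<partial>P) = (\<integral>\<omega>. ?\<phi> (?Z \<omega>, ?Y \<omega>) \<partial>P)"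
      unfolding local_grad_sum_restrict by simp
    also have "\<dots> = (\<integral>\<omega>. \<integral>\<omega>'. ?\<phi> (?Z \<omega>, ?Y \<omega>') \<partial>P \<partial>P)"
    proof (rule integral_independent_copy[OF independent_batch[OF Z] \<phi>])
      show "integrable P (\<lambda>\<omega>. ?\<phi> (?Z \<omega>, ?Y \<omega>))"
        using integrable_inner[OF sq_H sq_S[OF that]] unfolding local_grad_sum_restrict by simp
    qed
    also have "\<dots> = (\<integral>\<omega>. \<integral>\<omega>'. grad_f (avg k \<omega>) \<bullet> (\<Sum>j<m. g i (stale k i \<omega>) (\<xi> k i j \<omega>')) \<partial>P \<partial>P)"
      by simp
    also have "\<dots> = (\<integral>\<omega>. real m * (grad_f (avg k \<omega>) \<bullet> h i (stale k i \<omega>)) \<partial>P)"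
      using has_bochner_integral_inner_right[OF batch_at_fixed_point(1)]
      by (intro Bochner_Integration.integral_cong refl) (simp add: has_bochner_integral_iff)
    finally show ?thesis by simp
  qed
  have meas: "(\<lambda>\<omega>. grad_f (avg k \<omega>) \<bullet> local_grad_sum k i \<omega>) \<in> borel_measurable (info (past k \<union> {Batch k}))" for i
  proof -
    have [measurable]: "avg k \<in> borel_measurable (info (past k \<union> {Batch k}))"
      by (rule measurable_info_mono[OF Un_upper1 measurable_past(2)])
    note [measurable] = local_grad_sum_measurable(1)[of k i]
    show ?thesis by measurable
  qed
  have int: "p i \<noteq> 0 \<Longrightarrow> integrable P (\<lambda>\<omega>. grad_f (avg k \<omega>) \<bullet> local_grad_sum k i \<omega>)" for i
    by (rule integrable_inner[OF sq_H sq_S])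
  have nS: "Select k \<notin> past k \<union> {Batch k}" by (auto simp: past_def)
  note sel = integral_selected[OF meas nS int]
  have "(\<integral>\<omega>. grad_f (avg k \<omega>) \<bullet> update k \<omega> \<partial>P) =
      (\<integral>\<omega>. (\<Sum>i\<in>UNIV. (grad_f (avg k \<omega>) \<bullet> local_grad_sum k i \<omega>) * indicator {i} (I k \<omega>)) \<partial>P)"
    by (intro Bochner_Integration.integral_cong refl)
      (rule update_eq_sum_selected[of "\<lambda>v. grad_f (avg k \<omega>) \<bullet> v" for \<omega>])
  also have "\<dots> = (\<Sum>i\<in>UNIV. p i * (\<integral>\<omega>. grad_f (avg k \<omega>) \<bullet> local_grad_sum k i \<omega> \<partial>P))"
    by (subst Bochner_Integration.integral_sum) (auto intro!: sum.cong sel)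
  also have "\<dots> = (\<Sum>i\<in>UNIV. (\<integral>\<omega>. real m * (p i * (grad_f (avg k \<omega>) \<bullet> h i (stale k i \<omega>))) \<partial>P))"
  proof (intro sum.cong refl)
    fix i show "p i * (\<integral>\<omega>. grad_f (avg k \<omega>) \<bullet> local_grad_sum k i \<omega> \<partial>P) = (\<integral>\<omega>. real m * (p i * (grad_f (avg k \<omega>) \<bullet> h i (stale k i \<omega>))) \<partial>P)"
      by (cases "p i = 0") (simp_all add: local)
  qed
  also have "\<dots> = (\<integral>\<omega>. (\<Sum>i\<in>UNIV. real m * (p i * (grad_f (avg k \<omega>) \<bullet> h i (stale k i \<omega>)))) \<partial>P)"
  proof (rule Bochner_Integration.integral_sum[symmetric])
    fix i show "integrable P (\<lambda>\<omega>. real m * (p i * (grad_f (avg k \<omega>) \<bullet> h i (stale k i \<omega>))))"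
      by (cases "p i = 0") (auto intro!: integrable_mult_right integrable_inner[OF sq_H sq_h])
  qed
  also have "\<dots> = real m * (\<integral>\<omega>. grad_f (avg k \<omega>) \<bullet> mean_grad k \<omega> \<partial>P)"
    by (simp add: mean_grad_def inner_sum_right sum_distrib_left[symmetric])
  finally show ?thesis .
qed

section \<open>Disagreement between the workers\<close>

text \<open>
  \<open>consensus_bound k\<close> bounds \<open>E |X\<^sub>k u|\<^sup>2\<close> for unit vectors \<open>u\<close> orthogonal to the all-ones
  vector; it starts at 0 since all workers start from the same model.
\<close>

primrec consensus_bound :: "nat \<Rightarrow> real" where
  "consensus_bound 0 = 0"
| "consensus_bound (Suc k) = r * consensus_bound k + \<gamma>\<^sup>2 * (\<integral>\<omega>. (norm (update k \<omega>))\<^sup>2 \<partial>P) / (1 - r)"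

lemma consensus_bound_nonneg: "0 \<le> consensus_bound k"
  using r by (induction k) (auto intro!: add_nonneg_nonneg divide_nonneg_nonneg mult_nonneg_nonneg)

text \<open>
  The invariant of the algorithm. The bound is for deterministic directions \<open>u\<close>; by
  independence it extends to the random directions that averaging produces.
\<close>

definition controlled :: "nat \<Rightarrow> bool" where
  "controlled k \<longleftrightarrow> integrable P (\<lambda>\<omega>. f (avg k \<omega>)) \<and> square_integrable P (\<lambda>\<omega>. grad_f (avg k \<omega>)) \<and>
     (\<forall>u. u \<bullet> 1 = 0 \<longrightarrow> square_integrable P (\<lambda>\<omega>. X k \<omega> *v u) \<and>
        (\<integral>\<omega>. (norm (X k \<omega> *v u))\<^sup>2 \<partial>P) \<le> consensus_bound k * (norm u)\<^sup>2)"

text \<open>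
  \<open>X *v centred i\<close> is the deviation of the \<open>i\<close>-th local model from the mean model.
\<close>

definition centred :: "'n \<Rightarrow> real^'n" where
  "centred i = axis i 1 - (1 / real CARD('n)) *\<^sub>R 1"

lemma norm_one_vec_sq: "(1::real^'n) \<bullet> 1 = real CARD('n)"
  by (simp add: inner_vec_def)

lemma axis_inner_one: "axis i (1::real) \<bullet> (1::real^'n) = 1"
  by (simp add: inner_axis')

lemma centred_inner_one: "centred i \<bullet> 1 = 0"
  by (simp add: centred_def inner_diff_left axis_inner_one norm_one_vec_sq)

lemma norm_centred_sq: "(norm (centred i))\<^sup>2 = (real CARD('n) - 1) / real CARD('n)"
proof -
  have "(norm (centred i))\<^sup>2 = centred i \<bullet> axis i 1 - (centred i \<bullet> 1) / real CARD('n)"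
    unfolding power2_norm_eq_inner by (subst (2) centred_def) (simp add: inner_diff_right)
  also have "\<dots> = (real CARD('n) - 1) / real CARD('n)"
    unfolding centred_inner_one
    by (simp add: centred_def inner_diff_left inner_axis_axis inner_commute[of 1] axis_inner_one field_simps)
  finally show ?thesis .
qed

lemma stale_minus_avg: "stale k i \<omega> - avg (k - \<tau> k) \<omega> = X (k - \<tau> k) \<omega> *v centred i"
proof -
  have one: "((\<chi> i. 1) :: real^'n) = 1" by (simp add: vec_eq_iff)
  show ?thesis
    by (simp add: stale_def avg_def average_model_def column_eq_mult centred_def one
        matrix_vector_mult_diff_distrib matrix_vector_mult_scaleR)
qed

text \<open>
  The factor \<open>(n - 1)/n\<close> is the squared length of \<open>centred i\<close>.
\<close>

lemma disagreement_controlled: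
  assumes "controlled (k - \<tau> k)"
  shows "integrable P (disagreement k)"
    and "(\<integral>\<omega>. disagreement k \<omega> \<partial>P) \<le> (real CARD('n) - 1) / real CARD('n) * consensus_bound (k - \<tau> k)"
proof -
  have c: "square_integrable P (\<lambda>\<omega>. X (k - \<tau> k) \<omega> *v centred i)"
    "(\<integral>\<omega>. (norm (X (k - \<tau> k) \<omega> *v centred i))\<^sup>2 \<partial>P) \<le> consensus_bound (k - \<tau> k) * (norm (centred i))\<^sup>2" for i
    using assms centred_inner_one[of i] by (auto simp: controlled_def)
  show "integrable P (disagreement k)"
    unfolding disagreement_def[abs_def] stale_minus_avg
    using square_integrableD(2)[OF c(1)] by simp
  have "(\<integral>\<omega>. disagreement k \<omega> \<partial>P) = (\<Sum>i\<in>UNIV. p i * (\<integral>\<omega>. (norm (X (k - \<tau> k) \<omega> *v centred i))\<^sup>2 \<partial>P))"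
    unfolding disagreement_def stale_minus_avg
    using square_integrableD(2)[OF c(1)] by (subst Bochner_Integration.integral_sum) auto
  also have "\<dots> \<le> (\<Sum>i\<in>UNIV. p i * ((real CARD('n) - 1) / real CARD('n) * consensus_bound (k - \<tau> k)))"
    using c(2) p_nonneg unfolding norm_centred_sq by (intro sum_mono mult_left_mono) (auto simp: mult.commute)
  also have "\<dots> = (real CARD('n) - 1) / real CARD('n) * consensus_bound (k - \<tau> k)"
    by (simp only: sum_distrib_right[symmetric] p_sum mult_1)
  finally show "(\<integral>\<omega>. disagreement k \<omega> \<partial>P) \<le> (real CARD('n) - 1) / real CARD('n) * consensus_bound (k - \<tau> k)" .
qed

lemma mean_grad_controlled:
  assumes "controlled (k - \<tau> k)"
  shows "square_integrable P (mean_grad k)"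
proof (rule square_integrable_bound)
  have *: "(norm (mean_grad k \<omega>))\<^sup>2 \<le> 2 * (norm (grad_f (avg (k - \<tau> k) \<omega>)))\<^sup>2 + 4 * L\<^sup>2 * disagreement k \<omega>" for \<omega>
    using gradient_deviation_sq_le[where p = p and h = h and L = L, OF p_nonneg p_sum h_lip, where x = "avg (k - \<tau> k) \<omega>"
        and b = "avg (k - \<tau> k) \<omega>" and a = "\<lambda>i. stale k i \<omega>"]
      norm_add_sq_le[of "grad_f (avg (k - \<tau> k) \<omega>)" "mean_grad k \<omega> - grad_f (avg (k - \<tau> k) \<omega>)"]
    by (simp add: grad_f_def[symmetric] mean_grad_def[symmetric] disagreement_def[symmetric] norm_minus_commute)
  then show "AE \<omega> in P. (norm (mean_grad k \<omega>))\<^sup>2 \<le> 2 * (norm (grad_f (avg (k - \<tau> k) \<omega>)))\<^sup>2 + 4 * L\<^sup>2 * disagreement k \<omega>"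
    by simp
  show "integrable P (\<lambda>\<omega>. 2 * (norm (grad_f (avg (k - \<tau> k) \<omega>)))\<^sup>2 + 4 * L\<^sup>2 * disagreement k \<omega>)"
    using assms disagreement_controlled(1)[OF assms] by (auto simp: controlled_def square_integrable_def)
qed simp

text \<open>
  The noise part is a constant; the rest is proportional to quantities that the descent and
  the averaging control.
\<close>

lemma update_controlled:
  assumes "controlled (k - \<tau> k)"
  shows "square_integrable P (update k)"
    and "(\<integral>\<omega>. (norm (update k \<omega>))\<^sup>2 \<partial>P) \<le> real m * (\<sigma>\<^sup>2 + 6 * real m * \<nu>\<^sup>2) +
      (real m)\<^sup>2 * (12 * L\<^sup>2 * (\<integral>\<omega>. disagreement k \<omega> \<partial>P) + 2 * (\<integral>\<omega>. (norm (mean_grad k \<omega>))\<^sup>2 \<partial>P))"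
proof -
  note dis = disagreement_controlled(1)[OF assms]
  note mean = square_integrableD(2)[OF mean_grad_controlled[OF assms]]
  let ?c = "real m * \<sigma>\<^sup>2 + (real m)\<^sup>2 * (\<integral>\<omega>. grad_energy_bound k \<omega> \<partial>P)"
  have int: "integrable P (grad_energy_bound k)"
    unfolding grad_energy_bound_def[abs_def] using dis mean by simp
  have nonneg: "0 \<le> grad_energy_bound k \<omega>" for \<omega>
    unfolding grad_energy_bound_def using disagreement_nonneg[of k \<omega>] by simp
  have c: "0 \<le> ?c"
    using nonneg by (intro add_nonneg_nonneg mult_nonneg_nonneg integral_nonneg_AE) auto
  have "(\<integral>\<^sup>+\<omega>. ennreal ((norm (update k \<omega>))\<^sup>2) \<partial>P) \<le>
      (\<integral>\<^sup>+\<omega>. ennreal (real m * \<sigma>\<^sup>2 + (real m)\<^sup>2 * grad_energy_bound k \<omega>) \<partial>P)"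
    by (rule nn_second_moment_update)
  also have "\<dots> = ennreal (\<integral>\<omega>. real m * \<sigma>\<^sup>2 + (real m)\<^sup>2 * grad_energy_bound k \<omega> \<partial>P)"
    using int nonneg by (intro nn_integral_eq_integral) auto
  also have "(\<integral>\<omega>. real m * \<sigma>\<^sup>2 + (real m)\<^sup>2 * grad_energy_bound k \<omega> \<partial>P) = ?c"
    using int by (simp add: prob_space)
  finally have le: "(\<integral>\<^sup>+\<omega>. ennreal ((norm (update k \<omega>))\<^sup>2) \<partial>P) \<le> ennreal ?c" .
  show "square_integrable P (update k)"
    by (rule square_integrable_nn_integral(1)[OF _ le c]) simp
  have "(\<integral>\<omega>. (norm (update k \<omega>))\<^sup>2 \<partial>P) \<le> ?c"
    by (rule square_integrable_nn_integral(2)[OF _ le c]) simp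
  also have "(\<integral>\<omega>. grad_energy_bound k \<omega> \<partial>P) =
      12 * L\<^sup>2 * (\<integral>\<omega>. disagreement k \<omega> \<partial>P) + 6 * \<nu>\<^sup>2 + 2 * (\<integral>\<omega>. (norm (mean_grad k \<omega>))\<^sup>2 \<partial>P)"
    unfolding grad_energy_bound_def using dis mean by (simp add: prob_space)
  finally show "(\<integral>\<omega>. (norm (update k \<omega>))\<^sup>2 \<partial>P) \<le> real m * (\<sigma>\<^sup>2 + 6 * real m * \<nu>\<^sup>2) +
      (real m)\<^sup>2 * (12 * L\<^sup>2 * (\<integral>\<omega>. disagreement k \<omega> \<partial>P) + 2 * (\<integral>\<omega>. (norm (mean_grad k \<omega>))\<^sup>2 \<partial>P))"
    by (simp add: algebra_simps power2_eq_square)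
qed

lemma avg_Suc: "AE \<omega> in P. avg (Suc k) \<omega> = avg k \<omega> - (\<gamma> / real CARD('n)) *\<^sub>R update k \<omega>"
  using W_stoch[of k] AE_space
proof eventually_elim
  fix \<omega> assume W: "doubly_stochastic (W k \<omega>)" and \<omega>: "\<omega> \<in> space P"
  have one: "((\<chi> i. 1) :: real^'n) = 1" by (simp add: vec_eq_iff)
  show "avg (Suc k) \<omega> = avg k \<omega> - (\<gamma> / real CARD('n)) *\<^sub>R update k \<omega>"
    unfolding avg_def average_model_def one X_Suc_mult[OF \<omega>] doubly_stochastic_mult_one[OF W]
    by (simp add: scaleR_diff_right)
qed

lemma X_0_mult:
  assumes "\<omega> \<in> space P"
  shows "X 0 \<omega> *v u = (u \<bullet> 1) *\<^sub>R x0 \<omega>"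
proof -
  have "X 0 \<omega> $ l $ i = x0 \<omega> $ l" for l i
    using X_0[OF assms, of i] by (auto simp: column_def vec_eq_iff)
  then show ?thesis
    by (simp add: vec_eq_iff matrix_vector_mult_def inner_vec_def sum_distrib_left mult.commute)
qed

lemma avg_0:
  assumes "\<omega> \<in> space P"
  shows "avg 0 \<omega> = x0 \<omega>"
proof -
  have one: "((\<chi> i. 1) :: real^'n) = 1" by (simp add: vec_eq_iff)
  show ?thesis
    unfolding avg_def average_model_def one X_0_mult[OF assms] norm_one_vec_sq by simp
qed

lemma controlled_0: "controlled 0"
proof -
  have f: "integrable P (\<lambda>\<omega>. f (avg 0 \<omega>))"
    using f_x0_int by (subst Bochner_Integration.integrable_cong[OF refl, of _ _ "\<lambda>\<omega>. f (x0 \<omega>)"]) (auto simp: avg_0)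
  have "square_integrable P (\<lambda>\<omega>. grad_f (avg 0 \<omega>))"
    by (rule square_integrable_bound[of _ _ "\<lambda>\<omega>. 2 * (L + 1) * (f (avg 0 \<omega>) - fmin)"])
      (use f lipschitz_gradient_norm_bound[OF f_GDERIV grad_f_lip f_lower] in auto)
  moreover have "square_integrable P (\<lambda>\<omega>. X 0 \<omega> *v u) \<and> (\<integral>\<omega>. (norm (X 0 \<omega> *v u))\<^sup>2 \<partial>P) \<le> consensus_bound 0 * (norm u)\<^sup>2"
    if "u \<bullet> 1 = 0" for u
  proof -
    have z: "X 0 \<omega> *v u = 0" if "\<omega> \<in> space P" for \<omega> using X_0_mult[OF that, of u] \<open>u \<bullet> 1 = 0\<close> by simp
    have "integrable P (\<lambda>\<omega>. (norm (X 0 \<omega> *v u))\<^sup>2)"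
      by (subst Bochner_Integration.integrable_cong[OF refl, of _ _ "\<lambda>\<omega>. 0"]) (auto simp: z)
    moreover have "(\<integral>\<omega>. (norm (X 0 \<omega> *v u))\<^sup>2 \<partial>P) = (\<integral>\<omega>. 0 \<partial>P)"
      by (rule Bochner_Integration.integral_cong) (auto simp: z)
    ultimately show ?thesis by (auto simp: square_integrable_def)
  qed
  ultimately show ?thesis using f by (auto simp: controlled_def)
qed

text \<open>
  The direction \<open>W\<^sub>k u\<close> depends only on step \<open>k\<close>, and \<open>X\<^sub>k\<close> only on earlier sources.
  Conditionally on the direction the invariant applies, and the expected squared length of
  the direction has contracted.
\<close>

lemma averaging_contracts:
  assumes "controlled k" and u: "u \<bullet> 1 = 0"
  shows "square_integrable P (\<lambda>\<omega>. X k \<omega> *v (W k \<omega> *v u))"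
    and "(\<integral>\<omega>. (norm (X k \<omega> *v (W k \<omega> *v u)))\<^sup>2 \<partial>P) \<le> r\<^sup>2 * (consensus_bound k * (norm u)\<^sup>2)"
proof -
  note [measurable] = W_meas
  have ind: "independent_rv borel (\<lambda>\<omega>. W k \<omega> *v u) borel (X k)"
  proof (rule independent_info[of "{Select k}" "past k"])
    have [measurable]: "W k \<in> borel_measurable (info {Select k})"
      by (rule measurable_info_Select) simp
    show "(\<lambda>\<omega>. W k \<omega> *v u) \<in> borel_measurable (info {Select k})" by measurable
    show "{Select k} \<inter> past k = {}" by (auto simp: past_def)
  qed (rule measurable_X_past)
  have \<phi>: "(\<lambda>z. ennreal ((norm (snd z *v fst z))\<^sup>2)) \<in> borel_measurable (borel \<Otimes>\<^sub>M borel :: ((real^'n) \<times> (real^'n^'d)) measure)"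
    by measurable
  have "(\<integral>\<^sup>+\<omega>. ennreal ((norm (X k \<omega> *v (W k \<omega> *v u)))\<^sup>2) \<partial>P) =
      (\<integral>\<^sup>+\<omega>. \<integral>\<^sup>+\<omega>'. ennreal ((norm (X k \<omega>' *v (W k \<omega> *v u)))\<^sup>2) \<partial>P \<partial>P)"
    using nn_integral_independent_copy[OF ind \<phi>] by simp
  also have "\<dots> \<le> (\<integral>\<^sup>+\<omega>. ennreal (consensus_bound k * (norm (W k \<omega> *v u))\<^sup>2) \<partial>P)"
  proof (rule nn_integral_mono_AE)
    show "AE \<omega> in P. (\<integral>\<^sup>+\<omega>'. ennreal ((norm (X k \<omega>' *v (W k \<omega> *v u)))\<^sup>2) \<partial>P) \<le>
        ennreal (consensus_bound k * (norm (W k \<omega> *v u))\<^sup>2)"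
      using W_stoch[of k]
    proof eventually_elim
      fix \<omega> assume "doubly_stochastic (W k \<omega>)"
      then have "(W k \<omega> *v u) \<bullet> 1 = 0" using u by (simp add: doubly_stochastic_inner_one)
      then have "square_integrable P (\<lambda>\<omega>'. X k \<omega>' *v (W k \<omega> *v u))"
        "(\<integral>\<omega>'. (norm (X k \<omega>' *v (W k \<omega> *v u)))\<^sup>2 \<partial>P) \<le> consensus_bound k * (norm (W k \<omega> *v u))\<^sup>2"
        using assms(1) by (auto simp: controlled_def)
      then show "(\<integral>\<^sup>+\<omega>'. ennreal ((norm (X k \<omega>' *v (W k \<omega> *v u)))\<^sup>2) \<partial>P) \<le>
          ennreal (consensus_bound k * (norm (W k \<omega> *v u))\<^sup>2)"
        by (subst nn_integral_eq_integral) (auto simp: square_integrable_def intro!: ennreal_leI)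
    qed
  qed
  also have "\<dots> = ennreal (consensus_bound k * (\<integral>\<omega>. (norm (W k \<omega> *v u))\<^sup>2 \<partial>P))"
    using square_integrableD(2)[OF contraction_int[OF u, of k]] consensus_bound_nonneg[of k]
    by (subst nn_integral_eq_integral) auto
  also have "\<dots> \<le> ennreal (r\<^sup>2 * (consensus_bound k * (norm u)\<^sup>2))"
    using mult_left_mono[OF contraction[OF u, of k] consensus_bound_nonneg[of k]]
    by (intro ennreal_leI) (simp add: algebra_simps)
  finally have le: "(\<integral>\<^sup>+\<omega>. ennreal ((norm (X k \<omega> *v (W k \<omega> *v u)))\<^sup>2) \<partial>P) \<le>
      ennreal (r\<^sup>2 * (consensus_bound k * (norm u)\<^sup>2))" .
  have nonneg: "0 \<le> r\<^sup>2 * (consensus_bound k * (norm u)\<^sup>2)" using consensus_bound_nonneg[of k] by simp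
  show "square_integrable P (\<lambda>\<omega>. X k \<omega> *v (W k \<omega> *v u))"
    and "(\<integral>\<omega>. (norm (X k \<omega> *v (W k \<omega> *v u)))\<^sup>2 \<partial>P) \<le> r\<^sup>2 * (consensus_bound k * (norm u)\<^sup>2)"
    by (rule square_integrable_nn_integral[OF _ le nonneg]; measurable)+
qed

text \<open>
  The gradient at the new mean model stays square integrable by the Lipschitz property, its
  loss stays integrable by the descent inequality and the lower bound, and the bound on the
  deviations follows from the weighted Young inequality.
\<close>

lemma controlled_Suc:
  assumes k: "controlled k" and upd: "square_integrable P (update k)"
  shows "controlled (Suc k)"
proof -
  note [measurable] = I_meas W_meas
  define d where "d \<omega> = (\<gamma> / real CARD('n)) *\<^sub>R update k \<omega>" for \<omega>
  have [measurable]: "d \<in> borel_measurable P" unfolding d_def[abs_def] by measurable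
  have d: "square_integrable P d" unfolding d_def[abs_def] by (rule square_integrable_scaleR[OF upd])
  have step: "AE \<omega> in P. avg (Suc k) \<omega> = avg k \<omega> - d \<omega>" using avg_Suc[of k] by (simp add: d_def)
  have L: "0 \<le> L" by (rule lipschitz_on_nonneg[OF grad_f_lip])
  have Hk: "square_integrable P (\<lambda>\<omega>. grad_f (avg k \<omega>))" and fk: "integrable P (\<lambda>\<omega>. f (avg k \<omega>))"
    using k by (auto simp: controlled_def)
  have "square_integrable P (\<lambda>\<omega>. grad_f (avg (Suc k) \<omega>) - grad_f (avg k \<omega>))"
  proof (rule square_integrable_bound[of _ _ "\<lambda>\<omega>. L\<^sup>2 * (norm (d \<omega>))\<^sup>2"])
    show "AE \<omega> in P. (norm (grad_f (avg (Suc k) \<omega>) - grad_f (avg k \<omega>)))\<^sup>2 \<le> L\<^sup>2 * (norm (d \<omega>))\<^sup>2"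
      using step
    proof eventually_elim
      fix \<omega> assume "avg (Suc k) \<omega> = avg k \<omega> - d \<omega>"
      then show "(norm (grad_f (avg (Suc k) \<omega>) - grad_f (avg k \<omega>)))\<^sup>2 \<le> L\<^sup>2 * (norm (d \<omega>))\<^sup>2"
        using lipschitz_on_UNIV_sq[OF grad_f_lip, of "avg (Suc k) \<omega>" "avg k \<omega>"] by simp
    qed
  qed (use square_integrableD(2)[OF d] in auto)
  from square_integrable_add[OF Hk this]
  have HS: "square_integrable P (\<lambda>\<omega>. grad_f (avg (Suc k) \<omega>))" by simp
  have fS: "integrable P (\<lambda>\<omega>. f (avg (Suc k) \<omega>))"
  proof (rule Bochner_Integration.integrable_bound)
    show "integrable P (\<lambda>\<omega>. \<bar>fmin\<bar> + \<bar>f (avg k \<omega>)\<bar> + (norm (grad_f (avg k \<omega>)))\<^sup>2 + (1 + L / 2) * (norm (d \<omega>))\<^sup>2)"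
      using fk square_integrableD(2)[OF Hk] square_integrableD(2)[OF d] by simp
    show "AE \<omega> in P. norm (f (avg (Suc k) \<omega>)) \<le>
        norm (\<bar>fmin\<bar> + \<bar>f (avg k \<omega>)\<bar> + (norm (grad_f (avg k \<omega>)))\<^sup>2 + (1 + L / 2) * (norm (d \<omega>))\<^sup>2)"
      using step
    proof eventually_elim
      fix \<omega> assume eq: "avg (Suc k) \<omega> = avg k \<omega> - d \<omega>"
      have "f (avg (Suc k) \<omega>) \<le> f (avg k \<omega>) + grad_f (avg k \<omega>) \<bullet> (- d \<omega>) + L / 2 * (norm (d \<omega>))\<^sup>2"
        using lipschitz_gradient_upper_bound[OF f_GDERIV grad_f_lip, of "avg (Suc k) \<omega>" "avg k \<omega>"] by (simp add: eq)
      moreover have "grad_f (avg k \<omega>) \<bullet> (- d \<omega>) \<le> (norm (grad_f (avg k \<omega>)))\<^sup>2 + (norm (d \<omega>))\<^sup>2"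
        using abs_inner_le_sq[of "grad_f (avg k \<omega>)" "- d \<omega>"] by simp
      ultimately have "f (avg (Suc k) \<omega>) \<le> \<bar>f (avg k \<omega>)\<bar> + (norm (grad_f (avg k \<omega>)))\<^sup>2 + (1 + L / 2) * (norm (d \<omega>))\<^sup>2"
        by (simp add: algebra_simps)
      moreover have "fmin \<le> f (avg (Suc k) \<omega>)" by (rule f_lower)
      moreover have "0 \<le> (norm (grad_f (avg k \<omega>)))\<^sup>2 + (1 + L / 2) * (norm (d \<omega>))\<^sup>2" using L by simp
      ultimately show "norm (f (avg (Suc k) \<omega>)) \<le>
          norm (\<bar>fmin\<bar> + \<bar>f (avg k \<omega>)\<bar> + (norm (grad_f (avg k \<omega>)))\<^sup>2 + (1 + L / 2) * (norm (d \<omega>))\<^sup>2)"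
        unfolding real_norm_def by linarith
    qed
  qed measurable
  have "square_integrable P (\<lambda>\<omega>. X (Suc k) \<omega> *v u) \<and>
      (\<integral>\<omega>. (norm (X (Suc k) \<omega> *v u))\<^sup>2 \<partial>P) \<le> consensus_bound (Suc k) * (norm u)\<^sup>2" if u: "u \<bullet> 1 = 0" for u
  proof -
    let ?A = "\<lambda>\<omega>. X k \<omega> *v (W k \<omega> *v u)"
    let ?B = "\<lambda>\<omega>. (- \<gamma> * u $ I k \<omega>) *\<^sub>R update k \<omega>"
    note A = averaging_contracts[OF k u]
    have Bm: "?B \<in> borel_measurable P" by measurable
    have Ble: "(norm (?B \<omega>))\<^sup>2 \<le> \<gamma>\<^sup>2 * (norm u)\<^sup>2 * (norm (update k \<omega>))\<^sup>2" for \<omega>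
    proof -
      have "(u $ I k \<omega>)\<^sup>2 \<le> (norm u)\<^sup>2"
        using component_le_norm_cart[of u "I k \<omega>"] by (metis abs_le_square_iff abs_norm_cancel)
      then show ?thesis
        by (auto simp: power_mult_distrib intro!: mult_right_mono mult_left_mono)
    qed
    have B: "square_integrable P ?B"
      by (rule square_integrable_bound[OF Bm, of "\<lambda>\<omega>. \<gamma>\<^sup>2 * (norm u)\<^sup>2 * (norm (update k \<omega>))\<^sup>2"])
        (use Ble square_integrableD(2)[OF upd] in auto)
    have "(\<integral>\<omega>. (norm (?B \<omega>))\<^sup>2 \<partial>P) \<le> (\<integral>\<omega>. \<gamma>\<^sup>2 * (norm u)\<^sup>2 * (norm (update k \<omega>))\<^sup>2 \<partial>P)"
      using square_integrableD(2)[OF B] square_integrableD(2)[OF upd] by (intro integral_mono Ble) auto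
    then have Bi: "(\<integral>\<omega>. (norm (?B \<omega>))\<^sup>2 \<partial>P) \<le> \<gamma>\<^sup>2 * (norm u)\<^sup>2 * (\<integral>\<omega>. (norm (update k \<omega>))\<^sup>2 \<partial>P)" by simp
    have eq: "X (Suc k) \<omega> *v u = ?A \<omega> + ?B \<omega>" if "\<omega> \<in> space P" for \<omega>
      using X_Suc_mult[OF that, of k u] by simp
    have "square_integrable P (\<lambda>\<omega>. ?A \<omega> + ?B \<omega>)" by (rule square_integrable_add[OF A(1) B])
    then have "square_integrable P (\<lambda>\<omega>. X (Suc k) \<omega> *v u)"
      unfolding square_integrable_def
      using measurable_cong[of P "\<lambda>\<omega>. X (Suc k) \<omega> *v u" "\<lambda>\<omega>. ?A \<omega> + ?B \<omega>" borel] eq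
        Bochner_Integration.integrable_cong[OF refl, of P "\<lambda>\<omega>. (norm (X (Suc k) \<omega> *v u))\<^sup>2" "\<lambda>\<omega>. (norm (?A \<omega> + ?B \<omega>))\<^sup>2"]
      by auto
    moreover have "(\<integral>\<omega>. (norm (X (Suc k) \<omega> *v u))\<^sup>2 \<partial>P) = (\<integral>\<omega>. (norm (?A \<omega> + ?B \<omega>))\<^sup>2 \<partial>P)"
      by (rule Bochner_Integration.integral_cong[OF refl]) (simp only: eq)
    moreover have "\<dots> \<le> r * (consensus_bound k * (norm u)\<^sup>2) + \<gamma>\<^sup>2 * (norm u)\<^sup>2 * (\<integral>\<omega>. (norm (update k \<omega>))\<^sup>2 \<partial>P) / (1 - r)"
      by (rule integral_norm_add_sq_weighted[OF A(1) B A(2) Bi r])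
    moreover have "\<dots> = consensus_bound (Suc k) * (norm u)\<^sup>2"
      using r by (simp add: field_simps)
    ultimately show ?thesis by simp
  qed
  then show ?thesis using HS fS by (auto simp: controlled_def)
qed

lemma controlled: "controlled k"
proof (induction k rule: less_induct)
  case (less k)
  show ?case
  proof (cases k)
    case 0
    then show ?thesis using controlled_0 by simp
  next
    case (Suc l)
    have "controlled (l - \<tau> l)" "controlled l" using less.IH Suc by auto
    then show ?thesis using controlled_Suc update_controlled(1) Suc by blast
  qed
qed

section \<open>Descent of the mean model\<close>

lemma avg_drift: "AE \<omega> in P. avg (j + t) \<omega> = avg j \<omega> - (\<gamma> / real CARD('n)) *\<^sub>R (\<Sum>l\<in>{j..<j + t}. update l \<omega>)"
proof (induction t)
  case (Suc t)
  from Suc avg_Suc[of "j + t"] show ?case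
    by eventually_elim (simp add: scaleR_add_right)
qed simp

lemma expected_drift:
  "integrable P (\<lambda>\<omega>. (norm (avg k \<omega> - avg (k - \<tau> k) \<omega>))\<^sup>2)"
  "(\<integral>\<omega>. (norm (avg k \<omega> - avg (k - \<tau> k) \<omega>))\<^sup>2 \<partial>P) \<le>
    (\<gamma> / real CARD('n))\<^sup>2 * (real T * (\<Sum>l\<in>{k - \<tau> k..<k}. (\<integral>\<omega>. (norm (update l \<omega>))\<^sup>2 \<partial>P)))"
proof -
  let ?n = "real CARD('n)" and ?S = "{k - \<tau> k..<k}"
  have upd: "square_integrable P (update l)" for l by (rule update_controlled(1)[OF controlled])
  have B: "integrable P (\<lambda>\<omega>. (\<gamma> / ?n)\<^sup>2 * (real T * (\<Sum>l\<in>?S. (norm (update l \<omega>))\<^sup>2)))"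
    using square_integrableD(2)[OF upd] by simp
  have card: "card ?S = \<tau> k" using tau_le[of k] by simp
  have ae: "AE \<omega> in P. (norm (avg k \<omega> - avg (k - \<tau> k) \<omega>))\<^sup>2 \<le> (\<gamma> / ?n)\<^sup>2 * (real T * (\<Sum>l\<in>?S. (norm (update l \<omega>))\<^sup>2))"
    using avg_drift[of "k - \<tau> k" "\<tau> k"]
  proof eventually_elim
    fix \<omega> assume "avg (k - \<tau> k + \<tau> k) \<omega> = avg (k - \<tau> k) \<omega> - (\<gamma> / ?n) *\<^sub>R (\<Sum>l\<in>{k - \<tau> k..<k - \<tau> k + \<tau> k}. update l \<omega>)"
    then have "avg k \<omega> - avg (k - \<tau> k) \<omega> = - ((\<gamma> / ?n) *\<^sub>R (\<Sum>l\<in>?S. update l \<omega>))"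
      using tau_le[of k] by simp
    then have "(norm (avg k \<omega> - avg (k - \<tau> k) \<omega>))\<^sup>2 = (\<gamma> / ?n)\<^sup>2 * (norm (\<Sum>l\<in>?S. update l \<omega>))\<^sup>2"
      by (simp add: power_mult_distrib power_divide)
    also have "\<dots> \<le> (\<gamma> / ?n)\<^sup>2 * (real (card ?S) * (\<Sum>l\<in>?S. (norm (update l \<omega>))\<^sup>2))"
      by (intro mult_left_mono norm_sum_sq_le_card) auto
    also have "\<dots> \<le> (\<gamma> / ?n)\<^sup>2 * (real T * (\<Sum>l\<in>?S. (norm (update l \<omega>))\<^sup>2))"
      unfolding card using tau_bound[of k] by (intro mult_left_mono mult_right_mono sum_nonneg) auto
    finally show "(norm (avg k \<omega> - avg (k - \<tau> k) \<omega>))\<^sup>2 \<le> (\<gamma> / ?n)\<^sup>2 * (real T * (\<Sum>l\<in>?S. (norm (update l \<omega>))\<^sup>2))" .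
  qed
  have "square_integrable P (\<lambda>\<omega>. avg k \<omega> - avg (k - \<tau> k) \<omega>)"
    by (rule square_integrable_bound[OF _ B ae]) measurable
  then show int: "integrable P (\<lambda>\<omega>. (norm (avg k \<omega> - avg (k - \<tau> k) \<omega>))\<^sup>2)"
    by (rule square_integrableD)
  have "(\<integral>\<omega>. (norm (avg k \<omega> - avg (k - \<tau> k) \<omega>))\<^sup>2 \<partial>P) \<le>
      (\<integral>\<omega>. (\<gamma> / ?n)\<^sup>2 * (real T * (\<Sum>l\<in>?S. (norm (update l \<omega>))\<^sup>2)) \<partial>P)"
    by (rule integral_mono_AE[OF int B ae])
  also have "\<dots> = (\<gamma> / ?n)\<^sup>2 * (real T * (\<Sum>l\<in>?S. (\<integral>\<omega>. (norm (update l \<omega>))\<^sup>2 \<partial>P)))"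
    using square_integrableD(2)[OF upd] by simp
  finally show "(\<integral>\<omega>. (norm (avg k \<omega> - avg (k - \<tau> k) \<omega>))\<^sup>2 \<partial>P) \<le>
    (\<gamma> / ?n)\<^sup>2 * (real T * (\<Sum>l\<in>?S. (\<integral>\<omega>. (norm (update l \<omega>))\<^sup>2 \<partial>P)))" .
qed

text \<open>
  By polarisation the inner product of the global gradient with the mean of the local
  gradients is half the sum of their squares minus half the square of their difference. That
  difference is bounded by the drift and the disagreement.
\<close>

lemma expected_descent:
  "(\<integral>\<omega>. f (avg (Suc k) \<omega>) \<partial>P) \<le> (\<integral>\<omega>. f (avg k \<omega>) \<partial>P)
    - \<gamma> * real m / (2 * real CARD('n)) * ((\<integral>\<omega>. (norm (grad_f (avg k \<omega>)))\<^sup>2 \<partial>P) + (\<integral>\<omega>. (norm (mean_grad k \<omega>))\<^sup>2 \<partial>P))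
    + \<gamma> * real m / real CARD('n) * L\<^sup>2 *
      ((\<integral>\<omega>. (norm (avg k \<omega> - avg (k - \<tau> k) \<omega>))\<^sup>2 \<partial>P) + (\<integral>\<omega>. disagreement k \<omega> \<partial>P))
    + L * \<gamma>\<^sup>2 / (2 * (real CARD('n))\<^sup>2) * (\<integral>\<omega>. (norm (update k \<omega>))\<^sup>2 \<partial>P)"
proof -
  let ?n = "real CARD('n)"
  have upd: "square_integrable P (update k)" by (rule update_controlled(1)[OF controlled])
  have mean: "square_integrable P (mean_grad k)" by (rule mean_grad_controlled[OF controlled])
  have dis: "integrable P (disagreement k)" by (rule disagreement_controlled(1)[OF controlled])
  have Hk: "square_integrable P (\<lambda>\<omega>. grad_f (avg k \<omega>))" and fk: "integrable P (\<lambda>\<omega>. f (avg k \<omega>))"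
    and fS: "integrable P (\<lambda>\<omega>. f (avg (Suc k) \<omega>))"
    using controlled[of k] controlled[of "Suc k"] by (auto simp: controlled_def)
  note iU = integrable_inner[OF Hk upd] and iM = integrable_inner[OF Hk mean]
  note sq = square_integrableD(2)[OF upd] square_integrableD(2)[OF mean] square_integrableD(2)[OF Hk] expected_drift(1)[of k]
  have "(\<integral>\<omega>. f (avg (Suc k) \<omega>) \<partial>P) \<le>
      (\<integral>\<omega>. f (avg k \<omega>) - \<gamma> / ?n * (grad_f (avg k \<omega>) \<bullet> update k \<omega>) + L * \<gamma>\<^sup>2 / (2 * ?n\<^sup>2) * (norm (update k \<omega>))\<^sup>2 \<partial>P)"
  proof (rule integral_mono_AE[OF fS])
    show "AE \<omega> in P. f (avg (Suc k) \<omega>) \<le>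
        f (avg k \<omega>) - \<gamma> / ?n * (grad_f (avg k \<omega>) \<bullet> update k \<omega>) + L * \<gamma>\<^sup>2 / (2 * ?n\<^sup>2) * (norm (update k \<omega>))\<^sup>2"
      using avg_Suc[of k]
    proof eventually_elim
      fix \<omega> assume eq: "avg (Suc k) \<omega> = avg k \<omega> - (\<gamma> / ?n) *\<^sub>R update k \<omega>"
      show "f (avg (Suc k) \<omega>) \<le>
        f (avg k \<omega>) - \<gamma> / ?n * (grad_f (avg k \<omega>) \<bullet> update k \<omega>) + L * \<gamma>\<^sup>2 / (2 * ?n\<^sup>2) * (norm (update k \<omega>))\<^sup>2"
        using lipschitz_gradient_upper_bound[OF f_GDERIV grad_f_lip, of "avg (Suc k) \<omega>" "avg k \<omega>"]
        by (simp add: eq power_mult_distrib power_divide)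
    qed
  qed (use fk iU sq in simp)
  also have "\<dots> = (\<integral>\<omega>. f (avg k \<omega>) \<partial>P) - \<gamma> / ?n * (\<integral>\<omega>. grad_f (avg k \<omega>) \<bullet> update k \<omega> \<partial>P)
      + L * \<gamma>\<^sup>2 / (2 * ?n\<^sup>2) * (\<integral>\<omega>. (norm (update k \<omega>))\<^sup>2 \<partial>P)"
    using fk iU sq by simp
  finally have desc: "(\<integral>\<omega>. f (avg (Suc k) \<omega>) \<partial>P) \<le> (\<integral>\<omega>. f (avg k \<omega>) \<partial>P)
      - \<gamma> / ?n * (real m * (\<integral>\<omega>. grad_f (avg k \<omega>) \<bullet> mean_grad k \<omega> \<partial>P))
      + L * \<gamma>\<^sup>2 / (2 * ?n\<^sup>2) * (\<integral>\<omega>. (norm (update k \<omega>))\<^sup>2 \<partial>P)"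
    unfolding inner_update[OF Hk upd dis mean] .
  have "(\<integral>\<omega>. ((norm (grad_f (avg k \<omega>)))\<^sup>2 + (norm (mean_grad k \<omega>))\<^sup>2) / 2
        - L\<^sup>2 * ((norm (avg k \<omega> - avg (k - \<tau> k) \<omega>))\<^sup>2 + disagreement k \<omega>) \<partial>P)
      \<le> (\<integral>\<omega>. grad_f (avg k \<omega>) \<bullet> mean_grad k \<omega> \<partial>P)"
  proof (rule integral_mono)
    fix \<omega>
    have "(norm (grad_f (avg k \<omega>) - mean_grad k \<omega>))\<^sup>2 \<le>
        2 * L\<^sup>2 * (norm (avg k \<omega> - avg (k - \<tau> k) \<omega>))\<^sup>2 + 2 * L\<^sup>2 * disagreement k \<omega>"
      unfolding grad_f_def mean_grad_def disagreement_def
      by (rule gradient_deviation_sq_le[OF p_nonneg p_sum h_lip])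
    moreover have "(norm (grad_f (avg k \<omega>) - mean_grad k \<omega>))\<^sup>2 =
        (norm (grad_f (avg k \<omega>)))\<^sup>2 + (norm (mean_grad k \<omega>))\<^sup>2 - 2 * (grad_f (avg k \<omega>) \<bullet> mean_grad k \<omega>)"
      unfolding power2_norm_eq_inner by (simp add: inner_diff_left inner_diff_right inner_commute)
    ultimately show "((norm (grad_f (avg k \<omega>)))\<^sup>2 + (norm (mean_grad k \<omega>))\<^sup>2) / 2
        - L\<^sup>2 * ((norm (avg k \<omega> - avg (k - \<tau> k) \<omega>))\<^sup>2 + disagreement k \<omega>) \<le> grad_f (avg k \<omega>) \<bullet> mean_grad k \<omega>"
      by (simp add: algebra_simps)
  qed (use sq iM dis in simp_all)
  then have "((\<integral>\<omega>. (norm (grad_f (avg k \<omega>)))\<^sup>2 \<partial>P) + (\<integral>\<omega>. (norm (mean_grad k \<omega>))\<^sup>2 \<partial>P)) / 2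
      - L\<^sup>2 * ((\<integral>\<omega>. (norm (avg k \<omega> - avg (k - \<tau> k) \<omega>))\<^sup>2 \<partial>P) + (\<integral>\<omega>. disagreement k \<omega> \<partial>P))
      \<le> (\<integral>\<omega>. grad_f (avg k \<omega>) \<bullet> mean_grad k \<omega> \<partial>P)"
    using sq dis by simp
  then have "\<gamma> / ?n * real m * (((\<integral>\<omega>. (norm (grad_f (avg k \<omega>)))\<^sup>2 \<partial>P) + (\<integral>\<omega>. (norm (mean_grad k \<omega>))\<^sup>2 \<partial>P)) / 2
      - L\<^sup>2 * ((\<integral>\<omega>. (norm (avg k \<omega> - avg (k - \<tau> k) \<omega>))\<^sup>2 \<partial>P) + (\<integral>\<omega>. disagreement k \<omega> \<partial>P)))
      \<le> \<gamma> / ?n * real m * (\<integral>\<omega>. grad_f (avg k \<omega>) \<bullet> mean_grad k \<omega> \<partial>P)"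
    using gamma by (intro mult_left_mono) auto
  then show ?thesis
    using desc by (simp add: algebra_simps add_divide_distrib diff_divide_distrib)
qed

theorem average_gradient_bound:
  fixes T' :: real
  assumes m: "1 \<le> m" and K: "1 \<le> K" and T: "real T \<le> T'"
    and C1: "0 < C1 (real CARD('n)) (real m) L T' (r\<^sup>2) \<gamma>"
    and C2: "0 \<le> C2 (real CARD('n)) (real m) L T' (r\<^sup>2) \<gamma>"
    and C3: "C3 (real CARD('n)) (real m) L T' (r\<^sup>2) \<gamma> \<le> 1"
  shows "(\<Sum>k<K. \<integral>\<omega>. (norm (grad_f (avg k \<omega>)))\<^sup>2 \<partial>P) / real K
    \<le> 2 * ((\<integral>\<omega>. f (x0 \<omega>) \<partial>P) - fmin) * real CARD('n) / (\<gamma> * real K * real m)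
      + 2 * \<gamma> * L / real CARD('n) * (\<sigma>\<^sup>2 + 6 * real m * \<nu>\<^sup>2)"
proof -
  have "fmin \<le> (\<integral>\<omega>. f (avg K \<omega>) \<partial>P)"
  proof -
    have "(\<integral>\<omega>. fmin \<partial>P) \<le> (\<integral>\<omega>. f (avg K \<omega>) \<partial>P)"
      using controlled[of K] f_lower by (intro integral_mono) (auto simp: controlled_def)
    then show ?thesis by (simp add: prob_space)
  qed
  then have "(\<Sum>k<K. \<integral>\<omega>. (norm (grad_f (avg k \<omega>)))\<^sup>2 \<partial>P) / real K
    \<le> 2 * ((\<integral>\<omega>. f (avg 0 \<omega>) \<partial>P) - fmin) * real CARD('n) / (\<gamma> * real K * real m)
      + 2 * \<gamma> * L / real CARD('n) * (\<sigma>\<^sup>2 + 6 * real m * \<nu>\<^sup>2)"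
    by (intro rate_from_recursions[where \<tau> = \<tau> and T = T and T' = T' and r = r and \<beta> = consensus_bound
        and E = "\<lambda>k. \<integral>\<omega>. (norm (update k \<omega>))\<^sup>2 \<partial>P" and V = "\<lambda>k. \<integral>\<omega>. disagreement k \<omega> \<partial>P"
        and \<Gamma> = "\<lambda>k. \<integral>\<omega>. (norm (mean_grad k \<omega>))\<^sup>2 \<partial>P"
        and d = "\<lambda>k. \<integral>\<omega>. (norm (avg k \<omega> - avg (k - \<tau> k) \<omega>))\<^sup>2 \<partial>P"
        and \<phi> = "\<lambda>k. \<integral>\<omega>. f (avg k \<omega>) \<partial>P"]
      expected_descent expected_drift(2) update_controlled(2)[OF controlled]
      disagreement_controlled(2)[OF controlled] tau_le tau_bound r gamma T K C1 C2 C3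
      lipschitz_on_nonneg[OF grad_f_lip])
      (use m in \<open>auto intro!: integral_nonneg_AE simp: disagreement_nonneg Suc_le_eq\<close>)
  moreover have "(\<integral>\<omega>. f (avg 0 \<omega>) \<partial>P) = (\<integral>\<omega>. f (x0 \<omega>) \<partial>P)"
    by (rule Bochner_Integration.integral_cong) (auto simp: avg_0)
  ultimately show ?thesis by simp
qed

end

section \<open>The convergence rate\<close>

theorem theorem1:
  fixes P :: "'w measure"
    and D :: "'n::finite \<Rightarrow> 's measure"
    and F :: "'n \<Rightarrow> real^'d \<Rightarrow> 's \<Rightarrow> real"
    and p :: "'n \<Rightarrow> real"
    and x0 :: "'w \<Rightarrow> real^'d"
    and I :: "nat \<Rightarrow> 'w \<Rightarrow> 'n"
    and W :: "nat \<Rightarrow> 'w \<Rightarrow> real^'n^'n"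
    and \<xi> :: "nat \<Rightarrow> 'n \<Rightarrow> nat \<Rightarrow> 'w \<Rightarrow> 's"
    and X :: "nat \<Rightarrow> 'w \<Rightarrow> real^'n^'d"
    and \<tau> :: "nat \<Rightarrow> nat"
    and M K :: nat
    and \<gamma> L \<rho> \<sigma> \<nu> T :: real
  defines "f \<equiv> global_loss p D F"
    and "fi \<equiv> local_loss D F"
    and "n \<equiv> real CARD('n)"
  assumes prob_P: "prob_space P"
    and prob_D: "\<And>i. prob_space (D i)"
    and p_nonneg: "\<And>i. 0 \<le> p i"
    and p_sum: "(\<Sum>i\<in>UNIV. p i) = 1"
    and M: "1 \<le> M" and K: "1 \<le> K" and gamma: "0 < \<gamma>"
    and F_meas: "\<And>i. (\<lambda>(x, s). F i x s) \<in> borel_measurable (borel \<Otimes>\<^sub>M D i)"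
    and F_diff: "\<And>i x s. s \<in> space (D i) \<Longrightarrow> (\<lambda>y. F i y s) differentiable (at x)"
    and F_int: "\<And>i x. integrable (D i) (F i x)"
    and f_bdd: "bdd_below (range f)"
    and fi_diff: "\<And>i x. fi i differentiable (at x)"
    and fi_lip: "\<And>i. L-lipschitz_on UNIV (gradient (fi i))"
    and unbiased_local:
      "\<And>i x. has_bochner_integral (D i) (stoch_grad F i x) (gradient (fi i) x)"
    and unbiased_global:
      "\<And>x. (\<Sum>i\<in>UNIV. p i *\<^sub>R (\<integral>s. stoch_grad F i x s \<partial>D i)) = gradient f x"
    and sigma: "0 \<le> \<sigma>" and varsigma: "0 \<le> \<nu>"
    and var_int: "\<And>i x. integrable (D i) (\<lambda>s. (norm (stoch_grad F i x s - gradient (fi i) x))^2)"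
    and var_local: "\<And>i x. (\<integral>s. (norm (stoch_grad F i x s - gradient (fi i) x))^2 \<partial>D i) \<le> \<sigma>^2"
    and var_global: "\<And>x. (\<Sum>i\<in>UNIV. p i * (norm (gradient (fi i) x - gradient f x))^2) \<le> \<nu>^2"
    and x0_meas: "x0 \<in> borel_measurable P"
    and f_x0_int: "integrable P (\<lambda>\<omega>. f (x0 \<omega>))"
    and I_meas: "\<And>k. I k \<in> measurable P (count_space UNIV)"
    and I_law: "\<And>k i. measure P {\<omega> \<in> space P. I k \<omega> = i} = p i"
    and W_meas: "\<And>k. W k \<in> borel_measurable P"
    and xi_meas: "\<And>k i j. j < M \<Longrightarrow> \<xi> k i j \<in> measurable P (D i)"
    and xi_law: "\<And>k i j. j < M \<Longrightarrow> distr P (D i) (\<xi> k i j) = D i"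
    and batch_indep: "\<And>k i. prob_space.indep_vars P (\<lambda>_. D i) (\<lambda>j. \<xi> k i j) {..<M}"
    and indep: "prob_space.indep_sets P (source_events P D M x0 I W \<xi>) UNIV"
    and W_stoch: "\<And>k. AE \<omega> in P. doubly_stochastic (W k \<omega>)"
    and rho: "0 \<le> \<rho>" "\<rho> < 1"
    and spectral: "\<And>k. let A = (\<integral>\<omega>. transpose (W k \<omega>) ** W k \<omega> \<partial>P) in
        max \<bar>nth_largest_eigenvalue 2 A\<bar> \<bar>nth_largest_eigenvalue CARD('n) A\<bar> \<le> \<rho>"
    and tau_le: "\<And>k. \<tau> k \<le> k"
    and tau_bound: "\<And>k. real (\<tau> k) \<le> T"
    and X_0: "\<And>\<omega> i. \<omega> \<in> space P \<Longrightarrow> column i (X 0 \<omega>) = x0 \<omega>"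
    and X_Suc: "\<And>\<omega> k. \<omega> \<in> space P \<Longrightarrow>
        X (Suc k) \<omega> = X k \<omega> ** W k \<omega>
          - \<gamma> *\<^sub>R batch_grad F M (X (k - \<tau> k) \<omega>) (\<lambda>j. \<xi> k (I k \<omega>) j \<omega>) (I k \<omega>)"
    and C3: "C3 n (real M) L T \<rho> \<gamma> \<le> 1"
    and C2: "0 \<le> C2 n (real M) L T \<rho> \<gamma>"
    and C1: "0 < C1 n (real M) L T \<rho> \<gamma>"
  shows "(\<Sum>k<K. \<integral>\<omega>. (norm (gradient f (average_model (X k \<omega>))))^2 \<partial>P) / real K
    \<le> 2 * ((\<integral>\<omega>. f (x0 \<omega>) \<partial>P) - (INF x. f x)) * n / (\<gamma> * real K * real M)
      + 2 * \<gamma> * L / n * (\<sigma>^2 + 6 * real M * \<nu>^2)"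
proof -
  let ?r = "sqrt \<rho>" and ?h = "\<lambda>i. gradient (fi i)" and ?T = "nat \<lfloor>T\<rfloor>"
  have r2: "?r\<^sup>2 = \<rho>" and r: "0 \<le> ?r" "?r < 1" using rho by (auto simp: real_sqrt_lt_1_iff)
  have T0: "0 \<le> T" using tau_bound[of 0] by linarith
  have f_eq: "f = (\<lambda>x. \<Sum>i\<in>UNIV. p i * fi i x)"
    by (simp add: f_def fi_def global_loss_def fun_eq_iff)
  have f_deriv: "GDERIV f x :> (\<Sum>i\<in>UNIV. p i *\<^sub>R ?h i x)" for x
    unfolding f_eq by (rule GDERIV_weighted_sum) (rule GDERIV_gradient[OF fi_diff])
  have gradient_f: "gradient f x = (\<Sum>i\<in>UNIV. p i *\<^sub>R ?h i x)" for x
    by (rule gradient_eqI[OF f_deriv])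
  have W_contracts: "square_integrable P (\<lambda>\<omega>. W k \<omega> *v u)"
    "(\<integral>\<omega>. (norm (W k \<omega> *v u))\<^sup>2 \<partial>P) \<le> ?r\<^sup>2 * (norm u)\<^sup>2" if "u \<bullet> 1 = 0" for k u
  proof -
    have "nth_largest_eigenvalue 2 (\<integral>\<omega>. transpose (W k \<omega>) ** W k \<omega> \<partial>P) \<le> \<rho>"
      using spectral[of k] by (simp add: Let_def abs_le_iff)
    from prob_space.expected_contraction[OF prob_P W_meas W_stoch this rho(2) that]
    show "square_integrable P (\<lambda>\<omega>. W k \<omega> *v u)"
      "(\<integral>\<omega>. (norm (W k \<omega> *v u))\<^sup>2 \<partial>P) \<le> ?r\<^sup>2 * (norm u)\<^sup>2"
      by (simp_all add: r2)
  qed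
  interpret prob_space P by (rule prob_P)
  interpret adpsgd P D "stoch_grad F" ?h f "INF x. f x" p x0 I W \<xi> X \<tau> M ?T \<gamma> L ?r \<sigma> \<nu>
  proof
    show "(\<lambda>(x, s). stoch_grad F i x s) \<in> borel_measurable (borel \<Otimes>\<^sub>M D i)" for i
      by (rule measurable_stoch_grad[OF F_meas F_diff])
    show "(INF x. f x) \<le> f x" for x by (rule cINF_lower[OF f_bdd]) simp
    show "has_bochner_integral (D i) (stoch_grad F i x) (?h i x)" for i x by (rule unbiased_local)
    show "(\<Sum>i\<in>UNIV. p i * (norm (?h i x - (\<Sum>j\<in>UNIV. p j *\<^sub>R ?h j x)))\<^sup>2) \<le> \<nu>\<^sup>2" for x
      using var_global[of x] by (simp add: gradient_f)
    show "\<tau> k \<le> ?T" for k using tau_bound[of k] by (simp add: le_nat_floor)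
    show "X (Suc k) \<omega> = X k \<omega> ** W k \<omega> - \<gamma> *\<^sub>R (\<chi> l c. if c = I k \<omega>
        then (\<Sum>j<M. stoch_grad F (I k \<omega>) (column (I k \<omega>) (X (k - \<tau> k) \<omega>)) (\<xi> k (I k \<omega>) j \<omega>)) $ l else 0)"
      if "\<omega> \<in> space P" for \<omega> k
      using X_Suc[OF that, of k] by (simp only: batch_grad_def)
  qed (use assms f_deriv W_contracts r in \<open>auto simp only:\<close>)
  have "gradient f (average_model (X k \<omega>)) = grad_f (avg k \<omega>)" for k \<omega>
    by (simp add: gradient_f grad_f_def avg_def)
  moreover have "real ?T \<le> T" using T0 by (simp add: of_nat_floor)
  ultimately show ?thesis
    using average_gradient_bound[OF M K, of T] C1 C2 C3 by (simp add: r2 n_def)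
qed

end
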